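(* Let $x$ be a self-adjoint element in a unital C$^*$-algebra $\mathcal A$, let $\sigma(x)$ be the spectrum of $x$ in $\mathcal A$, and let $n\in\{1,2,\ldots\}\cup\{\infty\}$ be the cardinality of $\sigma(x)$ (with $n=\infty$ if $\sigma(x)$ is infinite). Then $$\delta_{top}(x)=1-\frac1n,$$ where $\frac1\infty=0$.
   Context: $\mathcal M_k(\mathbb C)$ is the algebra of $k\times k$ complex matrices, $\mathcal M_k^{s.a}(\mathbb C)$ its self-adjoint part, $\|\cdot\|$ the operator norm. Let $\{P_r\}_{r=1}^\infty$ be a fixed enumeration of all polynomials in $\mathbb C\langle X\rangle$ (constant terms allowed, evaluated as multiples of the identity) whose coefficients have rational real and imaginary parts. For $R,\epsilon>0$ and integers $r,k\ge1$ let $$\Gamma^{(top)}_R(x;k,\epsilon,P_1,\ldots,P_r)=\{A\in\mathcal M_k^{s.a}(\mathbb C): \|A\|\le R,\ |\|P_j(A)\|-\|P_j(x)\||\le\epsilon\ \text{ for } 1\le j\le r\}.$$ For $\Sigma\subseteq\mathcal M_k(\mathbb C)$ and $\omega>0$, $\nu_\infty(\Sigma,\omega)$ is the minimal number of open operator-norm balls of radius $\omega$ with centers in $\Sigma$ whose union covers $\Sigma$. For $0<\omega<1$ put (with $\log0=-\infty$) $$\delta_{top}(x;\omega)=\sup_{R>0}\ \inf_{\epsilon>0,\,r\in\mathbb N}\ \limsup_{k\to\infty}\frac{\log\nu_\infty(\Gamma^{(top)}_R(x;k,\epsilon,P_1,\ldots,P_r),\omega)}{-k^2\log\omega},\qquad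 \delta_{top}(x)=\limsup_{\omega\to0^+}\delta_{top}(x;\omega).$$ *)

theory Defs
  imports
    "HOL-Library.Extended_Real"
    "HOL-Library.Liminf_Limsup"
    "HOL-Computational_Algebra.Polynomial"
    "Jordan_Normal_Form.Schur_Decomposition"
begin

section \<open>Unital C*-algebras\<close>

text \<open>
  The parent classes provide a complete, submultiplicative norm with \<open>norm 1 = 1\<close>; in
  particular \<open>0 \<noteq> 1\<close>, so only the zero algebra (where every spectrum is empty) is excluded.
\<close>

class unital_cstar_algebra = real_normed_algebra_1 + banach +
  fixes scaleC :: "complex \<Rightarrow> 'a \<Rightarrow> 'a"
    and star :: "'a \<Rightarrow> 'a"
  assumes scaleC_add_right: "scaleC a (x + y) = scaleC a x + scaleC a y"
    and scaleC_add_left: "scaleC (a + b) x = scaleC a x + scaleC b x"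
    and scaleC_scaleC: "scaleC a (scaleC b x) = scaleC (a * b) x"
    and scaleC_one: "scaleC 1 x = x"
    and scaleR_scaleC: "scaleR r x = scaleC (complex_of_real r) x"
    and mult_scaleC_left: "scaleC a x * y = scaleC a (x * y)"
    and mult_scaleC_right: "x * scaleC a y = scaleC a (x * y)"
    and norm_scaleC: "norm (scaleC a x) = cmod a * norm x"
    and star_add: "star (x + y) = star x + star y"
    and star_scaleC: "star (scaleC a x) = scaleC (cnj a) (star x)"
    and star_mult: "star (x * y) = star y * star x"
    and star_star: "star (star x) = x"
    and norm_star_mult: "norm (star x * x) = (norm x)\<^sup>2"

definition cstar_spectrum :: "'a::unital_cstar_algebra \<Rightarrow> complex set" where
  "cstar_spectrum x =
     {z. \<not> (\<exists>y. (scaleC z 1 - x) * y = 1 \<and> y * (scaleC z 1 - x) = 1)}"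

definition cstar_poly :: "complex poly \<Rightarrow> 'a::unital_cstar_algebra \<Rightarrow> 'a" where
  "cstar_poly p x = (\<Sum>i\<le>degree p. scaleC (coeff p i) (x ^ i))"

section \<open>Complex matrices\<close>

definition vec_l2norm :: "complex vec \<Rightarrow> real" where
  "vec_l2norm v = sqrt (\<Sum>i<dim_vec v. (cmod (v $ i))\<^sup>2)"

definition mat_opnorm :: "complex mat \<Rightarrow> real" where
  "mat_opnorm A =
     (SUP v \<in> {v \<in> carrier_vec (dim_col A). vec_l2norm v \<le> 1}. vec_l2norm (A *\<^sub>v v))"

definition selfadjoint_mats :: "nat \<Rightarrow> complex mat set" where
  "selfadjoint_mats k = {A \<in> carrier_mat k k. mat_adjoint A = A}"

text \<open>
  The matrix polynomial \<open>\<Sum>\<^sub>l coeff p l A\<^sup>l\<close>, written entrywise because matrices of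
  a given size do not form a type. The term \<open>l = 0\<close> is a multiple of the identity.
\<close>

definition mat_poly :: "complex poly \<Rightarrow> complex mat \<Rightarrow> complex mat" where
  "mat_poly p A = mat (dim_row A) (dim_row A)
     (\<lambda>(i, j). \<Sum>l\<le>degree p. coeff p l * (A ^\<^sub>m l) $$ (i, j))"

section \<open>Topological free entropy dimension\<close>

definition rational_complex_polys :: "complex poly set" where
  "rational_complex_polys = {p. \<forall>i. Re (coeff p i) \<in> \<rat> \<and> Im (coeff p i) \<in> \<rat>}"

definition Gamma_top ::
  "(nat \<Rightarrow> complex poly) \<Rightarrow> real \<Rightarrow> 'a::unital_cstar_algebra \<Rightarrow> nat \<Rightarrow> real \<Rightarrow> nat \<Rightarrow> complex mat set"
where
  "Gamma_top P R x k \<epsilon> r = {A \<in> selfadjoint_mats k. mat_opnorm A \<le> R \<and>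
     (\<forall>j\<in>{1..r}. \<bar>mat_opnorm (mat_poly (P j) A) - norm (cstar_poly (P j) x)\<bar> \<le> \<epsilon>)}"

text \<open>The infimum over the empty family, i.e. in the absence of a finite cover, is \<open>\<infinity>\<close>.\<close>

definition covering_number :: "complex mat set \<Rightarrow> real \<Rightarrow> enat" where
  "covering_number S \<omega> =
     (INF C \<in> {C. finite C \<and> C \<subseteq> S \<and> S \<subseteq> (\<Union>A\<in>C. {B. mat_opnorm (B - A) < \<omega>})}.
        enat (card C))"

definition log_enat :: "enat \<Rightarrow> ereal" where
  "log_enat m = (case m of enat i \<Rightarrow> (if i = 0 then -\<infinity> else ereal (ln (real i))) | \<infinity> \<Rightarrow> \<infinity>)"

definition delta_top_at ::
  "(nat \<Rightarrow> complex poly) \<Rightarrow> 'a::unital_cstar_algebra \<Rightarrow> real \<Rightarrow> ereal"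
where
  "delta_top_at P x \<omega> =
     (SUP R \<in> {0<..}. INF (\<epsilon>, r) \<in> {0<..} \<times> {1..}.
        limsup (\<lambda>k. log_enat (covering_number (Gamma_top P R x k \<epsilon> r) \<omega>)
                     / ereal (- (real k)\<^sup>2 * ln \<omega>)))"

definition delta_top :: "(nat \<Rightarrow> complex poly) \<Rightarrow> 'a::unital_cstar_algebra \<Rightarrow> ereal" where
  "delta_top P x = Limsup (at_right 0) (\<lambda>\<omega>. delta_top_at P x \<omega>)"

end

theory Submission
  imports
    Defs
    "HOL-Analysis.Convex"
    "HOL-Analysis.Topology_Euclidean_Space"
    "HOL-Real_Asymp.Real_Asymp"
begin

unbundle no vec_syntax
hide_type (open) Finite_Cartesian_Product.vec
hide_const (open) Finite_Cartesian_Product.vec Finite_Cartesian_Product.mat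

text \<open>
  Let \<open>\<sigma>\<close> be the spectrum of \<open>x\<close>, a compact set of reals. A self-adjoint matrix is \<open>U diag(d) U\<^sup>*\<close>
  with \<open>U\<close> unitary, and \<open>\<parallel>p(A)\<parallel>\<close> is the largest \<open>|p(d\<^sub>i)|\<close>, just as \<open>\<parallel>p(x)\<parallel>\<close> is the largest value of
  \<open>|p|\<close> on \<open>\<sigma>\<close> (\<open>norm_cstar_poly_attained\<close>). So the matrices whose polynomials have nearly the same
  norms as those of \<open>x\<close> are nearly the matrices with all eigenvalues in \<open>\<sigma>\<close>, and the dimension of
  \<open>x\<close> is the exponent with which the covering numbers of this union of unitary orbits grow. If \<open>\<sigma>\<close>
  has \<open>n\<close> points, the orbit with multiplicities \<open>k\<^sub>1, \<dots>, k\<^sub>n\<close> is a manifold of dimension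
  \<open>k\<^sup>2 - \<Sum> k\<^sub>i\<^sup>2\<close>. By the Cauchy-Schwarz inequality this is at most \<open>k\<^sup>2 (1 - 1 / n)\<close>, with near equality
  when the multiplicities are nearly equal.

  Dimension must be turned into covering numbers with constants of the form \<open>C\<close> to the power \<open>k\<^sup>2\<close>;
  such factors are harmless, as \<open>ln C / |ln \<omega>|\<close> tends to \<open>0\<close> with \<open>\<omega>\<close>. No measure on the unitary
  group enters. The only volume-type input is that in a normed space of real dimension \<open>m\<close> the
  largest \<open>\<omega>\<close>-separated subset of a ball of radius \<open>\<rho>\<close> has between \<open>(\<rho> / \<omega>)\<^sup>m\<close> and
  \<open>(1 + 2 \<rho> / \<omega>)\<^sup>m\<close> elements, and even this is proved by counting lattice points and taking powers
  (\<open>separated_card_le\<close>, \<open>separated_in_ball_exists\<close>).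

  For the upper bound let \<open>A\<close>, \<open>A'\<close> have eigenvalues in \<open>\<sigma>\<close> and put \<open>r(t) = \<Prod> (t - m)\<close>, the product
  over the points \<open>m \<noteq> l\<close> of \<open>\<sigma>\<close>. Then \<open>r(A) (A - A') r(A') = 0\<close>. If both matrices are close to a
  diagonal matrix \<open>D\<close> of the same kind, \<open>r(A)\<close> and \<open>r(A')\<close> may be replaced by \<open>r(D)\<close>, a multiple of
  the projection onto the eigenspace of \<open>l\<close>. Hence the diagonal blocks of \<open>A - A'\<close> are negligible, and
  near \<open>D\<close> such matrices are determined, in a bi-Lipschitz way, by their off-diagonal blocks, which
  form a space of dimension \<open>k\<^sup>2 - \<Sum> k\<^sub>i\<^sup>2\<close> (\<open>off_block_determines\<close>). A net of a fixed mesh reduces the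
  problem to neighbourhoods of such points \<open>D\<close>, at the cost of a factor \<open>C\<close> to the power \<open>k\<^sup>2\<close>.

  For the lower bound take \<open>D\<close> with nearly equal multiplicities. The self-adjoint matrices near \<open>D\<close>
  fill a ball of dimension \<open>k\<^sup>2\<close>, and rounding the eigenvalues of such an \<open>H\<close> to \<open>\<sigma>\<close> gives a matrix \<open>A\<close>
  of the orbits that commutes with \<open>H\<close>. If two matrices \<open>H\<close>, \<open>H'\<close> have roundings within \<open>2 \<omega>\<close> of
  each other, then \<open>H - H'\<close> nearly commutes with \<open>D\<close>, so that it is within \<open>O(\<omega>)\<close> of a block diagonal
  matrix; the block diagonal matrices have dimension about \<open>k\<^sup>2 / n\<close>. So a covering of the orbits by
  balls of radius \<open>\<omega>\<close> needs at least about \<open>(1/\<omega>)\<close> to the power \<open>k\<^sup>2 - k\<^sup>2 / n\<close> of them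
  (\<open>spectral_class_discretization_ge\<close>).

  If \<open>\<sigma>\<close> is infinite, the exponent never exceeds \<open>1\<close>, and the lower bound applies to every finite
  subset of \<open>\<sigma>\<close>: a direct summand of bounded size, carrying points where the finitely many test
  polynomials attain their norms, turns matrices with eigenvalues in that subset into admissible ones
  (\<open>direct_sum_mem_Gamma_top\<close>).
\<close>

section \<open>The norm of a polynomial in a self-adjoint element\<close>

lemma scaleC_zero_right: "scaleC a (0::'a::unital_cstar_algebra) = 0"
  using scaleC_add_right[of a "0::'a" 0] by simp

lemma scaleC_zero_left: "scaleC 0 (x::'a::unital_cstar_algebra) = 0"
  using scaleC_add_left[of 0 0 x] by simp

lemma scaleC_minus_left: "scaleC (- a) (x::'a::unital_cstar_algebra) = - scaleC a x"
  using scaleC_add_left[of a "- a" x] by (simp add: scaleC_zero_left add_eq_0_iff)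

lemma scaleC_minus_right: "scaleC a (- x::'a::unital_cstar_algebra) = - scaleC a x"
  using scaleC_add_right[of a x "- x"] by (simp add: scaleC_zero_right add_eq_0_iff)

lemma scaleC_diff_left: "scaleC (a - b) (x::'a::unital_cstar_algebra) = scaleC a x - scaleC b x"
  using scaleC_add_left[of a "- b" x] by (simp add: scaleC_minus_left)

lemma scaleC_diff_right: "scaleC a (x - y::'a::unital_cstar_algebra) = scaleC a x - scaleC a y"
  using scaleC_add_right[of a x "- y"] by (simp add: scaleC_minus_right)

lemma scaleC_sum_right:
  "scaleC a (\<Sum>i\<in>A. f i :: 'a::unital_cstar_algebra) = (\<Sum>i\<in>A. scaleC a (f i))"
  by (induction A rule: infinite_finite_induct) (simp_all add: scaleC_zero_right scaleC_add_right)

lemma star_zero: "star (0::'a::unital_cstar_algebra) = 0"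
  using star_add[of "0::'a" 0] by simp

lemma star_one: "star (1::'a::unital_cstar_algebra) = 1"
  using star_mult[of "star (1::'a)" 1] by (simp add: star_star)

lemma star_power: "star ((x::'a::unital_cstar_algebra) ^ n) = star x ^ n"
  by (induction n) (simp_all add: star_one star_mult power_commutes)

lemma cstar_poly_0: "cstar_poly 0 (x::'a::unital_cstar_algebra) = 0"
  by (simp add: cstar_poly_def scaleC_zero_left)

lemma cstar_poly_altdef:
  assumes "degree p \<le> n"
  shows "cstar_poly p (x::'a::unital_cstar_algebra) = (\<Sum>i\<le>n. scaleC (coeff p i) (x ^ i))"
  unfolding cstar_poly_def
  by (rule sum.mono_neutral_left) (use assms in \<open>auto simp: coeff_eq_0 scaleC_zero_left\<close>)

lemma cstar_poly_pCons:
  "cstar_poly (pCons a p) (x::'a::unital_cstar_algebra) = scaleC a 1 + x * cstar_poly p x"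
proof -
  have "cstar_poly (pCons a p) x = (\<Sum>i\<le>Suc (degree p). scaleC (coeff (pCons a p) i) (x ^ i))"
    by (rule cstar_poly_altdef) (rule degree_pCons_le)
  also have "\<dots> = scaleC a 1 + (\<Sum>i\<le>degree p. x * scaleC (coeff p i) (x ^ i))"
    by (simp add: sum.atMost_Suc_shift mult_scaleC_right del: sum.atMost_Suc)
  finally show ?thesis
    by (simp add: cstar_poly_def sum_distrib_left)
qed

lemma cstar_poly_add:
  "cstar_poly (p + q) (x::'a::unital_cstar_algebra) = cstar_poly p x + cstar_poly q x"
  by (simp add: cstar_poly_altdef[of p "max (degree p) (degree q)"]
      cstar_poly_altdef[of q "max (degree p) (degree q)"]
      cstar_poly_altdef[of "p + q" "max (degree p) (degree q)"] degree_add_le_max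
      scaleC_add_left sum.distrib)

lemma cstar_poly_smult:
  "cstar_poly (smult c p) (x::'a::unital_cstar_algebra) = scaleC c (cstar_poly p x)"
  unfolding cstar_poly_altdef[OF degree_smult_le[of c p]]
  by (simp add: cstar_poly_def scaleC_sum_right scaleC_scaleC)

lemma cstar_poly_mult:
  "cstar_poly (p * q) (x::'a::unital_cstar_algebra) = cstar_poly p x * cstar_poly q x"
proof (induction p)
  case (pCons a p)
  then show ?case
    by (simp add: cstar_poly_add cstar_poly_smult cstar_poly_pCons algebra_simps mult_scaleC_left
        scaleC_zero_left)
qed (simp add: cstar_poly_0)

lemma cstar_poly_diff:
  "cstar_poly (p - q) (x::'a::unital_cstar_algebra) = cstar_poly p x - cstar_poly q x"
  using cstar_poly_add[of "p - q" q x] by (simp add: algebra_simps)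

lemma cstar_poly_const: "cstar_poly [:c:] (x::'a::unital_cstar_algebra) = scaleC c 1"
  by (simp add: cstar_poly_pCons cstar_poly_0)

lemma cstar_poly_linear:
  "cstar_poly [:-a, 1:] (x::'a::unital_cstar_algebra) = x - scaleC a 1"
  by (simp add: cstar_poly_pCons cstar_poly_0 scaleC_minus_left scaleC_one)

lemma star_cstar_poly:
  assumes "star x = (x::'a::unital_cstar_algebra)"
  shows "star (cstar_poly p x) = cstar_poly (map_poly cnj p) x"
proof -
  have comm: "x * cstar_poly p x = cstar_poly p x * x" for p
  proof -
    have "cstar_poly ([:0, 1:] * p) x = cstar_poly (p * [:0, 1:]) x"
      by (simp only: mult.commute)
    then show ?thesis
      using cstar_poly_linear[of 0 x] by (simp only: cstar_poly_mult) (simp add: scaleC_zero_left)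
  qed
  show ?thesis
  proof (induction p)
    case (pCons a p)
    then show ?case
      by (simp add: cstar_poly_pCons map_poly_pCons star_add star_scaleC star_one star_mult assms comm)
  qed (simp add: cstar_poly_0 star_zero)
qed

definition invertible_elt :: "'a::ring_1 \<Rightarrow> bool" where
  "invertible_elt a \<longleftrightarrow> (\<exists>b. a * b = 1 \<and> b * a = 1)"

lemma cstar_spectrum_iff:
  "z \<in> cstar_spectrum x \<longleftrightarrow> \<not> invertible_elt (scaleC z 1 - (x::'a::unital_cstar_algebra))"
  by (simp add: cstar_spectrum_def invertible_elt_def)

lemma invertible_elt_mult:
  assumes "invertible_elt a" "invertible_elt b"
  shows "invertible_elt (a * b)"
proof -
  obtain a' b' where "a * a' = 1" "a' * a = 1" "b * b' = 1" "b' * b = 1"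
    using assms by (auto simp: invertible_elt_def)
  then have "a * b * (b' * a') = 1" "b' * a' * (a * b) = 1"
    by (metis mult.assoc mult_1_left)+
  then show ?thesis
    by (auto simp: invertible_elt_def)
qed

lemma inverse_elt_unique:
  assumes "a * b = (1::'a::ring_1)" "b' * a = 1"
  shows "b' = b"
  by (metis assms mult.assoc mult_1_left mult_1_right)

text \<open>
  An inverse \<open>c\<close> of the product gives the right inverse \<open>b c\<close> and, because the factors commute, the
  left inverse \<open>c b\<close>.
\<close>
lemma invertible_elt_commuting_factor:
  assumes "invertible_elt (a * b)" "a * b = b * a"
  shows "invertible_elt a"
proof -
  obtain c where c: "a * b * c = 1" "c * (a * b) = 1"
    using assms(1) by (auto simp: invertible_elt_def)
  have "a * (b * c) = 1"
    using c(1) by (simp only: mult.assoc)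
  moreover have "c * b * a = 1"
    using c(2) by (simp only: assms(2) mult.assoc)
  moreover from \<open>a * (b * c) = 1\<close> this have "c * b = b * c"
    by (rule inverse_elt_unique)
  ultimately show ?thesis
    unfolding invertible_elt_def by metis
qed

lemma invertible_elt_scaleC:
  assumes "invertible_elt (a::'a::unital_cstar_algebra)" "c \<noteq> 0"
  shows "invertible_elt (scaleC c a)"
proof -
  obtain b where "a * b = 1" "b * a = 1"
    using assms by (auto simp: invertible_elt_def)
  then have "scaleC c a * scaleC (inverse c) b = 1" "scaleC (inverse c) b * scaleC c a = 1"
    using assms(2) by (simp_all add: mult_scaleC_left mult_scaleC_right scaleC_scaleC scaleC_one)
  then show ?thesis
    unfolding invertible_elt_def by metis
qed

lemma invertible_elt_minus: "invertible_elt (- a) \<longleftrightarrow> invertible_elt a"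
  unfolding invertible_elt_def by (metis minus_mult_minus mult_minus_left mult_minus_right minus_minus)

lemma invertible_elt_one_minus:
  assumes "norm (h::'a::{real_normed_algebra_1,banach}) < 1"
  shows "invertible_elt (1 - h)"
proof -
  have s: "summable (\<lambda>n. h ^ n)"
    by (rule complete_algebra_summable_geometric[OF assms])
  let ?s = "\<Sum>n. h ^ n"
  have split: "?s = 1 + (\<Sum>n. h ^ Suc n)"
    using suminf_split_head[OF s] by simp
  have "(\<Sum>n. h ^ Suc n) = h * ?s" "(\<Sum>n. h ^ Suc n) = ?s * h"
    using suminf_mult[OF s, of h] suminf_mult2[OF s, of h] by (simp_all add: power_commutes)
  with split have "(1 - h) * ?s = 1" "?s * (1 - h) = 1"
    by (simp_all add: algebra_simps)
  then show ?thesis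
    by (auto simp: invertible_elt_def)
qed

lemma cstar_spectrum_norm_le:
  assumes "z \<in> cstar_spectrum (x::'a::unital_cstar_algebra)"
  shows "cmod z \<le> norm x"
proof (rule ccontr)
  assume *: "\<not> ?thesis"
  then have z: "z \<noteq> 0"
    by auto
  have "norm (scaleC (inverse z) x) < 1"
    using * z by (simp add: norm_scaleC norm_inverse norm_divide field_simps)
  then have "invertible_elt (scaleC z (1 - scaleC (inverse z) x))"
    by (intro invertible_elt_scaleC invertible_elt_one_minus z)
  then show False
    using assms z by (simp add: cstar_spectrum_iff scaleC_diff_right scaleC_scaleC scaleC_one)
qed

lemma cstar_poly_mem_spectrum:
  assumes "z \<in> cstar_spectrum (x::'a::unital_cstar_algebra)"
  shows "poly p z \<in> cstar_spectrum (cstar_poly p x)"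
proof (rule ccontr)
  assume "\<not> ?thesis"
  then have inv: "invertible_elt (cstar_poly (p - [:poly p z:]) x)"
    using invertible_elt_minus[of "cstar_poly (p - [:poly p z:]) x"]
    by (simp add: cstar_spectrum_iff cstar_poly_diff cstar_poly_const)
  have "poly (p - [:poly p z:]) z = 0"
    by simp
  then obtain q where q: "p - [:poly p z:] = [:-z, 1:] * q"
    by (metis poly_eq_0_iff_dvd dvdE)
  have "invertible_elt (cstar_poly [:-z, 1:] x)"
    by (rule invertible_elt_commuting_factor[where b = "cstar_poly q x"])
      (use inv in \<open>simp_all only: q cstar_poly_mult[symmetric] mult.commute\<close>)
  then show False
    using assms invertible_elt_minus[of "cstar_poly [:-z, 1:] x"]
    by (simp add: cstar_spectrum_iff cstar_poly_linear)
qed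

lemma cstar_spectrum_poly_le_norm:
  assumes "z \<in> cstar_spectrum (x::'a::unital_cstar_algebra)"
  shows "cmod (poly p z) \<le> norm (cstar_poly p x)"
  by (intro cstar_spectrum_norm_le cstar_poly_mem_spectrum assms)

text \<open>
  The polynomial \<open>p - w\<close> splits into linear factors. If no root lay in the spectrum of \<open>x\<close>, its value
  at \<open>x\<close> would be a product of invertible elements.
\<close>
lemma cstar_spectrum_poly_surj:
  assumes "w \<in> cstar_spectrum (cstar_poly p (x::'a::unital_cstar_algebra))"
      and "degree p > 0"
  shows "\<exists>z\<in>cstar_spectrum x. poly p z = w"
proof (rule ccontr)
  assume *: "\<not> ?thesis"
  have prod: "invertible_elt (cstar_poly q x)"
    if "q \<noteq> 0" "\<And>z. poly q z = 0 \<Longrightarrow> poly p z = w" for q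
    using that
  proof (induction "degree q" arbitrary: q)
    case 0
    then obtain c where "q = [:c:]" "c \<noteq> 0"
      by (metis degree_eq_zeroE pCons_0_0)
    then show ?case
      using invertible_elt_scaleC[of 1 c] by (auto simp: cstar_poly_const invertible_elt_def)
  next
    case (Suc n)
    obtain z where z: "poly q z = 0"
      using fundamental_theorem_of_algebra[of q] Suc.hyps(2) by (metis constant_degree nat.distinct(1))
    then obtain q' where q': "q = [:-z, 1:] * q'"
      by (metis poly_eq_0_iff_dvd dvdE)
    have "q' \<noteq> 0"
      using Suc.prems(1) q' by auto
    then have "degree q = Suc (degree q')"
      using q' by (simp add: degree_mult_eq del: mult_pCons_left)
    then have "invertible_elt (cstar_poly q' x)"
      using Suc.hyps(2) \<open>q' \<noteq> 0\<close> Suc.prems(2) by (intro Suc.hyps(1)) (auto simp: q')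
    moreover have "z \<notin> cstar_spectrum x"
      using Suc.prems(2)[OF z] * by auto
    then have "invertible_elt (cstar_poly [:-z, 1:] x)"
      using invertible_elt_minus[of "cstar_poly [:-z, 1:] x"]
      by (simp add: cstar_spectrum_iff cstar_poly_linear)
    ultimately show ?case
      unfolding q' cstar_poly_mult by (intro invertible_elt_mult)
  qed
  have "p - [:w:] \<noteq> 0"
    using assms(2) by auto
  then have "invertible_elt (cstar_poly (p - [:w:]) x)"
    by (rule prod) auto
  then show False
    using assms(1) invertible_elt_minus[of "cstar_poly (p - [:w:]) x"]
    by (simp add: cstar_spectrum_iff cstar_poly_diff cstar_poly_const)
qed

text \<open>
  Adding \<open>i t\<close> to \<open>x\<close> raises the squared norm by at most \<open>t\<^sup>2\<close>, but it raises the squared modulus of a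
  spectral value with imaginary part \<open>b\<close> by \<open>t\<^sup>2 + 2 b t\<close>.
\<close>
lemma cstar_spectrum_real:
  assumes "star x = (x::'a::unital_cstar_algebra)" and "z \<in> cstar_spectrum x"
  shows "Im z = 0"
proof -
  let ?a = "Re z" and ?b = "Im z"
  have bound: "?a\<^sup>2 + (?b + t)\<^sup>2 \<le> (norm x)\<^sup>2 + t\<^sup>2" for t :: real
  proof -
    define y where "y = cstar_poly [:\<i> * of_real t, 1:] x"
    have y: "y = x + scaleC (\<i> * of_real t) 1"
      by (simp add: y_def cstar_poly_pCons cstar_poly_0 scaleC_one)
    have "cmod (z + \<i> * of_real t) \<le> norm y"
      using cstar_spectrum_poly_le_norm[OF assms(2), of "[:\<i> * of_real t, 1:]"]
      by (simp add: y_def add.commute)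
    then have "(cmod (z + \<i> * of_real t))\<^sup>2 \<le> (norm y)\<^sup>2"
      by (intro power_mono) auto
    also have "\<dots> = norm (star y * y)"
      by (simp add: norm_star_mult)
    also have "star y * y = (x - scaleC (\<i> * of_real t) 1) * (x + scaleC (\<i> * of_real t) 1)"
      by (simp add: y star_add star_scaleC star_one assms scaleC_minus_left)
    also have "\<dots> = x * x - scaleC (\<i> * of_real t * (\<i> * of_real t)) 1"
      by (simp only: left_diff_distrib distrib_left mult_scaleC_left mult_scaleC_right
          mult_1_left mult_1_right scaleC_scaleC scaleC_diff_right) simp
    also have "\<i> * of_real t * (\<i> * of_real t) = - complex_of_real (t\<^sup>2)"
      by (simp add: power2_eq_square algebra_simps)
    also have "x * x - scaleC (- complex_of_real (t\<^sup>2)) 1 = x * x + scaleC (of_real (t\<^sup>2)) 1"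
      by (simp only: scaleC_minus_left diff_minus_eq_add)
    also have "norm \<dots> \<le> norm (x * x) + t\<^sup>2"
      by (rule order.trans[OF norm_triangle_ineq]) (simp add: norm_scaleC del: of_real_power)
    also have "norm (x * x) = (norm x)\<^sup>2"
      using norm_star_mult[of x] assms(1) by simp
    finally show ?thesis
      by (simp add: cmod_power2)
  qed
  show ?thesis
  proof (rule ccontr)
    assume b: "?b \<noteq> 0"
    have "?a\<^sup>2 + ?b\<^sup>2 + 2 * ?b * t \<le> (norm x)\<^sup>2" for t
      using bound[of t] by (simp add: power2_sum algebra_simps)
    from this[of "((norm x)\<^sup>2 + 1) / (2 * ?b)"] b have "?a\<^sup>2 + ?b\<^sup>2 + 1 \<le> 0"
      by simp
    then show False
      using zero_le_power2[of ?a] zero_le_power2[of ?b] by linarith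
  qed
qed

lemma norm_power_two_selfadjoint:
  assumes "star y = (y::'a::unital_cstar_algebra)"
  shows "norm (y ^ (2 ^ m)) = norm y ^ (2 ^ m)"
proof (induction m)
  case (Suc m)
  have "norm (y ^ (2 ^ Suc m)) = norm (star (y ^ (2 ^ m)) * y ^ (2 ^ m))"
    by (simp add: star_power assms mult_2 power_add)
  also have "\<dots> = (norm y ^ (2 ^ m))\<^sup>2"
    by (simp only: norm_star_mult Suc.IH)
  finally show ?case
    by (simp add: power_mult[symmetric] mult.commute)
qed simp

text \<open>
  Rickart's elementary form of the spectral radius formula. Normalize \<open>y\<close> to an element \<open>x\<close> of norm
  \<open>1\<close>. If no spectral value had modulus at least \<open>1\<close>, the inverse of \<open>1 - z x\<close> would be a uniformly
  continuous function of \<open>z\<close> on the closed unit disc, so for some \<open>t < 1\<close> the inverses of \<open>1 - w x\<close>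
  and \<open>1 - t w x\<close> would be close for all \<open>w\<close> on the unit circle. Passing to means over square roots of
  \<open>w\<close> carries this over to \<open>1 - w x\<^sup>N\<close> and \<open>1 - t\<^sup>N w x\<^sup>N\<close> for every power \<open>N\<close> of two, with the same
  constant. As \<open>t\<^sup>N\<close> tends to \<open>0\<close>, the inverse of \<open>1 - x\<^sup>N\<close> would be close to \<open>1\<close>, which contradicts
  \<open>\<parallel>x\<^sup>N\<parallel> = 1\<close>.
\<close>
lemma selfadjoint_norm_attained:
  assumes sa: "star y = (y::'a::unital_cstar_algebra)"
  shows "\<exists>z\<in>cstar_spectrum y. cmod z \<ge> norm y"
proof (cases "y = 0")
  case True
  have "0 \<in> cstar_spectrum y"
    by (simp add: True cstar_spectrum_iff invertible_elt_def scaleC_zero_left)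
  then show ?thesis
    using True by auto
next
  case False
  then have ny: "norm y > 0"
    by simp
  define x where "x = scaleC (inverse (of_real (norm y))) y"
  have x: "star x = x" "norm x = 1"
    using ny by (simp_all add: x_def star_scaleC sa norm_scaleC norm_inverse)
  show ?thesis
  proof (rule ccontr)
    assume *: "\<not> ?thesis"
    have inv: "invertible_elt (1 - scaleC z x)" if "cmod z \<le> 1" for z
    proof (cases "z = 0")
      case True
      then show ?thesis
        by (auto simp: scaleC_zero_left invertible_elt_def)
    next
      case z: False
      define w where "w = of_real (norm y) / z"
      have "cmod w \<ge> norm y"
        using that z ny by (simp add: w_def norm_divide field_simps)
      then have "invertible_elt (scaleC w 1 - y)"
        using * by (auto simp: cstar_spectrum_iff)
      then have "invertible_elt (scaleC (inverse w) (scaleC w 1 - y))"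
        using z ny by (intro invertible_elt_scaleC) (auto simp: w_def)
      then show ?thesis
        using z ny by (simp add: x_def w_def scaleC_diff_right scaleC_scaleC scaleC_one field_simps)
    qed
    then obtain R where R: "\<And>z. cmod z \<le> 1 \<Longrightarrow> (1 - scaleC z x) * R z = 1"
        "\<And>z. cmod z \<le> 1 \<Longrightarrow> R z * (1 - scaleC z x) = 1"
      unfolding invertible_elt_def by metis
    have res: "R z - R z0 = scaleC (z - z0) (R z * x * R z0)" if "cmod z \<le> 1" "cmod z0 \<le> 1" for z z0
    proof -
      have "R z - R z0 = R z * ((1 - scaleC z0 x) * R z0) - (R z * (1 - scaleC z x)) * R z0"
        by (simp only: R(1)[OF that(2)] R(2)[OF that(1)] mult_1_left mult_1_right)
      also have "\<dots> = R z * scaleC z x * R z0 - R z * scaleC z0 x * R z0"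
        by (simp add: algebra_simps)
      finally have "R z - R z0 = R z * scaleC z x * R z0 - R z * scaleC z0 x * R z0" .
      then show ?thesis
        by (simp add: scaleC_diff_left mult_scaleC_left mult_scaleC_right)
    qed
    have cont: "continuous_on (cball 0 1) R"
      unfolding continuous_on_iff
    proof safe
      fix z0 :: complex and e :: real
      assume "z0 \<in> cball 0 1" and e: "0 < e"
      then have z0: "cmod z0 \<le> 1"
        by simp
      define c where "c = norm (R z0) + 1"
      have c: "c > 0" "norm (R z0) \<le> c"
        by (auto simp: c_def add_nonneg_pos)
      define d where "d = min (1 / (2 * c)) (e / (4 * c * c))"
      have "d > 0"
        using c e by (simp add: d_def)
      moreover have "dist (R z) (R z0) < e" if z: "cmod z \<le> 1" and dz: "dist z z0 < d" for z
      proof -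
        have "norm (R z - R z0) \<le> cmod (z - z0) * (norm (R z) * norm (R z0))"
          unfolding res[OF z z0] norm_scaleC
          using x(2) by (intro mult_left_mono order.trans[OF norm_mult_ineq] mult_right_mono
              order.trans[OF norm_mult_ineq[of "R z" x]]) auto
        also have "\<dots> \<le> cmod (z - z0) * (norm (R z) * c)"
          using c by (intro mult_left_mono) auto
        finally have 1: "norm (R z - R z0) \<le> cmod (z - z0) * norm (R z) * c"
          by (simp add: mult.assoc)
        have "cmod (z - z0) * c \<le> 1 / 2"
          using dz c by (simp add: d_def dist_norm field_simps)
        then have "cmod (z - z0) * c * norm (R z) \<le> 1 / 2 * norm (R z)"
          by (rule mult_right_mono) simp
        then have "norm (R z - R z0) \<le> norm (R z) / 2"
          using 1 by (simp add: mult_ac)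
        moreover have "norm (R z) \<le> norm (R z - R z0) + norm (R z0)"
          by (metis add.commute diff_add_cancel norm_triangle_ineq add_diff_cancel)
        ultimately have "norm (R z) \<le> 2 * c"
          using c(2) by linarith
        then have "norm (R z - R z0) \<le> cmod (z - z0) * (2 * c) * c"
          using 1 c(1) by (meson mult_left_mono mult_right_mono norm_ge_zero order.trans less_imp_le)
        also have "\<dots> < e / (4 * c * c) * (2 * c) * c"
          using dz c by (intro mult_strict_right_mono) (auto simp: d_def dist_norm)
        also have "\<dots> \<le> e"
          using c e by (simp add: field_simps)
        finally show ?thesis
          by (simp add: dist_norm)
      qed
      ultimately show "\<exists>d>0. \<forall>z\<in>cball 0 1. dist z z0 < d \<longrightarrow> dist (R z) (R z0) < e"
        by auto
    qed
    then have "uniformly_continuous_on (cball 0 1) R"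
      by (intro compact_uniformly_continuous compact_cball)
    then obtain d where d: "d > 0"
      "\<And>z z'. cmod z \<le> 1 \<Longrightarrow> cmod z' \<le> 1 \<Longrightarrow> dist z z' < d \<Longrightarrow> dist (R z) (R z') < 1 / 8"
      unfolding uniformly_continuous_on_def
      by (metis mem_cball_0 zero_less_divide_1_iff zero_less_numeral)
    define t where "t = 1 - min (d / 2) (1 / 2)"
    have t: "0 < t" "t < 1" "1 - t < d"
      using d(1) by (auto simp: t_def min_def)
    \<comment> \<open>The inverse of \<open>1 - w u\<^sup>2\<close> is the mean of the inverses of \<open>1 - v u\<close> and \<open>1 + v u\<close>, where
      \<open>v\<^sup>2 = w\<close>; so the estimate for exponent 1 passes to all powers of two.\<close>
    have key: "\<forall>w. cmod w = 1 \<longrightarrow> (\<exists>a b.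
         (1 - scaleC w (x ^ N)) * a = 1 \<and> a * (1 - scaleC w (x ^ N)) = 1 \<and>
         (1 - scaleC (of_real (t ^ N) * w) (x ^ N)) * b = 1 \<and>
         b * (1 - scaleC (of_real (t ^ N) * w) (x ^ N)) = 1 \<and> norm (a - b) \<le> 1 / 8)"
      if "N = 2 ^ m" for N m
      using that
    proof (induction m arbitrary: N)
      case 0
      show ?case
      proof safe
        fix w :: complex
        assume w: "cmod w = 1"
        have tw: "cmod (of_real t * w) \<le> 1"
          using t w by (simp add: norm_mult)
        have "w - of_real t * w = of_real (1 - t) * w"
          by (simp add: algebra_simps)
        then have "dist w (of_real t * w) < d"
          using t w by (simp add: dist_norm norm_mult del: of_real_diff)
        then have "norm (R w - R (of_real t * w)) \<le> 1 / 8"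
          using d(2)[of w "of_real t * w"] w tw by (simp add: dist_norm)
        then show "\<exists>a b. (1 - scaleC w (x ^ N)) * a = 1 \<and> a * (1 - scaleC w (x ^ N)) = 1 \<and>
         (1 - scaleC (of_real (t ^ N) * w) (x ^ N)) * b = 1 \<and>
         b * (1 - scaleC (of_real (t ^ N) * w) (x ^ N)) = 1 \<and> norm (a - b) \<le> 1 / 8"
          using R[of w] R[of "of_real t * w"] w tw 0 by auto
      qed
    next
      case (Suc m)
      define M where "M = (2::nat) ^ m"
      have N: "N = M + M"
        using Suc.prems by (simp add: M_def)
      show ?case
      proof safe
        fix w :: complex
        assume w: "cmod w = 1"
        define v where "v = csqrt w"
        have v: "v * v = w" "cmod v = 1"
          using power2_csqrt[of w] w by (simp_all add: v_def power2_eq_square norm_csqrt)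
        have dbl: "(1 - scaleC (s * s) (u * u)) * scaleC (1/2) (a + a') = 1 \<and>
            scaleC (1/2) (a + a') * (1 - scaleC (s * s) (u * u)) = 1"
          if "(1 - scaleC s u) * a = 1" "a * (1 - scaleC s u) = 1"
             "(1 - scaleC (- s) u) * a' = 1" "a' * (1 - scaleC (- s) u) = 1" for s and u a a' :: 'a
        proof -
          define f where "f = scaleC s u"
          have ff: "scaleC (s * s) (u * u) = f * f"
            by (simp add: f_def mult_scaleC_left mult_scaleC_right scaleC_scaleC)
          have h: "(1 - f) * a = 1" "a * (1 - f) = 1" "(1 + f) * a' = 1" "a' * (1 + f) = 1"
            using that by (simp_all add: f_def scaleC_minus_left)
          have e1: "1 - f * f = (1 + f) * (1 - f)" "1 - f * f = (1 - f) * (1 + f)"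
            by (simp_all add: algebra_simps)
          have two: "scaleC (1/2) (1 + 1 :: 'a) = 1"
            by (simp only: scaleC_add_right scaleC_add_left[symmetric]) (simp add: scaleC_one)
          have "(1 - f * f) * (a + a') = (1 + f) * ((1 - f) * a) + (1 - f) * ((1 + f) * a')"
            by (metis e1 mult.assoc distrib_left)
          then have A: "(1 - f * f) * (a + a') = 1 + 1"
            by (simp only: h mult_1_left mult_1_right) simp
          have "(a + a') * (1 - f * f) = (a * (1 - f)) * (1 + f) + (a' * (1 + f)) * (1 - f)"
            by (metis e1 mult.assoc distrib_right)
          then have B: "(a + a') * (1 - f * f) = 1 + 1"
            by (simp only: h mult_1_left mult_1_right) simp
          show ?thesis
            by (simp only: ff mult_scaleC_left mult_scaleC_right A B two simp_thms)
        qed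
        obtain a b where ab:
          "(1 - scaleC v (x ^ M)) * a = 1" "a * (1 - scaleC v (x ^ M)) = 1"
          "(1 - scaleC (of_real (t ^ M) * v) (x ^ M)) * b = 1"
          "b * (1 - scaleC (of_real (t ^ M) * v) (x ^ M)) = 1" "norm (a - b) \<le> 1 / 8"
          using Suc.IH[OF M_def] v(2) by metis
        obtain a' b' where ab':
          "(1 - scaleC (- v) (x ^ M)) * a' = 1" "a' * (1 - scaleC (- v) (x ^ M)) = 1"
          "(1 - scaleC (of_real (t ^ M) * - v) (x ^ M)) * b' = 1"
          "b' * (1 - scaleC (of_real (t ^ M) * - v) (x ^ M)) = 1" "norm (a' - b') \<le> 1 / 8"
          using Suc.IH[OF M_def] v(2) by (metis norm_minus_cancel)
        have xN: "x ^ N = x ^ M * x ^ M"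
          by (simp add: N power_add)
        have tN: "of_real (t ^ N) * w = (of_real (t ^ M) * v) * (of_real (t ^ M) * v)"
          by (simp add: N power_add v(1)[symmetric] mult_ac)
        have "norm (scaleC (1/2) (a + a') - scaleC (1/2) (b + b')) = norm ((a - b) + (a' - b')) / 2"
          by (simp add: scaleC_diff_right[symmetric] norm_scaleC algebra_simps norm_divide)
        also have "\<dots> \<le> (norm (a - b) + norm (a' - b')) / 2"
          by (intro divide_right_mono norm_triangle_ineq) auto
        also have "\<dots> \<le> 1 / 8"
          using ab(5) ab'(5) by simp
        finally have nrm: "norm (scaleC (1/2) (a + a') - scaleC (1/2) (b + b')) \<le> 1 / 8" .
        show "\<exists>a b. (1 - scaleC w (x ^ N)) * a = 1 \<and> a * (1 - scaleC w (x ^ N)) = 1 \<and>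
         (1 - scaleC (of_real (t ^ N) * w) (x ^ N)) * b = 1 \<and>
         b * (1 - scaleC (of_real (t ^ N) * w) (x ^ N)) = 1 \<and> norm (a - b) \<le> 1 / 8"
          unfolding xN tN unfolding v(1)[symmetric]
          using dbl[of v "x ^ M" a a'] dbl[of "of_real (t ^ M) * v" "x ^ M" b b'] ab ab' nrm
          by (intro exI[of _ "scaleC (1/2) (a + a')"] exI[of _ "scaleC (1/2) (b + b')"])
             (simp only: mult_minus_right simp_thms)
      qed
    qed
    have "(\<lambda>n. t ^ n) \<longlonglongrightarrow> 0"
      using t by (intro LIMSEQ_realpow_zero) auto
    then obtain n0 where n0: "\<And>n. n \<ge> n0 \<Longrightarrow> t ^ n < 1 / 16"
      using t by (fastforce dest: order_tendstoD(2)[where a = "1/16"] simp: eventually_sequentially)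
    define N where "N = (2::nat) ^ n0"
    have tN: "0 \<le> t ^ N" "t ^ N < 1 / 16"
      using n0[of N] t less_exp[of n0] by (auto simp: N_def)
    define u where "u = x ^ N"
    have u: "norm u = 1"
      unfolding u_def N_def using norm_power_two_selfadjoint[OF x(1), of n0] x(2) by simp
    obtain a b where ab: "(1 - u) * a = 1" "a * (1 - u) = 1"
        "(1 - scaleC (of_real (t ^ N)) u) * b = 1" "norm (a - b) \<le> 1 / 8"
      using key[OF N_def] unfolding u_def[symmetric]
      by (metis mult.right_neutral norm_one scaleC_one)
    have "b - 1 = scaleC (of_real (t ^ N)) u * b"
      using ab(3) by (simp add: algebra_simps)
    then have "norm (b - 1) \<le> t ^ N * norm b"
      using norm_mult_ineq[of "scaleC (of_real (t ^ N)) u" b] tN(1) u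
      by (simp add: norm_scaleC del: of_real_power)
    also have "\<dots> \<le> 1 / 16 * norm b"
      using tN by (intro mult_right_mono) auto
    finally have b1: "norm (b - 1) \<le> norm b / 16"
      by simp
    have "norm b \<le> norm (b - 1) + 1"
      using norm_triangle_ineq[of "b - 1" 1] by simp
    with b1 have "norm (b - 1) \<le> 1 / 8"
      by linarith
    then have a1: "norm (a - 1) \<le> 1 / 4"
      using norm_triangle_ineq[of "a - b" "b - 1"] ab(4) by simp
    have "a - 1 = u * a"
      using ab(1) by (simp add: algebra_simps)
    then have "u = (a - 1) - u * (a - 1)"
      by (simp add: algebra_simps)
    then have "norm u \<le> norm (a - 1) + norm u * norm (a - 1)"
      by (metis norm_triangle_ineq4 norm_mult_ineq add_left_mono order.trans)
    with u a1 show False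
      by simp
  qed
qed

text \<open>
  The C*-identity reduces this to the self-adjoint element \<open>p(x)\<^sup>* p(x)\<close>, which is the value at \<open>x\<close> of
  the polynomial \<open>|p|\<^sup>2\<close> on the real line.
\<close>
lemma norm_cstar_poly_attained:
  assumes sa: "star x = (x::'a::unital_cstar_algebra)"
  shows "\<exists>z\<in>cstar_spectrum x. cmod (poly p z) = norm (cstar_poly p x)"
proof (cases "degree p = 0")
  case True
  then obtain c where c: "p = [:c:]"
    by (metis degree_eq_zeroE)
  obtain z where "z \<in> cstar_spectrum x"
    using selfadjoint_norm_attained[OF sa] by auto
  then show ?thesis
    by (intro bexI[of _ z]) (simp_all add: c cstar_poly_const norm_scaleC)
next
  case False
  define q where "q = map_poly cnj p * p"
  have nz: "p \<noteq> 0"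
    using False by auto
  have deg: "degree (map_poly cnj p) = degree p"
    by (rule degree_map_poly) auto
  then have "degree q > 0"
    using False nz unfolding q_def by (subst degree_mult_eq) auto
  define y where "y = cstar_poly q x"
  have y: "y = star (cstar_poly p x) * cstar_poly p x"
    by (simp add: y_def q_def cstar_poly_mult star_cstar_poly[OF sa])
  then have "star y = y"
    by (simp add: star_mult star_star)
  then obtain w where w: "w \<in> cstar_spectrum y" "cmod w \<ge> norm y"
    using selfadjoint_norm_attained by blast
  then obtain z where z: "z \<in> cstar_spectrum x" "poly q z = w"
    using cstar_spectrum_poly_surj[of w q x] \<open>degree q > 0\<close> by (auto simp: y_def)
  have "cnj z = z"
    using cstar_spectrum_real[OF sa z(1)] by (simp add: complex_eq_iff)
  then have "poly (map_poly cnj p) z = cnj (poly p z)"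
    using poly_cnj[of p z] by simp
  then have "cmod w = (cmod (poly p z))\<^sup>2"
    using z(2) by (simp add: q_def norm_mult power2_eq_square flip: z(2))
  then have "(norm (cstar_poly p x))\<^sup>2 \<le> (cmod (poly p z))\<^sup>2"
    using w(2) y by (simp add: norm_star_mult)
  then have "norm (cstar_poly p x) \<le> cmod (poly p z)"
    by (rule power2_le_imp_le) simp
  with cstar_spectrum_poly_le_norm[OF z(1), of p] z(1) show ?thesis
    by force
qed

section \<open>Separated sets in a finite-dimensional normed space\<close>

text \<open>
  Passing to powers removes a constant that does not depend on the exponent.
\<close>
lemma le_of_power_le:
  fixes x y C :: real
  assumes "0 \<le> x" "0 < y" "0 < C" "\<And>j::nat. x ^ j \<le> C * y ^ j"
  shows "x \<le> y"
proof (rule ccontr)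
  assume "\<not> ?thesis"
  then have "1 < x / y"
    using assms(2) by simp
  then obtain j where "C < (x / y) ^ j"
    using real_arch_pow by blast
  with assms(2) assms(4)[of j] show False
    by (simp add: power_divide field_simps)
qed

definition separated :: "('x \<Rightarrow> 'x \<Rightarrow> real) \<Rightarrow> real \<Rightarrow> 'x set \<Rightarrow> bool" where
  "separated d \<omega> T \<longleftrightarrow> (\<forall>x\<in>T. \<forall>y\<in>T. x \<noteq> y \<longrightarrow> \<omega> \<le> d x y)"

lemma separatedD: "separated d \<omega> T \<Longrightarrow> x \<in> T \<Longrightarrow> y \<in> T \<Longrightarrow> x \<noteq> y \<Longrightarrow> \<omega> \<le> d x y"
  by (auto simp: separated_def)

text \<open>
  A separated set of largest cardinality is a net. Its points lie in \<open>S\<close> itself, as the definition of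
  the covering number demands of the centres.
\<close>
lemma maximal_separated_covers:
  fixes d :: "'x \<Rightarrow> 'x \<Rightarrow> real"
  assumes bdd: "\<And>T. finite T \<Longrightarrow> T \<subseteq> S \<Longrightarrow> separated d \<omega> T \<Longrightarrow> real (card T) \<le> B"
      and sym: "\<And>x y. x \<in> S \<Longrightarrow> y \<in> S \<Longrightarrow> d x y = d y x"
      and refl: "\<And>x. x \<in> S \<Longrightarrow> d x x < \<omega>"
  shows "\<exists>T. finite T \<and> T \<subseteq> S \<and> separated d \<omega> T \<and> (\<forall>x\<in>S. \<exists>y\<in>T. d x y < \<omega>)"
proof -
  let ?P = "\<lambda>T. finite T \<and> T \<subseteq> S \<and> separated d \<omega> T"
  have "card T < nat \<lceil>B\<rceil> + 1" if "?P T" for T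
  proof -
    have "real (card T) \<le> B"
      using bdd that by blast
    then show ?thesis
      by linarith
  qed
  then have "\<exists>T. ?P T \<and> (\<forall>U. ?P U \<longrightarrow> card U \<le> card T)"
    by (intro ex_has_greatest_nat[where k = "{}" and b = "nat \<lceil>B\<rceil> + 1"]) (auto simp: separated_def)
  then obtain T where T: "?P T" "\<And>U. ?P U \<Longrightarrow> card U \<le> card T"
    by blast
  have "\<exists>y\<in>T. d x y < \<omega>" if x: "x \<in> S" for x
  proof (rule ccontr)
    assume *: "\<not> ?thesis"
    then have "x \<notin> T"
      using refl[OF x] by auto
    moreover have "\<omega> \<le> d x y" "\<omega> \<le> d y x" if "y \<in> T" for y
      using * sym[OF x, of y] that T(1) by (auto simp: not_less subset_eq)
    then have "?P (insert x T)"
      using T(1) x by (auto simp: separated_def)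
    ultimately show False
      using T(2)[of "insert x T"] T(1) by simp
  qed
  with T(1) show ?thesis
    by blast
qed

text \<open>
  A norm on the real functions on a finite index set, compared with the maximum norm by constants \<open>a\<close>
  and \<open>b\<close>. These may depend on the dimension in any way: they enter the lattice point counts below, but
  not the conclusions, since the counts are applied at all scales at once. Values of a function outside
  \<open>I\<close> do not influence \<open>N\<close>, by \<open>le_coordinates\<close>.
\<close>
locale coordinate_norm =
  fixes I :: "'i set" and N :: "('i \<Rightarrow> real) \<Rightarrow> real" and a b :: real
  assumes finite_I: "finite I"
    and triangle: "N (\<lambda>i. f i + g i) \<le> N f + N g"
    and scale: "N (\<lambda>i. c * f i) = \<bar>c\<bar> * N f"
    and coordinate_le: "i \<in> I \<Longrightarrow> \<bar>f i\<bar> \<le> a * N f"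
    and le_coordinates: "0 \<le> s \<Longrightarrow> (\<And>i. i \<in> I \<Longrightarrow> \<bar>f i\<bar> \<le> s) \<Longrightarrow> N f \<le> b * s"
    and a_pos: "0 < a" and b_pos: "0 < b"
begin

abbreviation dst :: "('i \<Rightarrow> real) \<Rightarrow> ('i \<Rightarrow> real) \<Rightarrow> real" where
  "dst f g \<equiv> N (\<lambda>i. f i - g i)"

lemma zero: "N (\<lambda>i. 0) = 0"
  using scale[of 0 "\<lambda>i. 0"] by simp

lemma minus: "N (\<lambda>i. - f i) = N f"
  using scale[of "-1" f] by simp

lemma diff_le: "dst f g \<le> N f + N g"
  using triangle[of f "\<lambda>i. - g i"] by (simp add: minus)

lemma dst_commute: "dst f g = dst g f"
  using minus[of "\<lambda>i. f i - g i"] by simp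

text \<open>
  Points with the same integer parts of suitably scaled coordinates are too close to be separated.
\<close>
lemma separated_card_le_grid:
  assumes "finite U" "\<And>f. f \<in> U \<Longrightarrow> N f \<le> 1" "separated dst (2 * s) U" "0 < s" "s \<le> 1"
  shows "real (card U) \<le> ((2 * a * b + 3) / s) ^ card I"
proof -
  define \<phi> where "\<phi> = (\<lambda>f. restrict (\<lambda>i. \<lfloor>f i * b / s\<rfloor>) I)"
  define L where "L = \<lceil>a * b / s\<rceil>"
  have abs: "0 < a * b / s"
    using a_pos b_pos assms(4) by simp
  have "inj_on \<phi> U"
  proof (rule inj_onI, rule ccontr)
    fix f g
    assume fg: "f \<in> U" "g \<in> U" "\<phi> f = \<phi> g" "f \<noteq> g"
    have "\<bar>f i - g i\<bar> \<le> s / b" if "i \<in> I" for i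
    proof -
      have "\<lfloor>f i * b / s\<rfloor> = \<lfloor>g i * b / s\<rfloor>"
        using fg(3) that by (auto simp: \<phi>_def fun_eq_iff restrict_def split: if_splits)
      then have "\<bar>f i * b / s - g i * b / s\<bar> \<le> 1"
        by linarith
      also have "f i * b / s - g i * b / s = (f i - g i) * (b / s)"
        by (simp add: diff_divide_distrib left_diff_distrib)
      finally have "\<bar>f i - g i\<bar> * (b / s) \<le> 1"
        using b_pos assms(4) by (simp add: abs_mult)
      then show ?thesis
        using b_pos assms(4) by (simp add: field_simps)
    qed
    then have "dst f g \<le> b * (s / b)"
      using b_pos assms(4) by (intro le_coordinates) auto
    moreover have "2 * s \<le> dst f g"
      using separatedD[OF assms(3)] fg by blast
    ultimately show False
      using b_pos assms(4) by simp
  qed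
  moreover have "\<phi> ` U \<subseteq> PiE I (\<lambda>_. {-L..L})"
  proof (rule image_subsetI)
    fix f
    assume f: "f \<in> U"
    have "-L \<le> \<lfloor>f i * b / s\<rfloor> \<and> \<lfloor>f i * b / s\<rfloor> \<le> L" if "i \<in> I" for i
    proof -
      have "\<bar>f i\<bar> \<le> a"
        using coordinate_le[OF that, of f] assms(2)[OF f] a_pos
        by (metis mult.right_neutral mult_left_mono order.trans less_imp_le)
      then have "\<bar>f i\<bar> * (b / s) \<le> a * (b / s)"
        using b_pos assms(4) by (intro mult_right_mono) auto
      then have "\<bar>f i * b / s\<bar> \<le> a * b / s"
        using b_pos assms(4) by (simp add: abs_mult)
      moreover have "-\<lceil>z\<rceil> \<le> \<lfloor>y\<rfloor> \<and> \<lfloor>y\<rfloor> \<le> \<lceil>z\<rceil>" if "\<bar>y\<bar> \<le> z" for y z :: real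
        using that by linarith
      ultimately show ?thesis
        unfolding L_def by blast
    qed
    then show "\<phi> f \<in> PiE I (\<lambda>_. {-L..L})"
      by (auto simp: \<phi>_def)
  qed
  ultimately have "card U \<le> card (PiE I (\<lambda>_. {-L..L}))"
    by (intro card_inj_on_le[of \<phi>] finite_PiE finite_I) auto
  also have "\<dots> = nat (2 * L + 1) ^ card I"
    by (simp add: card_PiE finite_I)
  finally have "real (card U) \<le> real (nat (2 * L + 1)) ^ card I"
    by (metis of_nat_le_iff of_nat_power)
  also have "\<dots> \<le> ((2 * a * b + 3) / s) ^ card I"
  proof (rule power_mono)
    have "real (nat (2 * L + 1)) \<le> 2 * (a * b / s) + 3"
      using abs unfolding L_def by linarith
    also have "\<dots> \<le> 2 * (a * b / s) + 3 / s"
      using assms(4,5) by (simp add: field_simps)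
    finally show "real (nat (2 * L + 1)) \<le> (2 * a * b + 3) / s"
      by (simp add: add_divide_distrib)
  qed simp
  finally show ?thesis .
qed

text \<open>
  The bound that disjointness of balls and comparison of volumes would give, with the exact base
  \<open>1 + 2 \<rho> / \<omega>\<close>. The comparison of volumes is replaced by nesting copies of the configuration and
  counting lattice points.
\<close>
theorem separated_card_le:
  assumes "finite T" "\<And>f. f \<in> T \<Longrightarrow> N f \<le> \<rho>" "separated dst \<omega> T" "0 < \<omega>" "0 \<le> \<rho>"
  shows "real (card T) \<le> (1 + 2 * \<rho> / \<omega>) ^ card I"
proof -
  define \<sigma> where "\<sigma> = \<rho> + \<omega> / 2"
  define \<theta> where "\<theta> = \<omega> / 2 / \<sigma>"
  have \<sigma>: "\<sigma> > 0"
    using assms by (simp add: \<sigma>_def)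
  have \<theta>: "0 < \<theta>" "\<theta> \<le> 1"
    using assms \<sigma> by (simp_all add: \<theta>_def \<sigma>_def)
  define T' where "T' = (\<lambda>f i. f i / \<sigma>) ` T"
  have scale': "N (\<lambda>i. f i / \<sigma>) = N f / \<sigma>" for f
    using scale[of "1 / \<sigma>" f] \<sigma> by simp
  have "inj_on (\<lambda>f i. f i / \<sigma>) T"
    using \<sigma> by (auto simp: inj_on_def fun_eq_iff)
  then have card: "card T' = card T"
    by (simp add: T'_def card_image)
  have T': "N f \<le> 1 - \<theta>" if "f \<in> T'" for f
  proof -
    obtain g where "g \<in> T" "f = (\<lambda>i. g i / \<sigma>)"
      using \<open>f \<in> T'\<close> by (auto simp: T'_def)
    then have "N f \<le> \<rho> / \<sigma>"
      using assms(2)[of g] \<sigma> by (simp add: scale' divide_right_mono)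
    also have "\<rho> / \<sigma> = 1 - \<theta>"
      using \<sigma> by (simp add: \<theta>_def \<sigma>_def field_simps)
    finally show ?thesis .
  qed
  have sep: "2 * \<theta> \<le> dst f g" if fg: "f \<in> T'" "g \<in> T'" "f \<noteq> g" for f g
  proof -
    obtain f' g' where *: "f' \<in> T" "g' \<in> T" "f = (\<lambda>i. f' i / \<sigma>)" "g = (\<lambda>i. g' i / \<sigma>)"
      using fg by (auto simp: T'_def)
    then have "dst f g = dst f' g' / \<sigma>"
      by (simp add: scale'[symmetric] diff_divide_distrib)
    moreover have "\<omega> \<le> dst f' g'"
      using separatedD[OF assms(3) *(1,2)] * fg(3) by auto
    ultimately show ?thesis
      using \<sigma> by (simp add: \<theta>_def divide_right_mono)
  qed
  \<comment> \<open>Balls of radius \<open>\<theta>\<close> about the points of \<open>T'\<close> are disjoint and lie in the unit ball; putting a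
    scaled copy of the configuration into each of them can be repeated indefinitely.\<close>
  have iter: "\<exists>U. finite U \<and> card U = card T ^ j \<and> (\<forall>f\<in>U. N f \<le> 1 - \<theta> ^ j) \<and>
      separated dst (2 * \<theta> ^ j) U" for j :: nat
  proof (induction j)
    case 0
    show ?case
      by (rule exI[of _ "{\<lambda>i. 0}"]) (simp add: zero separated_def)
  next
    case (Suc j)
    then obtain U where U: "finite U" "card U = card T ^ j" "\<And>f. f \<in> U \<Longrightarrow> N f \<le> 1 - \<theta> ^ j"
        "separated dst (2 * \<theta> ^ j) U"
      by blast
    define F where "F = (\<lambda>(f, g). \<lambda>i::'i. f i + \<theta> * g i :: real)"
    have F: "2 * \<theta> ^ Suc j \<le> dst (F p) (F q)" if "p \<in> T' \<times> U" "q \<in> T' \<times> U" "p \<noteq> q" for p q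
    proof -
      obtain f g f' g' where pq: "p = (f, g)" "q = (f', g')" "f \<in> T'" "f' \<in> T'" "g \<in> U" "g' \<in> U"
        using \<open>p \<in> _\<close> \<open>q \<in> _\<close> by auto
      have dF: "dst (F p) (F q) = N (\<lambda>i. (f i - f' i) + \<theta> * (g i - g' i))"
        by (simp add: F_def pq algebra_simps)
      show ?thesis
      proof (cases "f = f'")
        case True
        then have "g \<noteq> g'"
          using \<open>p \<noteq> q\<close> pq by auto
        then have "2 * \<theta> ^ j \<le> dst g g'"
          using separatedD[OF U(4)] pq by blast
        moreover have "dst (F p) (F q) = \<theta> * dst g g'"
          using True \<theta> by (simp add: dF scale)
        ultimately show ?thesis
          using \<theta> by simp
      next
        case False
        have "dst f f' = N (\<lambda>i. ((f i - f' i) + \<theta> * (g i - g' i)) + \<theta> * (g' i - g i))"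
          by (simp add: algebra_simps)
        also have "\<dots> \<le> dst (F p) (F q) + \<theta> * dst g' g"
        proof -
          have "\<theta> * dst g' g = N (\<lambda>i. \<theta> * (g' i - g i))"
            using \<theta>(1) by (simp only: scale abs_of_pos)
          then show ?thesis
            unfolding dF by (simp only: triangle)
        qed
        also have "\<theta> * dst g' g \<le> \<theta> * ((1 - \<theta> ^ j) + (1 - \<theta> ^ j))"
          using \<theta> U(3)[OF pq(5)] U(3)[OF pq(6)] diff_le[of g' g] by (intro mult_left_mono) auto
        finally show ?thesis
          using sep[OF pq(3,4) False] by (simp add: algebra_simps)
      qed
    qed
    have pos: "0 < 2 * \<theta> ^ Suc j"
      using \<theta> by simp
    have "inj_on F (T' \<times> U)"
    proof (rule inj_onI, rule ccontr)
      fix p q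
      assume "p \<in> T' \<times> U" "q \<in> T' \<times> U" "F p = F q" "p \<noteq> q"
      with F[of p q] pos show False
        by (simp add: zero)
    qed
    then have "card (F ` (T' \<times> U)) = card T ^ Suc j"
      by (simp add: card_image card_cartesian_product card U(2))
    moreover have "finite (F ` (T' \<times> U))"
      using U(1) assms(1) by (simp add: T'_def)
    moreover have "separated dst (2 * \<theta> ^ Suc j) (F ` (T' \<times> U))"
      unfolding separated_def using F by blast
    moreover have "N (F p) \<le> 1 - \<theta> ^ Suc j" if "p \<in> T' \<times> U" for p
    proof -
      obtain f g where p: "p = (f, g)" "f \<in> T'" "g \<in> U"
        using \<open>p \<in> _\<close> by auto
      have "N (F p) \<le> N f + \<theta> * N g"
        unfolding F_def p(1) prod.case using triangle[of f "\<lambda>i. \<theta> * g i"] scale[of \<theta> g] \<theta> by simp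
      also have "\<dots> \<le> (1 - \<theta>) + \<theta> * (1 - \<theta> ^ j)"
        using T'[OF p(2)] U(3)[OF p(3)] \<theta> by (intro add_mono mult_left_mono) auto
      finally show ?thesis
        by (simp add: algebra_simps)
    qed
    ultimately show ?case
      by blast
  qed
  define K where "K = 2 * a * b + 3"
  have K: "K > 0"
    using a_pos b_pos by (simp add: K_def add_pos_pos)
  have "real (card T) \<le> (1 / \<theta>) ^ card I"
  proof (rule le_of_power_le)
    show "0 < K ^ card I"
      using K by simp
    fix j
    obtain U where U: "finite U" "card U = card T ^ j" "\<And>f. f \<in> U \<Longrightarrow> N f \<le> 1 - \<theta> ^ j"
        "separated dst (2 * \<theta> ^ j) U"
      using iter by blast
    have th: "0 < \<theta> ^ j" "\<theta> ^ j \<le> 1"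
      using \<theta> by (simp_all add: power_le_one)
    have "N f \<le> 1" if "f \<in> U" for f
      using U(3)[OF that] th(1) by linarith
    then have "real (card U) \<le> (K / \<theta> ^ j) ^ card I"
      unfolding K_def using U th by (intro separated_card_le_grid) auto
    also have "\<dots> = K ^ card I * ((1 / \<theta>) ^ card I) ^ j"
      by (simp add: power_divide power_mult[symmetric] mult.commute)
    finally show "real (card T) ^ j \<le> K ^ card I * ((1 / \<theta>) ^ card I) ^ j"
      by (simp add: U(2))
  qed (use \<theta> in auto)
  also have "1 / \<theta> = 1 + 2 * \<rho> / \<omega>"
    using \<sigma> assms by (simp add: \<theta>_def \<sigma>_def field_simps)
  finally show ?thesis .
qed

text \<open>
  A largest separated subset of the ball is a net. From a net with \<open>N\<close> points of relative mesh \<open>\<tau>\<close>,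
  scaled copies produce nets with \<open>N\<^sup>j\<close> points of mesh \<open>\<tau>\<^sup>j\<close>; comparing these with a lattice shows that
  \<open>N\<close> is at least \<open>1 / \<tau>\<close> to the power of the dimension.
\<close>
theorem separated_in_ball_exists:
  assumes "0 < \<rho>" "0 < \<omega>"
  shows "\<exists>T. finite T \<and> (\<forall>f\<in>T. N f \<le> \<rho>) \<and> separated dst \<omega> T \<and> (\<rho> / \<omega>) ^ card I \<le> real (card T)"
proof -
  have "\<exists>T. finite T \<and> T \<subseteq> {f. N f \<le> \<rho>} \<and> separated dst \<omega> T \<and>
      (\<forall>f\<in>{f. N f \<le> \<rho>}. \<exists>g\<in>T. dst f g < \<omega>)"
  proof (rule maximal_separated_covers)
    fix T
    assume "finite T" "T \<subseteq> {f. N f \<le> \<rho>}" "separated dst \<omega> T"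
    then show "real (card T) \<le> (1 + 2 * \<rho> / \<omega>) ^ card I"
      using assms by (intro separated_card_le) auto
  qed (use assms in \<open>auto simp: zero intro: dst_commute\<close>)
  then obtain T where T: "finite T" "\<And>f. f \<in> T \<Longrightarrow> N f \<le> \<rho>" "separated dst \<omega> T"
      and cov: "\<And>f. N f \<le> \<rho> \<Longrightarrow> \<exists>g\<in>T. dst f g < \<omega>"
    by blast
  define \<tau> where "\<tau> = \<omega> / \<rho>"
  have \<tau>: "\<tau> > 0"
    using assms by (simp add: \<tau>_def)
  have "T \<noteq> {}"
    using cov[of "\<lambda>i. 0"] assms by (auto simp: zero)
  then have nT: "0 < real (card T)"
    using T(1) by (simp add: card_gt_0_iff)
  have iter: "\<exists>C. finite C \<and> card C \<le> card T ^ j \<and> (\<forall>f. N f \<le> 1 \<longrightarrow> (\<exists>g\<in>C. dst f g \<le> \<tau> ^ j))" for j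
  proof (induction j)
    case 0
    show ?case
      by (rule exI[of _ "{\<lambda>i. 0}"]) simp
  next
    case (Suc j)
    then obtain C where C: "finite C" "card C \<le> card T ^ j"
        "\<And>f. N f \<le> 1 \<Longrightarrow> \<exists>g\<in>C. dst f g \<le> \<tau> ^ j"
      by blast
    define F where "F = (\<lambda>(g, h). \<lambda>i::'i. g i / \<rho> + \<tau> * h i :: real)"
    have "\<exists>g\<in>F ` (T \<times> C). dst f g \<le> \<tau> ^ Suc j" if f: "N f \<le> 1" for f
    proof -
      have "N (\<lambda>i. \<rho> * f i) \<le> \<rho>"
        using f assms by (simp add: scale)
      then obtain g where g: "g \<in> T" "N (\<lambda>i. \<rho> * f i - g i) < \<omega>"
        using cov by blast
      define h where "h = (\<lambda>i. (1 / \<omega>) * (\<rho> * f i - g i))"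
      have "N h \<le> 1"
        unfolding h_def scale using g(2) assms by simp
      then obtain h' where h': "h' \<in> C" "dst h h' \<le> \<tau> ^ j"
        using C(3) by blast
      have "(\<lambda>i. f i - F (g, h') i) = (\<lambda>i. \<tau> * (h i - h' i))"
        using assms by (auto simp: F_def h_def \<tau>_def field_simps)
      then have "dst f (F (g, h')) = \<tau> * dst h h'"
        using \<tau> by (simp add: scale)
      then have "dst f (F (g, h')) \<le> \<tau> ^ Suc j"
        using h'(2) \<tau> by simp
      then show ?thesis
        using g(1) h'(1) by blast
    qed
    moreover have "card (F ` (T \<times> C)) \<le> card T ^ Suc j"
      using card_image_le[of "T \<times> C" F] T(1) C(1,2)
      by (simp add: card_cartesian_product) (meson le_trans mult_le_mono2)
    moreover have "finite (F ` (T \<times> C))"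
      using T(1) C(1) by simp
    ultimately show ?case
      by blast
  qed
  define K where "K = 3 * a * b"
  have K: "K > 0"
    using a_pos b_pos by (simp add: K_def)
  have "(1 / \<tau>) ^ card I \<le> real (card T)"
  proof (rule le_of_power_le)
    show "0 < K ^ card I"
      using K by simp
    fix j
    obtain C where C: "finite C" "card C \<le> card T ^ j"
        "\<And>f. N f \<le> 1 \<Longrightarrow> \<exists>g\<in>C. dst f g \<le> \<tau> ^ j"
      using iter by blast
    \<comment> \<open>The mesh exceeds \<open>2 a \<tau>\<^sup>j\<close>, so lattice points sharing a centre of the net coincide.\<close>
    define s where "s = 3 * a * \<tau> ^ j"
    define M where "M = nat \<lfloor>1 / (b * s)\<rfloor>"
    have s: "s > 0"
      using a_pos \<tau> by (simp add: s_def)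
    have M: "real M \<le> 1 / (b * s)" "1 / (b * s) \<le> real (M + 1)"
      using b_pos s unfolding M_def by (auto, linarith)
    define G where "G = PiE I (\<lambda>_. {0..M})"
    define pt where "pt = (\<lambda>\<phi> (i::'i). s * real (\<phi> i :: nat))"
    have "\<exists>g\<in>C. dst (pt \<phi>) g \<le> \<tau> ^ j" if \<phi>: "\<phi> \<in> G" for \<phi>
    proof (rule C(3))
      have "\<bar>pt \<phi> i\<bar> \<le> 1 / b" if "i \<in> I" for i
      proof -
        have "real (\<phi> i) \<le> real M"
          using \<phi> that by (auto simp: G_def)
        then have "s * real (\<phi> i) \<le> s * (1 / (b * s))"
          using M(1) s by (intro mult_left_mono) auto
        then show ?thesis
          using s by (simp add: pt_def abs_mult)
      qed
      then have "N (pt \<phi>) \<le> b * (1 / b)"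
        using b_pos by (intro le_coordinates) auto
      then show "N (pt \<phi>) \<le> 1"
        using b_pos by simp
    qed
    then obtain c where c: "\<And>\<phi>. \<phi> \<in> G \<Longrightarrow> c \<phi> \<in> C" "\<And>\<phi>. \<phi> \<in> G \<Longrightarrow> dst (pt \<phi>) (c \<phi>) \<le> \<tau> ^ j"
      by metis
    have "inj_on c G"
    proof (rule inj_onI)
      fix \<phi> \<psi>
      assume *: "\<phi> \<in> G" "\<psi> \<in> G" "c \<phi> = c \<psi>"
      have "dst (pt \<phi>) (pt \<psi>) \<le> dst (pt \<phi>) (c \<phi>) + dst (pt \<psi>) (c \<phi>)"
        using diff_le[of "\<lambda>i. pt \<phi> i - c \<phi> i" "\<lambda>i. pt \<psi> i - c \<phi> i"] by simp
      also have "\<dots> \<le> 2 * \<tau> ^ j"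
        using c(2)[OF *(1)] c(2)[OF *(2)] *(3) by simp
      finally have d: "dst (pt \<phi>) (pt \<psi>) \<le> 2 * \<tau> ^ j" .
      have "\<phi> i = \<psi> i" if "i \<in> I" for i
      proof (rule ccontr)
        assume "\<phi> i \<noteq> \<psi> i"
        then have "1 \<le> \<bar>real (\<phi> i) - real (\<psi> i)\<bar>"
          by linarith
        then have "s * 1 \<le> s * \<bar>real (\<phi> i) - real (\<psi> i)\<bar>"
          using s by (intro mult_left_mono) auto
        also have "\<dots> = \<bar>pt \<phi> i - pt \<psi> i\<bar>"
          using s by (simp add: pt_def abs_mult right_diff_distrib[symmetric])
        also have "\<dots> \<le> a * dst (pt \<phi>) (pt \<psi>)"
          using coordinate_le[OF that, of "\<lambda>i. pt \<phi> i - pt \<psi> i"] by simp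
        also have "\<dots> \<le> a * (2 * \<tau> ^ j)"
          using d a_pos by simp
        finally show False
          using a_pos \<tau> by (simp add: s_def)
      qed
      then show "\<phi> = \<psi>"
        using *(1,2) unfolding G_def by (intro PiE_ext) auto
    qed
    then have "card G \<le> card C"
      using c(1) C(1) by (intro card_inj_on_le) auto
    also have "card G = (M + 1) ^ card I"
      by (simp add: G_def card_PiE finite_I)
    finally have "(M + 1) ^ card I \<le> card T ^ j"
      using C(2) by simp
    then have "real (M + 1) ^ card I \<le> real (card T) ^ j"
      by (metis of_nat_le_iff of_nat_power)
    moreover have "(1 / (b * s)) ^ card I \<le> real (M + 1) ^ card I"
      using M(2) b_pos s by (intro power_mono) auto
    moreover have "1 / (b * s) = 1 / K * (1 / \<tau>) ^ j"
      by (simp add: s_def K_def power_divide)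
    ultimately have "(1 / K * (1 / \<tau>) ^ j) ^ card I \<le> real (card T) ^ j"
      by simp
    then have "K ^ card I * (1 / K * (1 / \<tau>) ^ j) ^ card I \<le> K ^ card I * real (card T) ^ j"
      using K by (intro mult_left_mono) auto
    also have "K ^ card I * (1 / K * (1 / \<tau>) ^ j) ^ card I = (K * (1 / K * (1 / \<tau>) ^ j)) ^ card I"
      by (simp only: power_mult_distrib)
    also have "K * (1 / K * (1 / \<tau>) ^ j) = (1 / \<tau>) ^ j"
      using K by simp
    also have "((1 / \<tau>) ^ j) ^ card I = ((1 / \<tau>) ^ card I) ^ j"
      by (simp only: power_mult[symmetric] mult.commute)
    finally show "((1 / \<tau>) ^ card I) ^ j \<le> K ^ card I * real (card T) ^ j" .
  next
    show "0 \<le> (1 / \<tau>) ^ card I"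
      using \<tau> by simp
  qed (rule nT)
  then have "(\<rho> / \<omega>) ^ card I \<le> real (card T)"
    by (simp add: \<tau>_def)
  with T show ?thesis
    by blast
qed

end

section \<open>The operator norm of complex matrices\<close>

lemma vec_l2norm_eq_L2_set: "vec_l2norm v = L2_set (\<lambda>i. cmod (v $ i)) {..<dim_vec v}"
  by (simp add: vec_l2norm_def L2_set_def)

lemma vec_l2norm_nonneg: "0 \<le> vec_l2norm v"
  by (simp add: vec_l2norm_eq_L2_set)

lemma vec_l2norm_zero: "vec_l2norm (0\<^sub>v n) = 0"
  by (simp add: vec_l2norm_def)

lemma vec_l2norm_add:
  assumes "v \<in> carrier_vec n" "w \<in> carrier_vec n"
  shows "vec_l2norm (v + w) \<le> vec_l2norm v + vec_l2norm w"
proof -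
  have "vec_l2norm (v + w) \<le> L2_set (\<lambda>i. cmod (v $ i) + cmod (w $ i)) {..<n}"
    using assms unfolding vec_l2norm_eq_L2_set by (auto intro!: L2_set_mono norm_triangle_ineq)
  also have "\<dots> \<le> vec_l2norm v + vec_l2norm w"
    using assms L2_set_triangle_ineq[of "\<lambda>i. cmod (v $ i)" "\<lambda>i. cmod (w $ i)" "{..<n}"]
    by (simp add: vec_l2norm_eq_L2_set)
  finally show ?thesis .
qed

lemma vec_l2norm_smult: "vec_l2norm (c \<cdot>\<^sub>v v) = cmod c * vec_l2norm v"
proof -
  have "vec_l2norm (c \<cdot>\<^sub>v v) = L2_set (\<lambda>i. cmod c * cmod (v $ i)) {..<dim_vec v}"
    unfolding vec_l2norm_eq_L2_set by (intro L2_set_cong) (auto simp: norm_mult)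
  then show ?thesis
    by (simp add: vec_l2norm_eq_L2_set L2_set_right_distrib)
qed

lemma vec_l2norm_component: "i < dim_vec v \<Longrightarrow> cmod (v $ i) \<le> vec_l2norm v"
  unfolding vec_l2norm_eq_L2_set by (rule member_le_L2_set) auto

lemma vec_l2norm_le_sum: "vec_l2norm v \<le> (\<Sum>i<dim_vec v. cmod (v $ i))"
  unfolding vec_l2norm_eq_L2_set by (rule L2_set_le_sum) auto

lemma vec_l2norm_unit_vec: "i < n \<Longrightarrow> vec_l2norm (unit_vec n i) = 1"
  by (simp add: vec_l2norm_def unit_vec_def if_distrib[of cmod] if_distrib[of "\<lambda>x. x\<^sup>2"] cong: if_cong)

lemma mult_mat_vec_index:
  assumes "A \<in> carrier_mat n m" "v \<in> carrier_vec m" "i < n"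
  shows "(A *\<^sub>v v) $ i = (\<Sum>l<m. A $$ (i, l) * v $ l)"
  using assms by (simp add: scalar_prod_def lessThan_atLeast0)

lemma mult_mat_index:
  assumes "A \<in> carrier_mat n m" "B \<in> carrier_mat m p" "i < n" "j < p"
  shows "(A * B) $$ (i, j) = (\<Sum>l<m. A $$ (i, l) * B $$ (l, j))"
  using assms by (simp add: scalar_prod_def lessThan_atLeast0)

lemma vec_l2norm_mult_mat_vec_le_entries:
  assumes "A \<in> carrier_mat n m" "v \<in> carrier_vec m"
  shows "vec_l2norm (A *\<^sub>v v) \<le> (\<Sum>i<n. \<Sum>j<m. cmod (A $$ (i, j))) * vec_l2norm v"
proof -
  have "vec_l2norm (A *\<^sub>v v) \<le> (\<Sum>i<n. cmod ((A *\<^sub>v v) $ i))"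
    using vec_l2norm_le_sum[of "A *\<^sub>v v"] assms by simp
  also have "\<dots> \<le> (\<Sum>i<n. \<Sum>j<m. cmod (A $$ (i, j)) * vec_l2norm v)"
  proof (rule sum_mono)
    fix i
    assume "i \<in> {..<n}"
    then have "cmod ((A *\<^sub>v v) $ i) \<le> (\<Sum>j<m. cmod (A $$ (i, j) * v $ j))"
      using assms by (simp add: mult_mat_vec_index norm_sum del: index_mult_mat_vec)
    also have "\<dots> \<le> (\<Sum>j<m. cmod (A $$ (i, j)) * vec_l2norm v)"
      using assms by (intro sum_mono) (auto simp: norm_mult intro!: mult_left_mono vec_l2norm_component)
    finally show "cmod ((A *\<^sub>v v) $ i) \<le> \<dots>" .
  qed
  finally show ?thesis
    by (simp add: sum_distrib_right)
qed

lemma mat_opnorm_bdd_above: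
  "bdd_above ((\<lambda>v. vec_l2norm (A *\<^sub>v v)) ` {v \<in> carrier_vec (dim_col A). vec_l2norm v \<le> 1})"
proof (rule bdd_aboveI2)
  fix v
  assume v: "v \<in> {v \<in> carrier_vec (dim_col A). vec_l2norm v \<le> 1}"
  let ?S = "\<Sum>i<dim_row A. \<Sum>j<dim_col A. cmod (A $$ (i, j))"
  have "vec_l2norm (A *\<^sub>v v) \<le> ?S * vec_l2norm v"
    using v by (intro vec_l2norm_mult_mat_vec_le_entries) auto
  also have "\<dots> \<le> ?S * 1"
    using v by (intro mult_left_mono sum_nonneg) auto
  finally show "vec_l2norm (A *\<^sub>v v) \<le> ?S"
    by simp
qed

lemma mat_opnorm_le:
  assumes "A \<in> carrier_mat n m" "0 \<le> c"
      and "\<And>v. v \<in> carrier_vec m \<Longrightarrow> vec_l2norm (A *\<^sub>v v) \<le> c * vec_l2norm v"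
  shows "mat_opnorm A \<le> c"
  unfolding mat_opnorm_def
proof (rule cSUP_least)
  show "{v \<in> carrier_vec (dim_col A). vec_l2norm v \<le> 1} \<noteq> {}"
    by (auto simp: vec_l2norm_zero intro!: exI[of _ "0\<^sub>v (dim_col A)"])
  fix v
  assume v: "v \<in> {v \<in> carrier_vec (dim_col A). vec_l2norm v \<le> 1}"
  have "vec_l2norm (A *\<^sub>v v) \<le> c * vec_l2norm v"
    using v assms by auto
  also have "\<dots> \<le> c * 1"
    using v assms by (intro mult_left_mono) auto
  finally show "vec_l2norm (A *\<^sub>v v) \<le> c"
    by simp
qed

lemma mat_opnorm_nonneg: "0 \<le> mat_opnorm A"
proof -
  have "vec_l2norm (A *\<^sub>v 0\<^sub>v (dim_col A)) \<le> mat_opnorm A"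
    unfolding mat_opnorm_def by (rule cSUP_upper) (auto simp: vec_l2norm_zero mat_opnorm_bdd_above)
  with vec_l2norm_nonneg show ?thesis
    by (rule order.trans)
qed

lemma vec_l2norm_mult_mat_vec_le:
  assumes "A \<in> carrier_mat n m" "v \<in> carrier_vec m"
  shows "vec_l2norm (A *\<^sub>v v) \<le> mat_opnorm A * vec_l2norm v"
proof (cases "vec_l2norm v = 0")
  case True
  then show ?thesis
    using vec_l2norm_mult_mat_vec_le_entries[OF assms] by simp
next
  case False
  then have v: "vec_l2norm v > 0"
    using vec_l2norm_nonneg[of v] by simp
  define c where "c = complex_of_real (1 / vec_l2norm v)"
  have c: "cmod c = 1 / vec_l2norm v"
    using v by (simp add: c_def del: of_real_divide)
  have "vec_l2norm (A *\<^sub>v (c \<cdot>\<^sub>v v)) \<le> mat_opnorm A"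
    unfolding mat_opnorm_def
    by (rule cSUP_upper) (use assms v in \<open>auto simp: mat_opnorm_bdd_above vec_l2norm_smult c\<close>)
  also have "A *\<^sub>v (c \<cdot>\<^sub>v v) = c \<cdot>\<^sub>v (A *\<^sub>v v)"
    using assms by (rule mult_mat_vec)
  finally show ?thesis
    using v by (simp add: vec_l2norm_smult c field_simps)
qed

lemma mat_opnorm_le_entries:
  assumes "A \<in> carrier_mat n m"
  shows "mat_opnorm A \<le> (\<Sum>i<n. \<Sum>j<m. cmod (A $$ (i, j)))"
  using assms by (intro mat_opnorm_le[OF assms] vec_l2norm_mult_mat_vec_le_entries sum_nonneg) auto

lemma mat_opnorm_zero: "mat_opnorm (0\<^sub>m n m) = 0"
  using mat_opnorm_le_entries[of "0\<^sub>m n m" n m] mat_opnorm_nonneg[of "0\<^sub>m n m"] by simp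

lemma mat_opnorm_entry:
  assumes "A \<in> carrier_mat n m" "i < n" "j < m"
  shows "cmod (A $$ (i, j)) \<le> mat_opnorm A"
proof -
  have "A *\<^sub>v unit_vec m j = col A j"
    using assms by (intro eq_vecI) auto
  then have "cmod (A $$ (i, j)) \<le> vec_l2norm (A *\<^sub>v unit_vec m j)"
    using assms vec_l2norm_component[of i "col A j"] by simp
  also have "\<dots> \<le> mat_opnorm A"
    using vec_l2norm_mult_mat_vec_le[OF assms(1) unit_vec_carrier, of j] assms
    by (simp add: vec_l2norm_unit_vec)
  finally show ?thesis .
qed

lemma mat_opnorm_add:
  assumes "A \<in> carrier_mat n m" "B \<in> carrier_mat n m"
  shows "mat_opnorm (A + B) \<le> mat_opnorm A + mat_opnorm B"
proof (rule mat_opnorm_le)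
  fix v :: "complex vec"
  assume v: "v \<in> carrier_vec m"
  have "vec_l2norm ((A + B) *\<^sub>v v) \<le> vec_l2norm (A *\<^sub>v v) + vec_l2norm (B *\<^sub>v v)"
    unfolding add_mult_distrib_mat_vec[OF assms v] by (rule vec_l2norm_add[of _ n]) (use assms v in auto)
  also have "\<dots> \<le> mat_opnorm A * vec_l2norm v + mat_opnorm B * vec_l2norm v"
    using assms v by (intro add_mono vec_l2norm_mult_mat_vec_le) auto
  finally show "vec_l2norm ((A + B) *\<^sub>v v) \<le> (mat_opnorm A + mat_opnorm B) * vec_l2norm v"
    by (simp add: distrib_right)
qed (use assms mat_opnorm_nonneg in auto)

lemma mat_opnorm_mult:
  assumes "A \<in> carrier_mat n m" "B \<in> carrier_mat m p"
  shows "mat_opnorm (A * B) \<le> mat_opnorm A * mat_opnorm B"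
proof (rule mat_opnorm_le)
  fix v :: "complex vec"
  assume v: "v \<in> carrier_vec p"
  have "vec_l2norm ((A * B) *\<^sub>v v) = vec_l2norm (A *\<^sub>v (B *\<^sub>v v))"
    using assms v by simp
  also have "\<dots> \<le> mat_opnorm A * vec_l2norm (B *\<^sub>v v)"
    using assms v by (intro vec_l2norm_mult_mat_vec_le) auto
  also have "\<dots> \<le> mat_opnorm A * (mat_opnorm B * vec_l2norm v)"
    using assms v by (intro mult_left_mono vec_l2norm_mult_mat_vec_le mat_opnorm_nonneg)
  finally show "vec_l2norm ((A * B) *\<^sub>v v) \<le> (mat_opnorm A * mat_opnorm B) * vec_l2norm v"
    by (simp add: mult.assoc)
qed (use assms mat_opnorm_nonneg in auto)

lemma mat_opnorm_smult_le:
  assumes "A \<in> carrier_mat n m"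
  shows "mat_opnorm (c \<cdot>\<^sub>m A) \<le> cmod c * mat_opnorm A"
proof (rule mat_opnorm_le)
  fix v :: "complex vec"
  assume v: "v \<in> carrier_vec m"
  have "(c \<cdot>\<^sub>m A) *\<^sub>v v = c \<cdot>\<^sub>v (A *\<^sub>v v)"
    using assms v by (intro eq_vecI) auto
  then have "vec_l2norm ((c \<cdot>\<^sub>m A) *\<^sub>v v) = cmod c * vec_l2norm (A *\<^sub>v v)"
    by (simp add: vec_l2norm_smult)
  also have "\<dots> \<le> cmod c * (mat_opnorm A * vec_l2norm v)"
    using assms v by (intro mult_left_mono vec_l2norm_mult_mat_vec_le) auto
  finally show "vec_l2norm ((c \<cdot>\<^sub>m A) *\<^sub>v v) \<le> cmod c * mat_opnorm A * vec_l2norm v"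
    by (simp add: mult.assoc)
qed (use assms mat_opnorm_nonneg in auto)

lemma mat_opnorm_smult:
  assumes "A \<in> carrier_mat n m"
  shows "mat_opnorm (c \<cdot>\<^sub>m A) = cmod c * mat_opnorm A"
proof (cases "c = 0")
  case True
  then have "c \<cdot>\<^sub>m A = 0\<^sub>m n m"
    using assms by (intro eq_matI) auto
  then show ?thesis
    using True by (simp add: mat_opnorm_zero)
next
  case False
  have "A = inverse c \<cdot>\<^sub>m (c \<cdot>\<^sub>m A)"
    using False by (intro eq_matI) auto
  then have "mat_opnorm A \<le> cmod (inverse c) * mat_opnorm (c \<cdot>\<^sub>m A)"
    using mat_opnorm_smult_le[of "c \<cdot>\<^sub>m A" n m "inverse c"] assms by simp
  then have "cmod c * mat_opnorm A \<le> mat_opnorm (c \<cdot>\<^sub>m A)"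
    using False by (simp add: norm_inverse norm_divide field_simps)
  with mat_opnorm_smult_le[OF assms, of c] show ?thesis
    by simp
qed

lemma mat_opnorm_minus_commute:
  assumes "A \<in> carrier_mat n m" "B \<in> carrier_mat n m"
  shows "mat_opnorm (A - B) = mat_opnorm (B - A)"
proof -
  have "A - B = (-1) \<cdot>\<^sub>m (B - A)"
    using assms by (intro eq_matI) auto
  then show ?thesis
    using mat_opnorm_smult[of "B - A" n m "-1"] assms by (simp add: minus_carrier_mat)
qed

lemma mat_opnorm_diff:
  assumes "A \<in> carrier_mat n m" "B \<in> carrier_mat n m"
  shows "mat_opnorm (A - B) \<le> mat_opnorm A + mat_opnorm B"
proof -
  have "A - B = A + (-1) \<cdot>\<^sub>m B"
    using assms by (intro eq_matI) auto
  then show ?thesis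
    using mat_opnorm_add[of A n m "(-1) \<cdot>\<^sub>m B"] mat_opnorm_smult[of B n m "-1"] assms by simp
qed

lemma mat_opnorm_diff_triangle:
  assumes "A \<in> carrier_mat n m" "B \<in> carrier_mat n m" "C \<in> carrier_mat n m"
  shows "mat_opnorm (A - C) \<le> mat_opnorm (A - B) + mat_opnorm (B - C)"
proof -
  have "A - C = (A - B) + (B - C)"
    using assms by (intro eq_matI) auto
  then show ?thesis
    using mat_opnorm_add[of "A - B" n m "B - C"] assms by (simp add: minus_carrier_mat)
qed

lemma mat_opnorm_diag_le:
  assumes "0 \<le> c" "\<And>i. i < k \<Longrightarrow> cmod (d i) \<le> c"
  shows "mat_opnorm (mat_diag k d) \<le> c"
proof (rule mat_opnorm_le[OF mat_diag_dim])
  fix v :: "complex vec"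
  assume v: "v \<in> carrier_vec k"
  have "(mat_diag k d *\<^sub>v v) $ i = d i * v $ i" if "i < k" for i
  proof -
    have "(mat_diag k d *\<^sub>v v) $ i = (\<Sum>l<k. if l = i then d i * v $ i else 0)"
      unfolding mult_mat_vec_index[OF mat_diag_dim v that]
      using that by (intro sum.cong) (auto simp: mat_diag_def)
    then show ?thesis
      using that by simp
  qed
  then have "vec_l2norm (mat_diag k d *\<^sub>v v) \<le> L2_set (\<lambda>i. c * cmod (v $ i)) {..<k}"
    unfolding vec_l2norm_eq_L2_set using assms
    by (auto simp: norm_mult mat_diag_def intro!: L2_set_mono mult_right_mono)
  then show "vec_l2norm (mat_diag k d *\<^sub>v v) \<le> c * vec_l2norm v"
    using v assms(1) by (simp add: vec_l2norm_eq_L2_set L2_set_right_distrib)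
qed (use assms in auto)

text \<open>
  Multiplying the blocks of a matrix by fixed scalars is bounded in operator norm uniformly in the
  size of the matrix; this is where it matters that the number of blocks is fixed.
\<close>
lemma mat_opnorm_block_multiplier:
  fixes d :: "nat \<Rightarrow> 'c"
  assumes M: "M \<in> carrier_mat k k" and "finite \<Lambda>" and d: "\<And>i. i < k \<Longrightarrow> d i \<in> \<Lambda>"
  shows "mat_opnorm (mat k k (\<lambda>(i, j). \<phi> (d i) (d j) * M $$ (i, j)))
           \<le> (\<Sum>(p, q)\<in>\<Lambda> \<times> \<Lambda>. cmod (\<phi> p q)) * mat_opnorm M"
proof -
  define X where "X = (\<lambda>F. mat k k (\<lambda>(i, j). if (d i, d j) \<in> F then \<phi> (d i) (d j) * M $$ (i, j) else 0))"
  have X: "X F \<in> carrier_mat k k" for F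
    by (simp add: X_def)
  have "mat_opnorm (X F) \<le> (\<Sum>(p, q)\<in>F. cmod (\<phi> p q)) * mat_opnorm M" if "finite F" for F
    using that
  proof (induction F)
    case empty
    have "X {} = 0\<^sub>m k k"
      by (auto simp: X_def)
    then show ?case
      by (simp add: mat_opnorm_zero)
  next
    case (insert pq F)
    obtain p q where pq: "pq = (p, q)"
      by (cases pq)
    define P where "P = (\<lambda>p. mat_diag k (\<lambda>i. if d i = p then 1 else 0 :: complex))"
    have P: "P p \<in> carrier_mat k k" "mat_opnorm (P p) \<le> 1" for p
      unfolding P_def by (auto intro!: mat_opnorm_diag_le)
    have PM: "P p * M \<in> carrier_mat k k"
      using P(1) M by (rule mult_carrier_mat)
    have PMP: "P p * M * P q = mat k k (\<lambda>(i, j). (if d i = p then 1 else 0) * M $$ (i, j) * (if d j = q then 1 else 0))"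
      unfolding P_def mat_diag_mult_left[OF M] by (subst mat_diag_mult_right[of _ k k]) auto
    have "X (insert pq F) = X F + \<phi> p q \<cdot>\<^sub>m (P p * M * P q)"
      unfolding PMP using insert.hyps by (intro eq_matI) (auto simp: X_def pq)
    then have "mat_opnorm (X (insert pq F)) \<le> mat_opnorm (X F) + cmod (\<phi> p q) * mat_opnorm (P p * M * P q)"
      using mat_opnorm_add[of "X F" k k "\<phi> p q \<cdot>\<^sub>m (P p * M * P q)"] X PM P
      by (simp add: mat_opnorm_smult[of _ k k])
    also have "mat_opnorm (P p * M * P q) \<le> mat_opnorm (P p) * mat_opnorm M * mat_opnorm (P q)"
      using mat_opnorm_mult[OF PM P(1)] mat_opnorm_mult[OF P(1) M] mat_opnorm_nonneg
      by (meson mult_right_mono order.trans)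
    also have "\<dots> \<le> 1 * mat_opnorm M * 1"
      using P(2) mat_opnorm_nonneg by (intro mult_mono) auto
    finally show ?case
      using insert by (simp add: pq distrib_right mult_left_mono)
  qed
  from this[of "\<Lambda> \<times> \<Lambda>"] have "mat_opnorm (X (\<Lambda> \<times> \<Lambda>)) \<le> (\<Sum>(p, q)\<in>\<Lambda> \<times> \<Lambda>. cmod (\<phi> p q)) * mat_opnorm M"
    using assms(2) by simp
  also have "X (\<Lambda> \<times> \<Lambda>) = mat k k (\<lambda>(i, j). \<phi> (d i) (d j) * M $$ (i, j))"
    using d by (intro eq_matI) (auto simp: X_def)
  finally show ?thesis .
qed

section \<open>Unitary diagonalization\<close>

lemma mat_adjoint_dim [simp]:
  "dim_row (mat_adjoint A) = dim_col A" "dim_col (mat_adjoint A) = dim_row A"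
  by (simp_all add: mat_adjoint_def mat_of_rows_def)

lemma mat_adjoint_carrier [simp]: "A \<in> carrier_mat n m \<Longrightarrow> mat_adjoint A \<in> carrier_mat m n"
  by (intro carrier_matI) auto

lemma mat_adjoint_index [simp]:
  "i < dim_col A \<Longrightarrow> j < dim_row A \<Longrightarrow> mat_adjoint A $$ (i, j) = cnj (A $$ (j, i))"
  by (simp add: mat_adjoint_def mat_of_rows_index)

lemma mat_adjoint_adjoint [simp]: "mat_adjoint (mat_adjoint A) = (A :: complex mat)"
  by (rule eq_matI) auto

lemma mat_adjoint_mult:
  assumes "A \<in> carrier_mat n m" "B \<in> carrier_mat m p"
  shows "mat_adjoint (A * B) = mat_adjoint B * mat_adjoint (A :: complex mat)"
proof (rule eq_matI)
  fix i j
  assume ij: "i < dim_row (mat_adjoint B * mat_adjoint A)" "j < dim_col (mat_adjoint B * mat_adjoint A)"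
  have "(A * B) $$ (j, i) = (\<Sum>l<m. A $$ (j, l) * B $$ (l, i))"
    using assms ij by (intro mult_mat_index) auto
  moreover have "(mat_adjoint B * mat_adjoint A) $$ (i, j) = (\<Sum>l<m. mat_adjoint B $$ (i, l) * mat_adjoint A $$ (l, j))"
    using assms ij by (intro mult_mat_index) auto
  ultimately show "mat_adjoint (A * B) $$ (i, j) = (mat_adjoint B * mat_adjoint A) $$ (i, j)"
    using assms ij by (simp add: mult.commute del: index_mult_mat(1))
qed (use assms in auto)

lemma mat_adjoint_diff:
  assumes "A \<in> carrier_mat n m" "B \<in> carrier_mat n m"
  shows "mat_adjoint (A - B) = mat_adjoint A - mat_adjoint (B :: complex mat)"
  using assms by (intro eq_matI) auto

lemma mat_adjoint_add:
  assumes "A \<in> carrier_mat n m" "B \<in> carrier_mat n m"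
  shows "mat_adjoint (A + B) = mat_adjoint A + mat_adjoint (B :: complex mat)"
  using assms by (intro eq_matI) auto

definition unitary_mat :: "nat \<Rightarrow> complex mat \<Rightarrow> bool" where
  "unitary_mat k U \<longleftrightarrow> U \<in> carrier_mat k k \<and> mat_adjoint U * U = 1\<^sub>m k \<and> U * mat_adjoint U = 1\<^sub>m k"

lemma unitary_mat_carrier: "unitary_mat k U \<Longrightarrow> U \<in> carrier_mat k k"
  by (simp add: unitary_mat_def)

lemma unitary_mat_adjoint: "unitary_mat k U \<Longrightarrow> unitary_mat k (mat_adjoint U)"
  by (simp add: unitary_mat_def)

lemma unitary_mat_one: "unitary_mat k (1\<^sub>m k)"
proof -
  have "mat_adjoint (1\<^sub>m k) = (1\<^sub>m k :: complex mat)"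
    by (rule eq_matI) auto
  then show ?thesis
    by (simp add: unitary_mat_def)
qed

lemma mat_assoc4:
  assumes "A \<in> carrier_mat k k" "B \<in> carrier_mat k k" "C \<in> carrier_mat k k" "D \<in> carrier_mat k k"
  shows "A * B * (C * D) = A * ((B * C) * D)"
  using assms by (simp add: assoc_mult_mat[of _ k k _ k _ k] mult_carrier_mat[of _ k k _ k])

lemma mat_assoc5:
  assumes "A \<in> carrier_mat k k" "B \<in> carrier_mat k k" "C \<in> carrier_mat k k" "D \<in> carrier_mat k k"
    "E \<in> carrier_mat k k"
  shows "A * (B * C * D) * E = (A * B) * C * (D * E)"
  using assms by (simp add: assoc_mult_mat[of _ k k _ k _ k] mult_carrier_mat[of _ k k _ k])

lemma mat_assoc6:
  assumes "A \<in> carrier_mat k k" "B \<in> carrier_mat k k" "C \<in> carrier_mat k k" "D \<in> carrier_mat k k"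
    "E \<in> carrier_mat k k" "F \<in> carrier_mat k k"
  shows "(A * B * C) * (D * E * F) = A * (B * ((C * D) * E)) * F"
  using assms by (simp add: assoc_mult_mat[of _ k k _ k _ k] mult_carrier_mat[of _ k k _ k])

lemma unitary_mat_mult:
  assumes "unitary_mat k U" "unitary_mat k V"
  shows "unitary_mat k (U * V)"
proof -
  have U: "U \<in> carrier_mat k k" "mat_adjoint U \<in> carrier_mat k k" "mat_adjoint U * U = 1\<^sub>m k"
      "U * mat_adjoint U = 1\<^sub>m k"
    and V: "V \<in> carrier_mat k k" "mat_adjoint V \<in> carrier_mat k k" "mat_adjoint V * V = 1\<^sub>m k"
      "V * mat_adjoint V = 1\<^sub>m k"
    using assms by (auto simp: unitary_mat_def)
  have "mat_adjoint V * mat_adjoint U * (U * V) = 1\<^sub>m k"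
    unfolding mat_assoc4[OF V(2) U(2) U(1) V(1)] U(3) using V by simp
  moreover have "U * V * (mat_adjoint V * mat_adjoint U) = 1\<^sub>m k"
    unfolding mat_assoc4[OF U(1) V(1) V(2) U(2)] V(4) using U by simp
  ultimately show ?thesis
    using U(1) V(1) by (simp add: unitary_mat_def mat_adjoint_mult[of _ k k _ k] mult_carrier_mat[of _ k k _ k])
qed

lemma inner_self: "v \<bullet>c v = complex_of_real ((vec_l2norm v)\<^sup>2)"
proof -
  have "(vec_l2norm v)\<^sup>2 = (\<Sum>i<dim_vec v. (cmod (v $ i))\<^sup>2)"
    by (simp add: vec_l2norm_def sum_nonneg)
  then show ?thesis
    by (simp add: scalar_prod_def lessThan_atLeast0 complex_norm_square del: of_real_power)
qed

lemma inner_mult_mat_vec: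
  fixes A :: "complex mat"
  assumes "A \<in> carrier_mat n m" "v \<in> carrier_vec m" "w \<in> carrier_vec n"
  shows "(A *\<^sub>v v) \<bullet>c w = v \<bullet>c (mat_adjoint A *\<^sub>v w)"
proof -
  have "(A *\<^sub>v v) \<bullet>c w = (\<Sum>i<n. (A *\<^sub>v v) $ i * cnj (w $ i))"
    using assms by (simp add: scalar_prod_def lessThan_atLeast0)
  also have "\<dots> = (\<Sum>i<n. \<Sum>j<m. A $$ (i, j) * v $ j * cnj (w $ i))"
    using assms by (intro sum.cong refl) (simp add: mult_mat_vec_index sum_distrib_right del: index_mult_mat_vec)
  also have "\<dots> = (\<Sum>j<m. \<Sum>i<n. A $$ (i, j) * v $ j * cnj (w $ i))"
    by (rule sum.swap)
  also have "\<dots> = (\<Sum>j<m. v $ j * cnj ((mat_adjoint A *\<^sub>v w) $ j))"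
    using assms by (intro sum.cong refl)
      (simp add: mult_mat_vec_index[of _ m n] sum_distrib_left mult_ac del: index_mult_mat_vec)
  also have "\<dots> = v \<bullet>c (mat_adjoint A *\<^sub>v w)"
    using assms by (simp add: scalar_prod_def lessThan_atLeast0)
  finally show ?thesis .
qed

lemma vec_l2norm_unitary:
  assumes "unitary_mat k U" "v \<in> carrier_vec k"
  shows "vec_l2norm (U *\<^sub>v v) = vec_l2norm v"
proof -
  have U: "U \<in> carrier_mat k k" "mat_adjoint U \<in> carrier_mat k k" "mat_adjoint U * U = 1\<^sub>m k"
    using assms(1) by (auto simp: unitary_mat_def)
  have "(U *\<^sub>v v) \<bullet>c (U *\<^sub>v v) = v \<bullet>c (mat_adjoint U *\<^sub>v (U *\<^sub>v v))"
    using U assms(2) by (intro inner_mult_mat_vec) auto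
  also have "mat_adjoint U *\<^sub>v (U *\<^sub>v v) = (mat_adjoint U * U) *\<^sub>v v"
    using U(1,2) assms(2) by (simp add: assoc_mult_mat_vec[of _ k k _ k])
  also have "\<dots> = v"
    using U(3) assms(2) by simp
  finally have "complex_of_real ((vec_l2norm (U *\<^sub>v v))\<^sup>2) = complex_of_real ((vec_l2norm v)\<^sup>2)"
    by (simp only: inner_self)
  then have "(vec_l2norm (U *\<^sub>v v))\<^sup>2 = (vec_l2norm v)\<^sup>2"
    by (simp only: of_real_eq_iff)
  then show ?thesis
    using vec_l2norm_nonneg by (simp add: power2_eq_iff_nonneg)
qed

lemma mat_opnorm_unitary_le: "unitary_mat k U \<Longrightarrow> mat_opnorm U \<le> 1"
  by (rule mat_opnorm_le[where n = k and m = k]) (auto simp: vec_l2norm_unitary unitary_mat_def)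

lemma mat_opnorm_unitary_conj_le:
  assumes "unitary_mat k U" "A \<in> carrier_mat k k"
  shows "mat_opnorm (U * A * mat_adjoint U) \<le> mat_opnorm A"
proof -
  have U: "U \<in> carrier_mat k k" "mat_adjoint U \<in> carrier_mat k k"
    using assms(1) by (auto simp: unitary_mat_def)
  have "mat_opnorm (U * A * mat_adjoint U) \<le> mat_opnorm U * mat_opnorm A * mat_opnorm (mat_adjoint U)"
    using mat_opnorm_mult[of "U * A" k k "mat_adjoint U" k] mat_opnorm_mult[of U k k A k] U assms(2)
      mat_opnorm_nonneg by (meson mult_right_mono mult_carrier_mat order.trans)
  also have "\<dots> \<le> 1 * mat_opnorm A * 1"
    using mat_opnorm_unitary_le[OF assms(1)] mat_opnorm_unitary_le[OF unitary_mat_adjoint[OF assms(1)]]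
      mat_opnorm_nonneg by (intro mult_mono) auto
  finally show ?thesis
    by simp
qed

lemma unitary_conj_cancel:
  assumes "unitary_mat k U" "A \<in> carrier_mat k k"
  shows "mat_adjoint U * (U * A * mat_adjoint U) * U = A"
proof -
  have U: "U \<in> carrier_mat k k" "mat_adjoint U \<in> carrier_mat k k" "mat_adjoint U * U = 1\<^sub>m k"
    using assms(1) by (auto simp: unitary_mat_def)
  show ?thesis
    unfolding mat_assoc5[OF U(2) U(1) assms(2) U(2) U(1)] U(3) using assms(2) by simp
qed

lemma mat_opnorm_unitary_conj:
  assumes "unitary_mat k U" "A \<in> carrier_mat k k"
  shows "mat_opnorm (U * A * mat_adjoint U) = mat_opnorm A"
proof (rule antisym)
  have c: "U * A * mat_adjoint U \<in> carrier_mat k k"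
    using assms by (auto simp: unitary_mat_def)
  show "mat_opnorm A \<le> mat_opnorm (U * A * mat_adjoint U)"
    using mat_opnorm_unitary_conj_le[OF unitary_mat_adjoint[OF assms(1)] c]
    by (simp add: unitary_conj_cancel[OF assms])
qed (rule mat_opnorm_unitary_conj_le[OF assms])

definition unitary_diag :: "nat \<Rightarrow> complex mat \<Rightarrow> (nat \<Rightarrow> complex) \<Rightarrow> complex mat" where
  "unitary_diag k U d = U * mat_diag k d * mat_adjoint U"

abbreviation rdiag :: "nat \<Rightarrow> (nat \<Rightarrow> real) \<Rightarrow> complex mat" where
  "rdiag k d \<equiv> mat_diag k (\<lambda>i. complex_of_real (d i))"

abbreviation unitary_rdiag :: "nat \<Rightarrow> complex mat \<Rightarrow> (nat \<Rightarrow> real) \<Rightarrow> complex mat" where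
  "unitary_rdiag k U d \<equiv> unitary_diag k U (\<lambda>i. complex_of_real (d i))"

lemma unitary_diag_carrier [simp]: "U \<in> carrier_mat k k \<Longrightarrow> unitary_diag k U d \<in> carrier_mat k k"
  by (auto simp: unitary_diag_def)

lemma unitary_diag_dim [simp]:
  "dim_row (unitary_diag k U d) = dim_row U" "dim_col (unitary_diag k U d) = dim_row U"
  by (simp_all add: unitary_diag_def)

lemma unitary_diag_index:
  assumes "U \<in> carrier_mat k k" "i < k" "j < k"
  shows "unitary_diag k U d $$ (i, j) = (\<Sum>a<k. U $$ (i, a) * d a * cnj (U $$ (j, a)))"
proof -
  have "U * mat_diag k d \<in> carrier_mat k k"
    using assms by auto
  then have "unitary_diag k U d $$ (i, j) = (\<Sum>a<k. (U * mat_diag k d) $$ (i, a) * mat_adjoint U $$ (a, j))"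
    unfolding unitary_diag_def using assms by (intro mult_mat_index) auto
  then show ?thesis
    using assms by (simp add: mat_diag_mult_right[OF assms(1)])
qed

lemma mat_adjoint_unitary_diag:
  assumes "U \<in> carrier_mat k k"
  shows "mat_adjoint (unitary_diag k U d) = unitary_diag k U (\<lambda>a. cnj (d a))"
  using assms by (intro eq_matI) (auto simp: unitary_diag_index mult_ac)

lemma unitary_diag_diff:
  assumes "U \<in> carrier_mat k k"
  shows "unitary_diag k U d - unitary_diag k U e = unitary_diag k U (\<lambda>a. d a - e a)"
  using assms by (intro eq_matI) (auto simp: unitary_diag_index algebra_simps sum_subtractf)

lemma unitary_diag_mult:
  assumes "unitary_mat k U"
  shows "unitary_diag k U d * unitary_diag k U e = unitary_diag k U (\<lambda>a. d a * e a)"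
proof -
  have U: "U \<in> carrier_mat k k" "mat_adjoint U \<in> carrier_mat k k" "mat_adjoint U * U = 1\<^sub>m k"
    using assms(1) by (auto simp: unitary_mat_def)
  show ?thesis
    unfolding unitary_diag_def mat_assoc6[OF U(1) mat_diag_dim U(2) U(1) mat_diag_dim U(2)] U(3)
    by (simp add: left_mult_one_mat[OF mat_diag_dim])
qed

lemma unitary_diag_one: "unitary_mat k U \<Longrightarrow> unitary_diag k U (\<lambda>_. 1) = 1\<^sub>m k"
  by (simp add: unitary_diag_def unitary_mat_def right_mult_one_mat[of U k k])

lemma unitary_diag_pow:
  assumes "unitary_mat k U"
  shows "unitary_diag k U d ^\<^sub>m l = unitary_diag k U (\<lambda>a. d a ^ l)"
proof (induction l)
  case 0
  have "dim_row (unitary_diag k U d) = k"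
    using unitary_mat_carrier[OF assms] by auto
  then show ?case
    by (simp add: unitary_diag_one[OF assms])
next
  case (Suc l)
  then show ?case
    by (simp add: unitary_diag_mult[OF assms] mult.commute)
qed

lemma mat_poly_unitary_diag:
  assumes "unitary_mat k U"
  shows "mat_poly p (unitary_diag k U d) = unitary_diag k U (\<lambda>a. poly p (d a))"
proof -
  have U: "U \<in> carrier_mat k k"
    using assms by (rule unitary_mat_carrier)
  have dim: "dim_row U = k"
    using U by auto
  show ?thesis
  proof (rule eq_matI)
    fix i j
    assume "i < dim_row (unitary_diag k U (\<lambda>a. poly p (d a)))" "j < dim_col (unitary_diag k U (\<lambda>a. poly p (d a)))"
    then have ij: "i < k" "j < k"
      by (simp_all add: dim)
    have "mat_poly p (unitary_diag k U d) $$ (i, j) =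
        (\<Sum>l\<le>degree p. coeff p l * (\<Sum>a<k. U $$ (i, a) * d a ^ l * cnj (U $$ (j, a))))"
      using ij by (simp add: mat_poly_def dim unitary_diag_pow[OF assms] unitary_diag_index[OF U])
    also have "\<dots> = (\<Sum>a<k. \<Sum>l\<le>degree p. coeff p l * (U $$ (i, a) * d a ^ l * cnj (U $$ (j, a))))"
      unfolding sum_distrib_left by (rule sum.swap)
    also have "\<dots> = unitary_diag k U (\<lambda>a. poly p (d a)) $$ (i, j)"
      using ij by (simp add: unitary_diag_index[OF U] poly_altdef sum_distrib_left sum_distrib_right mult_ac)
    finally show "mat_poly p (unitary_diag k U d) $$ (i, j) = unitary_diag k U (\<lambda>a. poly p (d a)) $$ (i, j)" .
  qed (simp_all add: mat_poly_def dim)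
qed

lemma mat_opnorm_unitary_diag_le:
  assumes "unitary_mat k U" "0 \<le> c" "\<And>a. a < k \<Longrightarrow> cmod (d a) \<le> c"
  shows "mat_opnorm (unitary_diag k U d) \<le> c"
proof -
  have "mat_opnorm (mat_diag k d) \<le> c"
    using assms(2,3) by (rule mat_opnorm_diag_le)
  then show ?thesis
    unfolding unitary_diag_def using mat_opnorm_unitary_conj_le[OF assms(1) mat_diag_dim, of d] by simp
qed

lemma mat_opnorm_unitary_diag_ge:
  assumes "unitary_mat k U" "a < k"
  shows "cmod (d a) \<le> mat_opnorm (unitary_diag k U d)"
proof -
  have "cmod (mat_diag k d $$ (a, a)) \<le> mat_opnorm (mat_diag k d)"
    by (rule mat_opnorm_entry[of _ k k]) (use assms in auto)
  then show ?thesis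
    using assms(2) by (simp add: unitary_diag_def mat_opnorm_unitary_conj[OF assms(1)] mat_diag_def)
qed

text \<open>
  Gram-Schmidt applied to a basis that starts with \<open>v\<close>, with the columns normalized.
\<close>
lemma unitary_with_first_column:
  assumes v: "v \<in> carrier_vec n" and v0: "v \<noteq> 0\<^sub>v n"
  shows "\<exists>W c. unitary_mat n W \<and> c \<noteq> 0 \<and> col W 0 = c \<cdot>\<^sub>v (v :: complex vec)"
proof -
  interpret cof_vec_space n "TYPE(complex)" .
  define b where "b = basis_completion v"
  define ws where "ws = gram_schmidt n b"
  have b: "distinct b" "\<not> lin_dep (set b)" "set b \<subseteq> carrier_vec n" "hd b = v" "length b = n"
    using basis_completion[OF v v0] unfolding b_def by auto
  have "n \<noteq> 0"
  proof
    assume "n = 0"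
    then have "v = 0\<^sub>v n"
      using v by (intro eq_vecI) auto
    then show False
      using v0 by simp
  qed
  then obtain vs where bv: "b = v # vs"
    using b(4,5) by (cases b) auto
  have ws: "set ws \<subseteq> carrier_vec n" "corthogonal ws" "length ws = n"
    using gram_schmidt_result[OF b(3,1,2) refl] b(5) by (auto simp: ws_def)
  have hd: "hd ws = v"
    using gram_schmidt_hd[OF v, of vs] by (simp add: ws_def bv)
  then have ws0: "ws ! 0 = v"
    using ws(3) \<open>n \<noteq> 0\<close> by (metis hd_conv_nth length_0_conv)
  define s where "s = (\<lambda>j. complex_of_real (1 / vec_l2norm (ws ! j)))"
  define W where "W = mat n n (\<lambda>(i, j). s j * ws ! j $ i)"
  have W: "W \<in> carrier_mat n n"
    by (simp add: W_def)
  have wsc: "ws ! j \<in> carrier_vec n" if "j < n" for j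
    using ws that by auto
  have nz: "vec_l2norm (ws ! j) \<noteq> 0" if "j < n" for j
  proof
    assume "vec_l2norm (ws ! j) = 0"
    then have "ws ! j \<bullet>c ws ! j = 0"
      by (simp add: inner_self)
    then show False
      using corthogonalD[OF ws(2), of j j] that ws(3) by simp
  qed
  have "mat_adjoint W * W = 1\<^sub>m n"
  proof (rule eq_matI)
    fix i j
    assume "i < dim_row (1\<^sub>m n :: complex mat)" "j < dim_col (1\<^sub>m n :: complex mat)"
    then have ij: "i < n" "j < n"
      by auto
    have "(mat_adjoint W * W) $$ (i, j) = (\<Sum>l<n. mat_adjoint W $$ (i, l) * W $$ (l, j))"
      using W ij by (intro mult_mat_index) auto
    also have "\<dots> = (\<Sum>l<n. cnj (s i) * s j * (ws ! j $ l * cnj (ws ! i $ l)))"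
      using W ij by (intro sum.cong) (auto simp: W_def)
    also have "\<dots> = cnj (s i) * s j * (ws ! j \<bullet>c ws ! i)"
      using wsc[OF ij(1)] wsc[OF ij(2)] by (simp add: scalar_prod_def sum_distrib_left lessThan_atLeast0)
    also have "\<dots> = (if i = j then 1 else 0)"
    proof (cases "i = j")
      case True
      have "cnj (s j) * s j * complex_of_real ((vec_l2norm (ws ! j))\<^sup>2) = 1"
        using nz[OF ij(2)] by (simp add: s_def power2_eq_square)
      then show ?thesis
        using True by (simp add: inner_self)
    next
      case False
      then show ?thesis
        using corthogonalD[OF ws(2), of j i] ws(3) ij by simp
    qed
    finally show "(mat_adjoint W * W) $$ (i, j) = 1\<^sub>m n $$ (i, j)"
      using ij by simp
  qed (use W in auto)
  then have "unitary_mat n W"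
    using W mat_mult_left_right_inverse[of "mat_adjoint W" n W] by (simp add: unitary_mat_def)
  moreover have "col W 0 = s 0 \<cdot>\<^sub>v v"
    using \<open>n \<noteq> 0\<close> v ws0 by (intro eq_vecI) (auto simp: W_def)
  moreover have "s 0 \<noteq> 0"
    using nz[of 0] \<open>n \<noteq> 0\<close> by (simp add: s_def)
  ultimately show ?thesis
    by blast
qed

definition direct_sum :: "complex mat \<Rightarrow> complex mat \<Rightarrow> complex mat" where
  "direct_sum A B = four_block_mat A (0\<^sub>m (dim_row A) (dim_col B)) (0\<^sub>m (dim_row B) (dim_col A)) B"

lemma direct_sum_carrier:
  "A \<in> carrier_mat n n \<Longrightarrow> B \<in> carrier_mat m m \<Longrightarrow> direct_sum A B \<in> carrier_mat (n + m) (n + m)"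
  by (auto simp: direct_sum_def)

lemma direct_sum_mult:
  assumes "A \<in> carrier_mat n n" "B \<in> carrier_mat m m" "C \<in> carrier_mat n n" "D \<in> carrier_mat m m"
  shows "direct_sum A B * direct_sum C D = direct_sum (A * C) (B * D)"
proof -
  have d: "dim_row A = n" "dim_col A = n" "dim_row B = m" "dim_col B = m"
    "dim_row C = n" "dim_col C = n" "dim_row D = m" "dim_col D = m"
    using assms by auto
  have AC: "A * C \<in> carrier_mat n n" "B * D \<in> carrier_mat m m"
    using assms by auto
  show ?thesis
    unfolding direct_sum_def d
    by (subst mult_four_block_mat[of _ n n _ m _ m _ _ n _ m])
      (use assms AC in \<open>auto simp: right_mult_zero_mat[of _ n n] left_mult_zero_mat[of _ m m]
        right_mult_zero_mat[of _ m m] left_mult_zero_mat[of _ n n] d\<close>)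
qed

lemma direct_sum_adjoint:
  assumes "A \<in> carrier_mat n n" "B \<in> carrier_mat m m"
  shows "mat_adjoint (direct_sum A B) = direct_sum (mat_adjoint A) (mat_adjoint B)"
  using assms by (intro eq_matI) (auto simp: direct_sum_def)

lemma direct_sum_one: "direct_sum (1\<^sub>m n) (1\<^sub>m m) = 1\<^sub>m (n + m)"
  by (intro eq_matI) (auto simp: direct_sum_def)

lemma direct_sum_diag:
  "direct_sum (mat_diag n d) (mat_diag m e) = mat_diag (n + m) (\<lambda>i. if i < n then d i else e (i - n))"
  by (intro eq_matI) (auto simp: direct_sum_def mat_diag_def)

lemma unitary_direct_sum:
  assumes "unitary_mat n U" "unitary_mat m V"
  shows "unitary_mat (n + m) (direct_sum U V)"
  using assms unfolding unitary_mat_def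
  by (auto simp: direct_sum_carrier direct_sum_adjoint[of U n V m] direct_sum_mult[of _ n _ m] direct_sum_one)

lemma direct_sum_unitary_diag:
  assumes "unitary_mat n U" "unitary_mat m V"
  shows "direct_sum (unitary_diag n U d) (unitary_diag m V e) =
    unitary_diag (n + m) (direct_sum U V) (\<lambda>i. if i < n then d i else e (i - n))"
proof -
  have c: "U \<in> carrier_mat n n" "V \<in> carrier_mat m m"
    using assms by (auto simp: unitary_mat_def)
  show ?thesis
    unfolding unitary_diag_def direct_sum_diag[symmetric] direct_sum_adjoint[OF c]
    using c by (simp add: direct_sum_mult[of _ n _ m] mult_carrier_mat[of _ n n _ n] mult_carrier_mat[of _ m m _ m])
qed

text \<open>
  Deflation: in an orthonormal basis that starts with an eigenvector, a self-adjoint matrix is the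
  direct sum of a real number and a smaller self-adjoint matrix.
\<close>
theorem selfadjoint_unitary_diagonalization:
  assumes "A \<in> carrier_mat k k" "mat_adjoint A = A"
  shows "\<exists>U d. unitary_mat k U \<and> A = unitary_rdiag k U d"
  using assms
proof (induction k arbitrary: A)
  case 0
  have "A = unitary_diag 0 (1\<^sub>m 0) (\<lambda>i. complex_of_real 0)"
    using 0 by (intro eq_matI) auto
  then show ?case
    using unitary_mat_one[of 0] by (intro exI[of _ "1\<^sub>m 0"] exI[of _ "\<lambda>_. 0"]) auto
next
  case (Suc k)
  note A = Suc.prems(1)
  obtain as where as: "char_poly A = (\<Prod>a\<leftarrow>as. [:- a, 1:])" "length as = Suc k"
    using char_poly_factorized[OF A] by blast
  then obtain l as' where "as = l # as'"
    by (cases as) auto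
  then have "eigenvalue A l"
    unfolding eigenvalue_root_char_poly[OF A] using as(1) by simp
  then obtain v where v: "v \<in> carrier_vec (Suc k)" "v \<noteq> 0\<^sub>v (Suc k)" "A *\<^sub>v v = l \<cdot>\<^sub>v v"
    using A by (auto simp: eigenvalue_def eigenvector_def)
  obtain W c where W: "unitary_mat (Suc k) W" "c \<noteq> 0" "col W 0 = c \<cdot>\<^sub>v v"
    using unitary_with_first_column[OF v(1,2)] by blast
  have Wc: "W \<in> carrier_mat (Suc k) (Suc k)" "mat_adjoint W \<in> carrier_mat (Suc k) (Suc k)"
    "mat_adjoint W * W = 1\<^sub>m (Suc k)" "W * mat_adjoint W = 1\<^sub>m (Suc k)"
    using W(1) by (auto simp: unitary_mat_def)
  define B where "B = mat_adjoint W * A * W"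
  have B: "B \<in> carrier_mat (Suc k) (Suc k)"
    using Wc A by (auto simp: B_def)
  have adjB: "mat_adjoint B = B"
    using Wc(1,2) A Suc.prems(2)
    by (simp add: B_def mat_adjoint_mult[of _ "Suc k" "Suc k" _ "Suc k"] mult_carrier_mat[of _ "Suc k" "Suc k" _ "Suc k"]
        assoc_mult_mat[of _ "Suc k" "Suc k" _ "Suc k" _ "Suc k"])
  have AB: "A = W * B * mat_adjoint W"
    using unitary_conj_cancel[OF unitary_mat_adjoint[OF W(1)] A] by (simp add: B_def)
  have "col B 0 = (mat_adjoint W * A) *\<^sub>v col W 0"
    unfolding B_def by (rule col_mult2) (use Wc A in auto)
  also have "\<dots> = mat_adjoint W *\<^sub>v (A *\<^sub>v (c \<cdot>\<^sub>v v))"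
    unfolding W(3) using Wc A v(1) by (intro assoc_mult_mat_vec) auto
  also have "A *\<^sub>v (c \<cdot>\<^sub>v v) = c \<cdot>\<^sub>v (A *\<^sub>v v)"
    using A v(1) by (rule mult_mat_vec)
  also have "\<dots> = l \<cdot>\<^sub>v col W 0"
    unfolding W(3) v(3) by (simp add: smult_smult_assoc mult.commute)
  also have "mat_adjoint W *\<^sub>v (l \<cdot>\<^sub>v col W 0) = l \<cdot>\<^sub>v (mat_adjoint W *\<^sub>v col W 0)"
    using Wc by (intro mult_mat_vec) auto
  also have "mat_adjoint W *\<^sub>v col W 0 = col (mat_adjoint W * W) 0"
    by (rule col_mult2[symmetric]) (use Wc in auto)
  also have "\<dots> = unit_vec (Suc k) 0"
    unfolding Wc(3) by simp
  finally have colB: "col B 0 = l \<cdot>\<^sub>v unit_vec (Suc k) 0" .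
  have B0: "B $$ (i, 0) = (if i = 0 then l else 0)" if "i < Suc k" for i
  proof -
    have "B $$ (i, 0) = col B 0 $ i"
      using B that by simp
    then show ?thesis
      unfolding colB using that by simp
  qed
  have B0': "B $$ (0, i) = (if i = 0 then l else 0)" if "i < Suc k" for i
  proof -
    have "B $$ (0, i) = mat_adjoint B $$ (0, i)"
      using adjB by simp
    also have "\<dots> = cnj (B $$ (i, 0))"
      using B that by simp
    finally show ?thesis
      using B0[OF that] B0[of 0] by (cases "i = 0") auto
  qed
  have "cnj l = l"
  proof -
    have "l = mat_adjoint B $$ (0, 0)"
      using adjB B0[of 0] by simp
    also have "\<dots> = cnj l"
      using B B0[of 0] by simp
    finally show ?thesis
      by simp
  qed
  then have l: "complex_of_real (Re l) = l"
    by (simp add: complex_eq_iff)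
  define C where "C = mat k k (\<lambda>(i, j). B $$ (Suc i, Suc j))"
  have C: "C \<in> carrier_mat k k"
    by (simp add: C_def)
  have "mat_adjoint C = C"
  proof (rule eq_matI)
    fix i j
    assume ij: "i < dim_row C" "j < dim_col C"
    have "mat_adjoint C $$ (i, j) = mat_adjoint B $$ (Suc i, Suc j)"
      using ij B by (simp add: C_def)
    then show "mat_adjoint C $$ (i, j) = C $$ (i, j)"
      using ij adjB by (simp add: C_def)
  qed (use C in auto)
  then obtain V d where V: "unitary_mat k V" "C = unitary_rdiag k V d"
    using Suc.IH[OF C] by blast
  define d' where "d' = (\<lambda>i. if i < 1 then Re l else d (i - 1))"
  define V' where "V' = direct_sum (1\<^sub>m 1) V"
  have V': "unitary_mat (Suc k) V'"
    using unitary_direct_sum[OF unitary_mat_one[of 1] V(1)] by (simp add: V'_def)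
  have one: "unitary_diag 1 (1\<^sub>m 1) (\<lambda>_. l) = mat 1 1 (\<lambda>_. l)"
    by (intro eq_matI) (auto simp: unitary_diag_index[of _ "Suc 0"])
  have "B = direct_sum (mat 1 1 (\<lambda>_. l)) C"
  proof (rule eq_matI)
    fix i j
    assume "i < dim_row (direct_sum (mat 1 1 (\<lambda>_. l)) C)" "j < dim_col (direct_sum (mat 1 1 (\<lambda>_. l)) C)"
    then have "i < Suc k" "j < Suc k"
      using C by (auto simp: direct_sum_def)
    then show "B $$ (i, j) = direct_sum (mat 1 1 (\<lambda>_. l)) C $$ (i, j)"
      using C B0[of i] B0'[of j] by (cases i; cases j) (auto simp: direct_sum_def C_def)
  qed (use B C in \<open>auto simp: direct_sum_def\<close>)
  also have "\<dots> = unitary_diag (1 + k) V' (\<lambda>i. if i < 1 then l else complex_of_real (d (i - 1)))"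
    unfolding one[symmetric] V(2) V'_def by (rule direct_sum_unitary_diag[OF unitary_mat_one V(1)])
  also have "(\<lambda>i. if i < 1 then l else complex_of_real (d (i - 1))) = (\<lambda>i. complex_of_real (d' i))"
    using l by (auto simp: d'_def)
  finally have BV: "B = unitary_diag (Suc k) V' (\<lambda>i. complex_of_real (d' i))"
    by simp
  have V'c: "V' \<in> carrier_mat (Suc k) (Suc k)"
    using V' by (rule unitary_mat_carrier)
  have "A = unitary_rdiag (Suc k) (W * V') d'"
    unfolding AB BV unitary_diag_def using Wc V'c
    by (simp add: mat_assoc5 mat_adjoint_mult[of _ "Suc k" "Suc k" _ "Suc k"])
  with unitary_mat_mult[OF W(1) V'] show ?case
    by blast
qed

section \<open>Separated families of self-adjoint matrices\<close>

text \<open>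
  The self-adjoint matrices supported on a symmetric set \<open>Q\<close> of positions form a real vector space
  of dimension \<open>card Q\<close>: real parts sit at the positions on or above the diagonal, imaginary parts
  below it.
\<close>
definition hermitian_of :: "nat \<Rightarrow> (nat \<times> nat) set \<Rightarrow> (nat \<times> nat \<Rightarrow> real) \<Rightarrow> complex mat" where
  "hermitian_of k Q f = mat k k (\<lambda>(i, j). if (i, j) \<in> Q then
      (if i < j then Complex (f (i, j)) (f (j, i)) else if i = j then complex_of_real (f (i, j))
       else Complex (f (j, i)) (- f (i, j))) else 0)"

lemma hermitian_of_carrier [simp]: "hermitian_of k Q f \<in> carrier_mat k k"
  by (simp add: hermitian_of_def)

lemma hermitian_of_dim [simp]: "dim_row (hermitian_of k Q f) = k" "dim_col (hermitian_of k Q f) = k"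
  by (simp_all add: hermitian_of_def)

lemma hermitian_of_selfadjoint:
  assumes "sym Q"
  shows "hermitian_of k Q f \<in> selfadjoint_mats k"
proof -
  have "mat_adjoint (hermitian_of k Q f) = hermitian_of k Q f"
    using assms by (intro eq_matI) (auto simp: hermitian_of_def complex_eq_iff dest: symD)
  then show ?thesis
    by (simp add: selfadjoint_mats_def)
qed

lemma hermitian_of_diff:
  "hermitian_of k Q (\<lambda>p. f p - g p) = hermitian_of k Q f - hermitian_of k Q g"
  by (intro eq_matI) (auto simp: hermitian_of_def complex_eq_iff)

lemma coordinate_norm_hermitian:
  assumes Q: "Q \<subseteq> {..<k} \<times> {..<k}" and sym: "sym Q"
  shows "coordinate_norm Q (\<lambda>f. mat_opnorm (hermitian_of k Q f)) 1 (2 * (real k)\<^sup>2 + 1)"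
proof
  show "finite Q"
    using Q by (rule finite_subset) auto
  fix f g :: "nat \<times> nat \<Rightarrow> real" and c :: real
  have "hermitian_of k Q (\<lambda>i. f i + g i) = hermitian_of k Q f + hermitian_of k Q g"
    by (intro eq_matI) (auto simp: hermitian_of_def complex_eq_iff)
  then show "mat_opnorm (hermitian_of k Q (\<lambda>i. f i + g i)) \<le> mat_opnorm (hermitian_of k Q f) + mat_opnorm (hermitian_of k Q g)"
    by (simp add: mat_opnorm_add[of _ k k])
  have "hermitian_of k Q (\<lambda>i. c * f i) = complex_of_real c \<cdot>\<^sub>m hermitian_of k Q f"
    by (intro eq_matI) (auto simp: hermitian_of_def complex_eq_iff)
  then show "mat_opnorm (hermitian_of k Q (\<lambda>i. c * f i)) = \<bar>c\<bar> * mat_opnorm (hermitian_of k Q f)"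
    by (simp add: mat_opnorm_smult[of _ k k])
next
  fix f :: "nat \<times> nat \<Rightarrow> real" and p
  assume "p \<in> Q"
  obtain i j where p: "p = (i, j)"
    by (cases p)
  have ij: "i < k" "j < k" "(j, i) \<in> Q"
    using \<open>p \<in> Q\<close> Q symD[OF sym] by (auto simp: p)
  let ?z = "hermitian_of k Q f $$ (min i j, max i j)"
  have "\<bar>f p\<bar> \<le> cmod ?z"
    using ij \<open>p \<in> Q\<close> abs_Re_le_cmod[of ?z] abs_Im_le_cmod[of ?z]
    by (cases "i < j"; cases "i = j") (auto simp: hermitian_of_def p min_def max_def)
  also have "\<dots> \<le> mat_opnorm (hermitian_of k Q f)"
    by (rule mat_opnorm_entry[of _ k k]) (use ij in auto)
  finally show "\<bar>f p\<bar> \<le> 1 * mat_opnorm (hermitian_of k Q f)"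
    by simp
next
  fix s :: real and f :: "nat \<times> nat \<Rightarrow> real"
  assume s: "0 \<le> s" "\<And>i. i \<in> Q \<Longrightarrow> \<bar>f i\<bar> \<le> s"
  have "cmod (hermitian_of k Q f $$ (i, j)) \<le> 2 * s" if "i < k" "j < k" for i j
  proof (cases "(i, j) \<in> Q")
    case True
    then have "\<bar>f (i, j)\<bar> \<le> s" "\<bar>f (j, i)\<bar> \<le> s"
      using s(2) symD[OF sym] by auto
    then show ?thesis
      using that True s(1) cmod_le[of "Complex (f (i, j)) (f (j, i))"] cmod_le[of "Complex (f (j, i)) (- f (i, j))"]
      by (auto simp: hermitian_of_def)
  next
    case False
    then show ?thesis
      using that s(1) by (simp add: hermitian_of_def)
  qed
  then have "(\<Sum>i<k. \<Sum>j<k. cmod (hermitian_of k Q f $$ (i, j))) \<le> (\<Sum>i<k. \<Sum>j<k. 2 * s)"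
    by (intro sum_mono) auto
  also have "\<dots> = 2 * (real k)\<^sup>2 * s"
    by (simp add: power2_eq_square)
  finally have "mat_opnorm (hermitian_of k Q f) \<le> 2 * (real k)\<^sup>2 * s"
    using mat_opnorm_le_entries[of "hermitian_of k Q f" k k] by simp
  with s(1) show "mat_opnorm (hermitian_of k Q f) \<le> (2 * (real k)\<^sup>2 + 1) * s"
    by (simp add: distrib_right)
qed (auto simp: add_nonneg_pos)

abbreviation opdist :: "complex mat \<Rightarrow> complex mat \<Rightarrow> real" where
  "opdist A B \<equiv> mat_opnorm (A - B)"

text \<open>
  Stated for an indexed family so that it bounds a set of matrices through some of their blocks:
  injectivity of \<open>\<phi>\<close> is part of the separation hypothesis.
\<close>
lemma selfadjoint_separated_card_le:
  assumes Q: "Q \<subseteq> {..<k} \<times> {..<k}" "sym Q"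
    and T: "finite T" "\<And>x. x \<in> T \<Longrightarrow> \<phi> x \<in> selfadjoint_mats k" "\<And>x. x \<in> T \<Longrightarrow> mat_opnorm (\<phi> x) \<le> \<rho>"
    and supp: "\<And>x i j. x \<in> T \<Longrightarrow> i < k \<Longrightarrow> j < k \<Longrightarrow> (i, j) \<notin> Q \<Longrightarrow> \<phi> x $$ (i, j) = 0"
    and sep: "\<And>x y. x \<in> T \<Longrightarrow> y \<in> T \<Longrightarrow> x \<noteq> y \<Longrightarrow> \<omega> \<le> opdist (\<phi> x) (\<phi> y)"
    and "0 < \<omega>" "0 \<le> \<rho>"
  shows "real (card T) \<le> (1 + 2 * \<rho> / \<omega>) ^ card Q"
proof -
  interpret coordinate_norm Q "\<lambda>f. mat_opnorm (hermitian_of k Q f)" 1 "2 * (real k)\<^sup>2 + 1"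
    using Q by (rule coordinate_norm_hermitian)
  define crd where "crd = (\<lambda>M (i, j). if i \<le> j then Re (M $$ (i, j)) else Im (M $$ (j, i)) :: real)"
  have inv: "hermitian_of k Q (crd (\<phi> x)) = \<phi> x" if x: "x \<in> T" for x
  proof (rule eq_matI)
    have c: "\<phi> x \<in> carrier_mat k k" "mat_adjoint (\<phi> x) = \<phi> x"
      using T(2)[OF x] by (auto simp: selfadjoint_mats_def)
    fix i j
    assume "i < dim_row (\<phi> x)" "j < dim_col (\<phi> x)"
    then have ij: "i < k" "j < k"
      using c by auto
    have "\<phi> x $$ (i, j) = mat_adjoint (\<phi> x) $$ (i, j)"
      using c(2) by simp
    also have "\<dots> = cnj (\<phi> x $$ (j, i))"
      using c(1) ij by simp
    finally have "\<phi> x $$ (i, j) = cnj (\<phi> x $$ (j, i))" .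
    then show "hermitian_of k Q (crd (\<phi> x)) $$ (i, j) = \<phi> x $$ (i, j)"
      using ij supp[OF x ij] by (auto simp: hermitian_of_def crd_def complex_eq_iff)
  qed (use T(2)[OF x] in \<open>auto simp: selfadjoint_mats_def\<close>)
  have sep': "\<omega> \<le> dst (crd (\<phi> x)) (crd (\<phi> y))" if "x \<in> T" "y \<in> T" "x \<noteq> y" for x y
    using sep[OF that] that by (simp add: hermitian_of_diff inv)
  have "inj_on (\<lambda>x. crd (\<phi> x)) T"
  proof (rule inj_onI, rule ccontr)
    fix x y
    assume *: "x \<in> T" "y \<in> T" "crd (\<phi> x) = crd (\<phi> y)" "x \<noteq> y"
    then have "\<omega> \<le> dst (crd (\<phi> x)) (crd (\<phi> x))"
      using sep' by metis
    then show False
      using \<open>0 < \<omega>\<close> by (simp add: zero)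
  qed
  then have "card T = card ((\<lambda>x. crd (\<phi> x)) ` T)"
    by (simp add: card_image)
  also have "real \<dots> \<le> (1 + 2 * \<rho> / \<omega>) ^ card Q"
  proof (rule separated_card_le)
    show "separated dst \<omega> ((\<lambda>x. crd (\<phi> x)) ` T)"
      unfolding separated_def using sep' by blast
  qed (use T inv \<open>0 < \<omega>\<close> \<open>0 \<le> \<rho>\<close> in auto)
  finally show ?thesis .
qed

lemma selfadjoint_separated_exists:
  assumes "0 < \<rho>" "0 < \<omega>"
  shows "\<exists>T. finite T \<and> T \<subseteq> selfadjoint_mats k \<and> (\<forall>A\<in>T. mat_opnorm A \<le> \<rho>) \<and>
    separated opdist \<omega> T \<and> (\<rho> / \<omega>) ^ (k\<^sup>2) \<le> real (card T)"
proof -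
  define Q where "Q = {..<k} \<times> {..<k}"
  have Q: "Q \<subseteq> {..<k} \<times> {..<k}" "sym Q"
    by (auto simp: Q_def sym_def)
  interpret coordinate_norm Q "\<lambda>f. mat_opnorm (hermitian_of k Q f)" 1 "2 * (real k)\<^sup>2 + 1"
    using Q by (rule coordinate_norm_hermitian)
  obtain T where T: "finite T" "\<And>f. f \<in> T \<Longrightarrow> mat_opnorm (hermitian_of k Q f) \<le> \<rho>" "separated dst \<omega> T"
      "(\<rho> / \<omega>) ^ card Q \<le> real (card T)"
    using separated_in_ball_exists[OF assms] by blast
  have sep: "\<omega> \<le> opdist (hermitian_of k Q f) (hermitian_of k Q g)" if "f \<in> T" "g \<in> T" "f \<noteq> g" for f g
    using separatedD[OF T(3) that] by (simp add: hermitian_of_diff)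
  have "inj_on (hermitian_of k Q) T"
  proof (rule inj_onI, rule ccontr)
    fix f g
    assume *: "f \<in> T" "g \<in> T" "hermitian_of k Q f = hermitian_of k Q g" "f \<noteq> g"
    then have "\<omega> \<le> opdist (hermitian_of k Q f) (hermitian_of k Q f)"
      using sep by metis
    then show False
      using assms(2) by (simp add: minus_r_inv_mat[of _ k k] mat_opnorm_zero)
  qed
  then have "card (hermitian_of k Q ` T) = card T"
    by (rule card_image)
  moreover have "separated opdist \<omega> (hermitian_of k Q ` T)"
    unfolding separated_def using sep by blast
  moreover have "card Q = k\<^sup>2"
    by (simp add: Q_def card_cartesian_product power2_eq_square)
  ultimately show ?thesis
    using T hermitian_of_selfadjoint[OF Q(2)] by (intro exI[of _ "hermitian_of k Q ` T"]) auto
qed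

section \<open>Matrices with a prescribed finite spectrum\<close>

text \<open>
  The union of the unitary orbits of the diagonal matrices with entries in \<open>\<Lambda>\<close>.
\<close>
definition spectral_class :: "nat \<Rightarrow> real set \<Rightarrow> complex mat set" where
  "spectral_class k \<Lambda> =
     {unitary_rdiag k U d | U d. unitary_mat k U \<and> (\<forall>i<k. d i \<in> \<Lambda>)}"

lemma spectral_class_selfadjoint: "A \<in> spectral_class k \<Lambda> \<Longrightarrow> A \<in> selfadjoint_mats k"
  by (auto simp: spectral_class_def selfadjoint_mats_def mat_adjoint_unitary_diag unitary_mat_carrier)

lemma selfadjoint_mats_carrier: "A \<in> selfadjoint_mats k \<Longrightarrow> A \<in> carrier_mat k k"
  by (simp add: selfadjoint_mats_def)

lemma spectral_class_carrier: "A \<in> spectral_class k \<Lambda> \<Longrightarrow> A \<in> carrier_mat k k"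
  by (intro selfadjoint_mats_carrier spectral_class_selfadjoint)

lemma spectral_class_norm_le:
  assumes "A \<in> spectral_class k \<Lambda>" "\<And>l. l \<in> \<Lambda> \<Longrightarrow> \<bar>l\<bar> \<le> \<rho>" "0 \<le> \<rho>"
  shows "mat_opnorm A \<le> \<rho>"
  using assms by (auto simp: spectral_class_def intro!: mat_opnorm_unitary_diag_le)

lemma unitary_conj_unitary_diag:
  assumes "unitary_mat k W" "unitary_mat k U"
  shows "mat_adjoint W * unitary_diag k U d * W = unitary_diag k (mat_adjoint W * U) d"
proof -
  have c: "W \<in> carrier_mat k k" "mat_adjoint W \<in> carrier_mat k k" "U \<in> carrier_mat k k" "mat_adjoint U \<in> carrier_mat k k"
    using assms by (auto simp: unitary_mat_def)
  show ?thesis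
    unfolding unitary_diag_def mat_assoc5[OF c(2,3) mat_diag_dim c(4,1)] mat_adjoint_mult[OF c(2,3)] by simp
qed

lemma spectral_class_unitary_conj:
  assumes "A \<in> spectral_class k \<Lambda>" "unitary_mat k W"
  shows "mat_adjoint W * A * W \<in> spectral_class k \<Lambda>"
proof -
  obtain U d where U: "unitary_mat k U" "\<forall>i<k. d i \<in> \<Lambda>" "A = unitary_rdiag k U d"
    using assms(1) by (auto simp: spectral_class_def)
  then have "mat_adjoint W * A * W = unitary_rdiag k (mat_adjoint W * U) d"
    using unitary_conj_unitary_diag[OF assms(2)] by simp
  with U(2) unitary_mat_mult[OF unitary_mat_adjoint[OF assms(2)] U(1)] show ?thesis
    by (auto simp: spectral_class_def)
qed

lemma mat_diag_eq_unitary_diag: "mat_diag k d = unitary_diag k (1\<^sub>m k) d"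
proof -
  have "mat_adjoint (1\<^sub>m k) = (1\<^sub>m k :: complex mat)"
    by (rule eq_matI) auto
  then show ?thesis
    by (simp add: unitary_diag_def left_mult_one_mat[OF mat_diag_dim] right_mult_one_mat[OF mat_diag_dim])
qed

lemma mat_diag_spectral_class: "(\<And>i. i < k \<Longrightarrow> d i \<in> \<Lambda>) \<Longrightarrow> rdiag k d \<in> spectral_class k \<Lambda>"
  unfolding mat_diag_eq_unitary_diag spectral_class_def using unitary_mat_one by blast

lemma unitary_diag_zero:
  assumes "U \<in> carrier_mat k k" "\<And>i. i < k \<Longrightarrow> d i = 0"
  shows "unitary_diag k U d = 0\<^sub>m k k"
  using assms by (intro eq_matI) (auto simp: unitary_diag_index)

lemma unitary_diag_shift:
  assumes "unitary_mat k U"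
  shows "unitary_diag k U d - c \<cdot>\<^sub>m 1\<^sub>m k = unitary_diag k U (\<lambda>i. d i - c)"
proof -
  have U: "U \<in> carrier_mat k k"
    using assms by (rule unitary_mat_carrier)
  have "c \<cdot>\<^sub>m 1\<^sub>m k = c \<cdot>\<^sub>m unitary_diag k U (\<lambda>_. 1)"
    using assms by (simp add: unitary_diag_one)
  also have "\<dots> = unitary_diag k U (\<lambda>_. c)"
    using U by (intro eq_matI) (auto simp: unitary_diag_index sum_distrib_left mult_ac)
  finally show ?thesis
    using unitary_diag_diff[OF U] by simp
qed

text \<open>
  The value at \<open>A\<close> of the polynomial with the given roots. Keeping the factors apart allows
  Lipschitz estimates by induction on their number.
\<close>
primrec shift_prod :: "nat \<Rightarrow> complex list \<Rightarrow> complex mat \<Rightarrow> complex mat" where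
  "shift_prod k [] A = 1\<^sub>m k"
| "shift_prod k (c # cs) A = (A - c \<cdot>\<^sub>m 1\<^sub>m k) * shift_prod k cs A"

lemma shift_carrier: "A \<in> carrier_mat k k \<Longrightarrow> A - c \<cdot>\<^sub>m 1\<^sub>m k \<in> carrier_mat k k"
  by (intro minus_carrier_mat) auto

lemma shift_prod_carrier: "A \<in> carrier_mat k k \<Longrightarrow> shift_prod k cs A \<in> carrier_mat k k"
  by (induction cs) (auto intro!: mult_carrier_mat[of _ k k] shift_carrier)

lemma shift_prod_unitary_diag:
  assumes "unitary_mat k U"
  shows "shift_prod k cs (unitary_diag k U d) = unitary_diag k U (\<lambda>i. \<Prod>c\<leftarrow>cs. d i - c)"
  using assms by (induction cs) (simp_all add: unitary_diag_one unitary_diag_shift unitary_diag_mult)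

lemma mat_opnorm_one_le: "mat_opnorm (1\<^sub>m k) \<le> 1"
  by (rule mat_opnorm_unitary_le[OF unitary_mat_one])

text \<open>
  The constant does not depend on the size of the matrices.
\<close>
lemma shift_prod_lipschitz:
  assumes "0 \<le> R"
  shows "\<exists>L\<ge>0. \<forall>k A B. A \<in> carrier_mat k k \<longrightarrow> B \<in> carrier_mat k k \<longrightarrow> mat_opnorm A \<le> R \<longrightarrow> mat_opnorm B \<le> R \<longrightarrow>
    mat_opnorm (shift_prod k cs A) \<le> L \<and>
    opdist (shift_prod k cs A) (shift_prod k cs B) \<le> L * opdist A B"
proof (induction cs)
  case Nil
  have "opdist (1\<^sub>m k) (1\<^sub>m k) \<le> 1 * opdist A B" for k A B
    using mat_opnorm_nonneg[of "A - B"] by (simp add: minus_r_inv_mat[of _ k k] mat_opnorm_zero)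
  then show ?case
    using mat_opnorm_one_le by (intro exI[of _ 1]) simp
next
  case (Cons c cs)
  then obtain L where L: "0 \<le> L"
    and LB: "\<And>k A B. A \<in> carrier_mat k k \<Longrightarrow> B \<in> carrier_mat k k \<Longrightarrow> mat_opnorm A \<le> R \<Longrightarrow> mat_opnorm B \<le> R \<Longrightarrow>
      mat_opnorm (shift_prod k cs A) \<le> L \<and> opdist (shift_prod k cs A) (shift_prod k cs B) \<le> L * opdist A B"
    by blast
  let ?L = "(R + cmod c + 1) * L"
  have "mat_opnorm (shift_prod k (c # cs) A) \<le> ?L \<and>
      opdist (shift_prod k (c # cs) A) (shift_prod k (c # cs) B) \<le> ?L * opdist A B"
    if A: "A \<in> carrier_mat k k" "mat_opnorm A \<le> R" and B: "B \<in> carrier_mat k k" "mat_opnorm B \<le> R" for k A B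
  proof -
    define a b X Y where "a = A - c \<cdot>\<^sub>m 1\<^sub>m k" and "b = B - c \<cdot>\<^sub>m 1\<^sub>m k"
      and "X = shift_prod k cs A" and "Y = shift_prod k cs B"
    have car: "a \<in> carrier_mat k k" "b \<in> carrier_mat k k" "X \<in> carrier_mat k k" "Y \<in> carrier_mat k k"
      using A B by (auto simp: a_def b_def X_def Y_def shift_prod_carrier shift_carrier)
    have XY: "mat_opnorm X \<le> L" "mat_opnorm Y \<le> L" "opdist X Y \<le> L * opdist A B"
      using LB[OF A(1) B(1) A(2) B(2)] LB[OF B(1) A(1) B(2) A(2)] by (auto simp: X_def Y_def)
    have "mat_opnorm (c \<cdot>\<^sub>m 1\<^sub>m k) \<le> cmod c"
      using mat_opnorm_smult[of "1\<^sub>m k" k k c] mat_opnorm_one_le[of k] by (simp add: mult_left_le)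
    then have a: "mat_opnorm a \<le> R + cmod c"
      unfolding a_def using mat_opnorm_diff[OF A(1), of "c \<cdot>\<^sub>m 1\<^sub>m k"] A(2) by simp
    have "mat_opnorm (a * X) \<le> mat_opnorm a * mat_opnorm X"
      using car by (intro mat_opnorm_mult)
    also have "\<dots> \<le> (R + cmod c) * L"
      using a XY(1) mat_opnorm_nonneg assms by (intro mult_mono) auto
    also have "\<dots> \<le> ?L"
      using L by (simp add: distrib_right)
    finally have 1: "mat_opnorm (a * X) \<le> ?L" .
    have "a - b = A - B"
      using A B by (intro eq_matI) (auto simp: a_def b_def)
    then have "(A - B) * Y = a * Y - b * Y"
      using minus_mult_distrib_mat[OF car(1,2,4)] by simp
    then have "a * X - b * Y = a * (X - Y) + (A - B) * Y"
      using car mult_minus_distrib_mat[OF car(1,3,4)]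
      by (intro eq_matI) (auto simp del: index_mult_mat(1))
    then have "opdist (a * X) (b * Y) \<le> mat_opnorm (a * (X - Y)) + mat_opnorm ((A - B) * Y)"
      using mat_opnorm_add[of "a * (X - Y)" k k "(A - B) * Y"] car A B
      by (simp add: mult_carrier_mat[of _ k k _ k] minus_carrier_mat)
    also have "\<dots> \<le> mat_opnorm a * opdist X Y + opdist A B * mat_opnorm Y"
      using car A B by (intro add_mono mat_opnorm_mult) (auto intro: minus_carrier_mat)
    also have "\<dots> \<le> (R + cmod c) * (L * opdist A B) + opdist A B * L"
      using a XY mat_opnorm_nonneg assms by (intro add_mono mult_mono) auto
    also have "\<dots> = ?L * opdist A B"
      by (simp add: algebra_simps)
    finally show ?thesis
      using 1 by (simp add: a_def b_def X_def Y_def)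
  qed
  then show ?case
    using L assms by (intro exI[of _ ?L]) auto
qed

text \<open>
  Let \<open>r\<close> be the polynomial with simple roots at the points of \<open>\<Lambda>\<close> other than \<open>l\<close>. Both \<open>r(A) (A - l)\<close>
  and \<open>(A' - l) r(A')\<close> vanish, hence so does \<open>r(A) (A - A') r(A')\<close>. Replacing \<open>A\<close> and \<open>A'\<close> by the diagonal
  matrix \<open>D\<close> in the outer factors costs \<open>O(\<eta>)\<close> times the norm of \<open>A - A'\<close>, and \<open>r(D)\<close> is \<open>r(l)\<close> times the
  projection onto the coordinates with \<open>d\<^sub>i = l\<close>.
\<close>
lemma spectral_block_small:
  fixes \<Lambda> :: "real set"
  assumes fin: "finite \<Lambda>" and l: "l \<in> \<Lambda>"
  shows "\<exists>C\<ge>0. \<forall>k d A A' \<eta>. (\<forall>i<k. d i \<in> \<Lambda>) \<longrightarrow> A \<in> spectral_class k \<Lambda> \<longrightarrow> A' \<in> spectral_class k \<Lambda> \<longrightarrow>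
    opdist A (rdiag k d) \<le> \<eta> \<longrightarrow> opdist A' (rdiag k d) \<le> \<eta> \<longrightarrow>
    mat_opnorm (mat k k (\<lambda>(i, j). if d i = l \<and> d j = l then (A - A') $$ (i, j) else 0)) \<le> C * \<eta> * opdist A A'"
proof -
  define cs where "cs = map complex_of_real (sorted_list_of_set (\<Lambda> - {l}))"
  define r where "r = (\<lambda>t::real. \<Prod>c\<leftarrow>cs. complex_of_real t - c)"
  have r0: "r t * (complex_of_real t - complex_of_real l) = 0" if "t \<in> \<Lambda>" for t
    using that fin by (cases "t = l") (auto simp: r_def cs_def prod_list_zero_iff image_iff)
  have rl: "r l \<noteq> 0"
    using fin by (auto simp: r_def cs_def prod_list_zero_iff)
  define R where "R = (\<Sum>t\<in>\<Lambda>. \<bar>t\<bar>)"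
  have R: "0 \<le> R" "\<And>t. t \<in> \<Lambda> \<Longrightarrow> \<bar>t\<bar> \<le> R"
    using fin by (auto simp: R_def sum_nonneg intro: member_le_sum)
  obtain L where L: "0 \<le> L"
    and LB: "\<And>k A B. A \<in> carrier_mat k k \<Longrightarrow> B \<in> carrier_mat k k \<Longrightarrow> mat_opnorm A \<le> R \<Longrightarrow> mat_opnorm B \<le> R \<Longrightarrow>
      mat_opnorm (shift_prod k cs A) \<le> L \<and> opdist (shift_prod k cs A) (shift_prod k cs B) \<le> L * opdist A B"
    using shift_prod_lipschitz[OF R(1), of cs] by blast
  define \<phi> where "\<phi> = (\<lambda>p q. if p = l \<and> q = l then 1 / (r l)\<^sup>2 else 0)"
  define S where "S = (\<Sum>(p, q)\<in>\<Lambda> \<times> \<Lambda>. cmod (\<phi> p q))"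
  have S: "0 \<le> S"
    unfolding S_def by (intro sum_nonneg) auto
  have "mat_opnorm (mat k k (\<lambda>(i, j). if d i = l \<and> d j = l then (A - A') $$ (i, j) else 0)) \<le> (S * (2 * L * L)) * \<eta> * opdist A A'"
    if d: "\<forall>i<k. d i \<in> \<Lambda>" and A: "A \<in> spectral_class k \<Lambda>" and A': "A' \<in> spectral_class k \<Lambda>"
      and AD: "opdist A (rdiag k d) \<le> \<eta>"
      and AD': "opdist A' (rdiag k d) \<le> \<eta>" for k d A A' \<eta>
  proof -
    define D where "D = rdiag k d"
    have D: "D \<in> spectral_class k \<Lambda>"
      unfolding D_def using d by (intro mat_diag_spectral_class) auto
    note car = spectral_class_carrier[OF A] spectral_class_carrier[OF A'] spectral_class_carrier[OF D]
    note nrm = spectral_class_norm_le[OF A R(2) R(1)] spectral_class_norm_le[OF A' R(2) R(1)] spectral_class_norm_le[OF D R(2) R(1)]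
    define X where "X = shift_prod k cs"
    have Xc: "X A \<in> carrier_mat k k" "X A' \<in> carrier_mat k k" "X D \<in> carrier_mat k k"
      using car by (auto simp: X_def shift_prod_carrier)
    define M where "M = A - A'"
    have M: "M \<in> carrier_mat k k"
      using car by (auto simp: M_def intro: minus_carrier_mat)
    define lI where "lI = complex_of_real l \<cdot>\<^sub>m (1\<^sub>m k :: complex mat)"
    obtain U a where U: "unitary_mat k U" "\<forall>i<k. a i \<in> \<Lambda>" "A = unitary_rdiag k U a"
      using A by (auto simp: spectral_class_def)
    obtain U' a' where U': "unitary_mat k U'" "\<forall>i<k. a' i \<in> \<Lambda>" "A' = unitary_diag k U' (\<lambda>i. complex_of_real (a' i))"
      using A' by (auto simp: spectral_class_def)
    \<comment> \<open>Here \<open>X\<close> is evaluation of \<open>r\<close> at a matrix and \<open>lI\<close> is \<open>l\<close> times the identity.\<close>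
    have z1: "X A * (A - lI) = 0\<^sub>m k k"
      unfolding X_def lI_def U(3) shift_prod_unitary_diag[OF U(1)] unitary_diag_shift[OF U(1)] unitary_diag_mult[OF U(1)]
      by (rule unitary_diag_zero[OF unitary_mat_carrier[OF U(1)]]) (use r0 U(2) in \<open>auto simp: r_def\<close>)
    have z2: "(A' - lI) * X A' = 0\<^sub>m k k"
      unfolding X_def lI_def U'(3) shift_prod_unitary_diag[OF U'(1)] unitary_diag_shift[OF U'(1)] unitary_diag_mult[OF U'(1)]
      by (rule unitary_diag_zero[OF unitary_mat_carrier[OF U'(1)]]) (use r0 U'(2) in \<open>auto simp: r_def mult.commute\<close>)
    have c1: "A - lI \<in> carrier_mat k k" "A' - lI \<in> carrier_mat k k"
      using car by (auto simp: lI_def intro!: shift_carrier)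
    have M2: "M = (A - lI) - (A' - lI)"
      using car by (intro eq_matI) (auto simp: M_def lI_def)
    have p1: "X A * (A' - lI) \<in> carrier_mat k k"
      using Xc c1 by (intro mult_carrier_mat)
    have "X A * M = 0\<^sub>m k k - X A * (A' - lI)"
      unfolding M2 mult_minus_distrib_mat[OF Xc(1) c1] z1 ..
    then have "X A * M * X A' = 0\<^sub>m k k * X A' - X A * (A' - lI) * X A'"
      using minus_mult_distrib_mat[OF zero_carrier_mat p1 Xc(2)] by simp
    also have "X A * (A' - lI) * X A' = X A * ((A' - lI) * X A')"
      using Xc c1 by (intro assoc_mult_mat)
    finally have z: "X A * M * X A' = 0\<^sub>m k k"
      unfolding z2 using Xc by (simp add: right_mult_zero_mat[OF Xc(1)] left_mult_zero_mat[OF Xc(2)])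
    define N where "N = X D * M * X D"
    have p2: "X D - X A \<in> carrier_mat k k" "X D - X A' \<in> carrier_mat k k" "X A * M \<in> carrier_mat k k" "X D * M \<in> carrier_mat k k"
      using Xc M by (auto intro: minus_carrier_mat mult_carrier_mat)
    have e1: "(X D - X A) * M * X D = X D * M * X D - X A * M * X D"
      unfolding minus_mult_distrib_mat[OF Xc(3,1) M] minus_mult_distrib_mat[OF p2(4,3) Xc(3)] ..
    have e2: "X A * M * (X D - X A') = X A * M * X D - X A * M * X A'"
      by (rule mult_minus_distrib_mat[OF p2(3) Xc(3,2)])
    have N: "N = (X D - X A) * M * X D + X A * M * (X D - X A')"
      unfolding e1 e2 z N_def using Xc M p2 by (intro eq_matI) (auto simp del: index_mult_mat(1))
    have lip: "opdist (X D) (X A) \<le> L * \<eta>" "opdist (X D) (X A') \<le> L * \<eta>" "mat_opnorm (X A) \<le> L" "mat_opnorm (X D) \<le> L"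
    proof -
      have "opdist (X D) (X A) \<le> L * opdist D A" "opdist (X D) (X A') \<le> L * opdist D A'"
        unfolding X_def using LB[OF car(3,1) nrm(3,1)] LB[OF car(3,2) nrm(3,2)] by auto
      moreover have "L * opdist D A \<le> L * \<eta>" "L * opdist D A' \<le> L * \<eta>"
        using AD AD' L mat_opnorm_minus_commute[OF car(3,1)] mat_opnorm_minus_commute[OF car(3,2)]
        by (auto simp: D_def[symmetric] intro!: mult_left_mono)
      ultimately show "opdist (X D) (X A) \<le> L * \<eta>" "opdist (X D) (X A') \<le> L * \<eta>"
        by auto
      show "mat_opnorm (X A) \<le> L" "mat_opnorm (X D) \<le> L"
        unfolding X_def using LB[OF car(1,1) nrm(1,1)] LB[OF car(3,3) nrm(3,3)] by auto
    qed
    have three: "mat_opnorm (E * M * F) \<le> mat_opnorm E * mat_opnorm M * mat_opnorm F"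
      if "E \<in> carrier_mat k k" "F \<in> carrier_mat k k" for E F
      using mat_opnorm_mult[of "E * M" k k F k] mat_opnorm_mult[of E k k M k] that M mat_opnorm_nonneg
      by (meson mult_right_mono mult_carrier_mat order.trans)
    have \<eta>: "0 \<le> \<eta>"
      using AD mat_opnorm_nonneg order.trans by blast
    have "mat_opnorm N \<le> mat_opnorm ((X D - X A) * M * X D) + mat_opnorm (X A * M * (X D - X A'))"
      unfolding N by (rule mat_opnorm_add[of _ k k]) (use Xc M p2 in \<open>auto intro!: mult_carrier_mat[of _ k k _ k]\<close>)
    also have "\<dots> \<le> opdist (X D) (X A) * mat_opnorm M * mat_opnorm (X D) + mat_opnorm (X A) * mat_opnorm M * opdist (X D) (X A')"
      using Xc p2 by (intro add_mono three)
    also have "\<dots> \<le> (L * \<eta>) * mat_opnorm M * L + L * mat_opnorm M * (L * \<eta>)"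
      using lip L \<eta> mat_opnorm_nonneg by (intro add_mono mult_mono) auto
    also have "\<dots> = (2 * L * L) * \<eta> * mat_opnorm M"
      by (simp add: algebra_simps)
    finally have nN: "mat_opnorm N \<le> (2 * L * L) * \<eta> * mat_opnorm M" .
    have XD: "X D = mat_diag k (\<lambda>i. r (d i))"
      unfolding X_def D_def mat_diag_eq_unitary_diag shift_prod_unitary_diag[OF unitary_mat_one] r_def ..
    have Nij: "N $$ (i, j) = r (d i) * M $$ (i, j) * r (d j)" if "i < k" "j < k" for i j
      using that unfolding N_def XD mat_diag_mult_left[OF M] by (simp add: mat_diag_mult_right[of _ k k])
    have Nc: "N \<in> carrier_mat k k"
      unfolding N_def using p2(4) Xc(3) by (rule mult_carrier_mat)
    have "mat k k (\<lambda>(i, j). if d i = l \<and> d j = l then (A - A') $$ (i, j) else 0) = mat k k (\<lambda>(i, j). \<phi> (d i) (d j) * N $$ (i, j))"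
      by (intro eq_matI) (auto simp: \<phi>_def Nij M_def[symmetric] rl power2_eq_square)
    also have "mat_opnorm \<dots> \<le> S * mat_opnorm N"
      unfolding S_def using d by (intro mat_opnorm_block_multiplier Nc fin) auto
    also have "\<dots> \<le> S * ((2 * L * L) * \<eta> * mat_opnorm M)"
      using nN S by (intro mult_left_mono)
    finally show ?thesis
      by (simp add: M_def mult_ac)
  qed
  then show ?thesis
    using S L by (intro exI[of _ "S * (2 * L * L)"]) auto
qed

definition off_block :: "nat \<Rightarrow> (nat \<Rightarrow> real) \<Rightarrow> complex mat \<Rightarrow> complex mat" where
  "off_block k d M = mat k k (\<lambda>(i, j). if d i = d j then 0 else M $$ (i, j))"

definition diag_block :: "nat \<Rightarrow> (nat \<Rightarrow> real) \<Rightarrow> complex mat \<Rightarrow> complex mat" where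
  "diag_block k d M = mat k k (\<lambda>(i, j). if d i = d j then M $$ (i, j) else 0)"

lemma off_block_carrier [simp]: "off_block k d M \<in> carrier_mat k k" "diag_block k d M \<in> carrier_mat k k"
  by (simp_all add: off_block_def diag_block_def)

lemma block_split: "M \<in> carrier_mat k k \<Longrightarrow> M = off_block k d M + diag_block k d M"
  by (intro eq_matI) (auto simp: off_block_def diag_block_def)

lemma mat_opnorm_le_blocks:
  assumes "M \<in> carrier_mat k k"
  shows "mat_opnorm M \<le> mat_opnorm (off_block k d M) + mat_opnorm (diag_block k d M)"
  using block_split[OF assms, of d] mat_opnorm_add[OF off_block_carrier, of k d M d M] by simp

lemma off_block_diff:
  assumes "M \<in> carrier_mat k k" "N \<in> carrier_mat k k"
  shows "off_block k d (M - N) = off_block k d M - off_block k d N"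
    "diag_block k d (M - N) = diag_block k d M - diag_block k d N"
  using assms by (auto simp: off_block_def diag_block_def)

lemma off_block_selfadjoint:
  assumes "M \<in> selfadjoint_mats k"
  shows "off_block k d M \<in> selfadjoint_mats k" "diag_block k d M \<in> selfadjoint_mats k"
proof -
  have *: "cnj (M $$ (j, i)) = M $$ (i, j)" if "i < k" "j < k" for i j
    using assms that mat_adjoint_index[of i M j] by (auto simp: selfadjoint_mats_def)
  have "mat_adjoint (off_block k d M) = off_block k d M" "mat_adjoint (diag_block k d M) = diag_block k d M"
    by (auto intro!: eq_matI simp: off_block_def diag_block_def *)
  then show "off_block k d M \<in> selfadjoint_mats k" "diag_block k d M \<in> selfadjoint_mats k"
    by (simp_all add: selfadjoint_mats_def)
qed

lemma block_norm_le:
  assumes "M \<in> carrier_mat k k" "finite \<Lambda>" "\<And>i. i < k \<Longrightarrow> d i \<in> \<Lambda>"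
  shows "mat_opnorm (off_block k d M) \<le> (real (card \<Lambda>))\<^sup>2 * mat_opnorm M"
    "mat_opnorm (diag_block k d M) \<le> (real (card \<Lambda>))\<^sup>2 * mat_opnorm M"
proof -
  have gen: "mat_opnorm (mat k k (\<lambda>(i, j). \<phi> (d i) (d j) * M $$ (i, j))) \<le> (real (card \<Lambda>))\<^sup>2 * mat_opnorm M"
    if "\<And>p q. cmod (\<phi> p q) \<le> 1" for \<phi> :: "real \<Rightarrow> real \<Rightarrow> complex"
  proof -
    have "(\<Sum>(p, q)\<in>\<Lambda> \<times> \<Lambda>. cmod (\<phi> p q)) \<le> (\<Sum>(p, q)\<in>\<Lambda> \<times> \<Lambda>. 1)"
      using that by (intro sum_mono) auto
    also have "\<dots> = (real (card \<Lambda>))\<^sup>2"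
      by (simp add: card_cartesian_product power2_eq_square case_prod_beta)
    finally have "(\<Sum>(p, q)\<in>\<Lambda> \<times> \<Lambda>. cmod (\<phi> p q)) \<le> (real (card \<Lambda>))\<^sup>2" .
    then show ?thesis
      using mat_opnorm_block_multiplier[OF assms(1,2), where d = d and \<phi> = \<phi>] assms(3) mat_opnorm_nonneg[of M]
      by (meson mult_right_mono order.trans)
  qed
  have "off_block k d M = mat k k (\<lambda>(i, j). (if d i = d j then 0 else 1) * M $$ (i, j))"
    "diag_block k d M = mat k k (\<lambda>(i, j). (if d i = d j then 1 else 0) * M $$ (i, j))"
    by (auto simp: off_block_def diag_block_def)
  then show "mat_opnorm (off_block k d M) \<le> (real (card \<Lambda>))\<^sup>2 * mat_opnorm M"
    "mat_opnorm (diag_block k d M) \<le> (real (card \<Lambda>))\<^sup>2 * mat_opnorm M"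
    using gen[of "\<lambda>p q. if p = q then 0 else 1"] gen[of "\<lambda>p q. if p = q then 1 else 0"] by auto
qed

text \<open>
  For \<open>\<eta>\<close> small the diagonal blocks of \<open>A - A'\<close> have together at most half the norm of \<open>A - A'\<close>.
\<close>
lemma off_block_determines:
  fixes \<Lambda> :: "real set"
  assumes fin: "finite \<Lambda>"
  shows "\<exists>\<eta>>0. \<eta> \<le> 1 \<and> (\<forall>k d A A'. (\<forall>i<k. d i \<in> \<Lambda>) \<longrightarrow> A \<in> spectral_class k \<Lambda> \<longrightarrow> A' \<in> spectral_class k \<Lambda> \<longrightarrow>
    opdist A (rdiag k d) \<le> \<eta> \<longrightarrow> opdist A' (rdiag k d) \<le> \<eta> \<longrightarrow>
    opdist A A' \<le> 2 * mat_opnorm (off_block k d (A - A')))"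
proof -
  define good where "good = (\<lambda>k d A A' \<eta>. (\<forall>i<k. d i \<in> \<Lambda>) \<and> A \<in> spectral_class k \<Lambda> \<and> A' \<in> spectral_class k \<Lambda> \<and>
    opdist A (rdiag k d) \<le> \<eta> \<and> opdist A' (rdiag k d) \<le> \<eta>)"
  have "\<forall>l\<in>\<Lambda>. \<exists>C\<ge>0. \<forall>k d A A' \<eta>. good k d A A' \<eta> \<longrightarrow>
    mat_opnorm (mat k k (\<lambda>(i, j). if d i = l \<and> d j = l then (A - A') $$ (i, j) else 0)) \<le> C * \<eta> * opdist A A'"
  proof
    fix l
    assume "l \<in> \<Lambda>"
    from spectral_block_small[OF fin this] obtain C where "0 \<le> C"
      and *: "\<forall>k d A A' \<eta>. (\<forall>i<k. d i \<in> \<Lambda>) \<longrightarrow> A \<in> spectral_class k \<Lambda> \<longrightarrow> A' \<in> spectral_class k \<Lambda> \<longrightarrow>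
        opdist A (rdiag k d) \<le> \<eta> \<longrightarrow> opdist A' (rdiag k d) \<le> \<eta> \<longrightarrow>
        mat_opnorm (mat k k (\<lambda>(i, j). if d i = l \<and> d j = l then (A - A') $$ (i, j) else 0)) \<le> C * \<eta> * opdist A A'"
      by (elim exE conjE) (rule that)
    show "\<exists>C\<ge>0. \<forall>k d A A' \<eta>. good k d A A' \<eta> \<longrightarrow>
      mat_opnorm (mat k k (\<lambda>(i, j). if d i = l \<and> d j = l then (A - A') $$ (i, j) else 0)) \<le> C * \<eta> * opdist A A'"
    proof (intro exI[of _ C] conjI allI impI)
      fix k d A A' \<eta>
      assume "good k d A A' \<eta>"
      with *[rule_format, of k d A A' \<eta>]
      show "mat_opnorm (mat k k (\<lambda>(i, j). if d i = l \<and> d j = l then (A - A') $$ (i, j) else 0)) \<le> C * \<eta> * opdist A A'"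
        unfolding good_def by blast
    qed (rule \<open>0 \<le> C\<close>)
  qed
  from bchoice[OF this] obtain C where CC: "\<forall>l\<in>\<Lambda>. 0 \<le> C l \<and> (\<forall>k d A A' \<eta>. good k d A A' \<eta> \<longrightarrow>
      mat_opnorm (mat k k (\<lambda>(i, j). if d i = l \<and> d j = l then (A - A') $$ (i, j) else 0)) \<le> C l * \<eta> * opdist A A')"
    by (elim exE) (rule that)
  have C: "0 \<le> C l" if "l \<in> \<Lambda>" for l
    using CC that by blast
  have CB: "mat_opnorm (mat k k (\<lambda>(i, j). if d i = l \<and> d j = l then (A - A') $$ (i, j) else 0)) \<le> C l * \<eta> * opdist A A'"
    if "l \<in> \<Lambda>" "good k d A A' \<eta>" for l k d A A' \<eta>
    using CC[rule_format, OF that(1)] that(2) by blast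
  define K where "K = (\<Sum>l\<in>\<Lambda>. C l)"
  have K: "0 \<le> K"
    unfolding K_def using C by (intro sum_nonneg)
  define \<eta> where "\<eta> = 1 / (2 * K + 1)"
  have \<eta>: "0 < \<eta>" "\<eta> \<le> 1" "K * \<eta> \<le> 1 / 2"
    using K by (auto simp: \<eta>_def field_simps)
  have "opdist A A' \<le> 2 * mat_opnorm (off_block k d (A - A'))" if g: "good k d A A' \<eta>" for k d A A'
  proof -
    have car: "A \<in> carrier_mat k k" "A' \<in> carrier_mat k k"
      using g by (auto simp: good_def spectral_class_carrier)
    define M where "M = A - A'"
    have M: "M \<in> carrier_mat k k"
      using car by (auto simp: M_def intro: minus_carrier_mat)
    have part: "mat_opnorm (mat k k (\<lambda>(i, j). if d i = d j \<and> d i \<in> F then M $$ (i, j) else 0)) \<le> (\<Sum>l\<in>F. C l) * \<eta> * mat_opnorm M"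
      if "finite F" "F \<subseteq> \<Lambda>" for F
      using that
    proof (induction F)
      case empty
      have *: "mat k k (\<lambda>(i, j). if d i = d j \<and> d i \<in> {} then M $$ (i, j) else 0) = 0\<^sub>m k k"
        by auto
      show ?case
        unfolding * by (simp add: mat_opnorm_zero)
    next
      case (insert l F)
      let ?F = "mat k k (\<lambda>(i, j). if d i = d j \<and> d i \<in> F then M $$ (i, j) else 0)"
      let ?l = "mat k k (\<lambda>(i, j). if d i = l \<and> d j = l then M $$ (i, j) else 0)"
      have "mat k k (\<lambda>(i, j). if d i = d j \<and> d i \<in> insert l F then M $$ (i, j) else 0) = ?F + ?l"
        using insert.hyps by (intro eq_matI) auto
      then have "mat_opnorm (mat k k (\<lambda>(i, j). if d i = d j \<and> d i \<in> insert l F then M $$ (i, j) else 0)) \<le> mat_opnorm ?F + mat_opnorm ?l"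
        using mat_opnorm_add[of ?F k k ?l] by simp
      also have "mat_opnorm ?F \<le> (\<Sum>l\<in>F. C l) * \<eta> * mat_opnorm M"
        using insert by auto
      also have "mat_opnorm ?l \<le> C l * \<eta> * mat_opnorm M"
        using CB[OF _ g, of l] insert.prems unfolding M_def by blast
      finally show ?case
        using insert.hyps by (simp add: distrib_right)
    qed
    have "diag_block k d M = mat k k (\<lambda>(i, j). if d i = d j \<and> d i \<in> \<Lambda> then M $$ (i, j) else 0)"
      using g by (intro eq_matI) (auto simp: good_def diag_block_def)
    then have "mat_opnorm (diag_block k d M) \<le> K * \<eta> * mat_opnorm M"
      using part[OF fin] by (simp add: K_def)
    also have "\<dots> \<le> 1 / 2 * mat_opnorm M"
      using \<eta>(3) mat_opnorm_nonneg by (intro mult_right_mono)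
    finally show ?thesis
      using mat_opnorm_le_blocks[OF M, of d] by (simp add: M_def)
  qed
  then show ?thesis
    using \<eta>(1,2) unfolding good_def by (intro exI[of _ \<eta>] conjI allI impI) auto
qed

text \<open>
  The left-hand side is the square of the sum of the multiplicities, so this is the Cauchy-Schwarz
  inequality. It makes equal multiplicities the extremal case.
\<close>
lemma card_equal_pairs_ge:
  fixes d :: "nat \<Rightarrow> 'c"
  assumes "finite \<Lambda>" "\<And>i. i < k \<Longrightarrow> d i \<in> \<Lambda>"
  shows "(real k)\<^sup>2 \<le> real (card \<Lambda>) * real (card {(i, j). i < k \<and> j < k \<and> d i = d j})"
proof -
  define K where "K = (\<lambda>l. {i. i < k \<and> d i = l})"
  have fK: "finite (K l)" for l
    by (simp add: K_def)
  have "{..<k} = (\<Union>l\<in>\<Lambda>. K l)"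
    using assms(2) by (auto simp: K_def)
  then have "card {..<k} = (\<Sum>l\<in>\<Lambda>. card (K l))"
    using fK by (simp only:) (rule card_UN_disjoint[OF assms(1)], auto simp: K_def)
  then have k: "real k = (\<Sum>l\<in>\<Lambda>. real (card (K l)))"
    by (metis card_lessThan of_nat_sum)
  have "{(i, j). i < k \<and> j < k \<and> d i = d j} = (\<Union>l\<in>\<Lambda>. K l \<times> K l)"
    using assms(2) by (auto simp: K_def)
  then have "card {(i, j). i < k \<and> j < k \<and> d i = d j} = (\<Sum>l\<in>\<Lambda>. card (K l \<times> K l))"
    using fK by (simp only:) (rule card_UN_disjoint[OF assms(1)], auto simp: K_def)
  then have "real (card {(i, j). i < k \<and> j < k \<and> d i = d j}) = (\<Sum>l\<in>\<Lambda>. (real (card (K l)))\<^sup>2)"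
    by (simp add: card_cartesian_product power2_eq_square)
  then show ?thesis
    unfolding k using sum_squared_le_sum_of_squares[of "\<lambda>l. real (card (K l))" \<Lambda>] assms(1)
    by (simp add: mult.commute)
qed

text \<open>
  The factor \<open>C\<close> to the power \<open>k\<^sup>2\<close> is the size of a net of the fixed mesh \<open>\<eta>\<close>. Around each of its points,
  moved by a unitary conjugation to a diagonal matrix, off-diagonal blocks keep the class separated up
  to a factor of two, and the number of off-diagonal positions is the dimension of the orbit.
\<close>
theorem spectral_class_separated_card_le:
  fixes \<Lambda> :: "real set"
  assumes fin: "finite \<Lambda>" and ne: "\<Lambda> \<noteq> {}"
  shows "\<exists>C\<ge>1. \<forall>k \<omega> T. 0 < \<omega> \<longrightarrow> \<omega> \<le> 1 \<longrightarrow> finite T \<longrightarrow> T \<subseteq> spectral_class k \<Lambda> \<longrightarrow> separated opdist \<omega> T \<longrightarrow>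
    real (card T) \<le> C ^ (k\<^sup>2) * (C / \<omega>) powr ((real k)\<^sup>2 * (1 - 1 / real (card \<Lambda>)))"
proof -
  define n where "n = real (card \<Lambda>)"
  have n: "n \<ge> 1"
    using fin ne by (simp add: n_def Suc_le_eq card_gt_0_iff)
  obtain \<eta> where \<eta>: "0 < \<eta>" "\<eta> \<le> 1"
    and det: "\<And>k d A A'. \<forall>i<k. d i \<in> \<Lambda> \<Longrightarrow> A \<in> spectral_class k \<Lambda> \<Longrightarrow> A' \<in> spectral_class k \<Lambda> \<Longrightarrow>
      opdist A (rdiag k d) \<le> \<eta> \<Longrightarrow> opdist A' (rdiag k d) \<le> \<eta> \<Longrightarrow>
      opdist A A' \<le> 2 * mat_opnorm (off_block k d (A - A'))"
    using off_block_determines[OF fin] by metis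
  define R where "R = (\<Sum>t\<in>\<Lambda>. \<bar>t\<bar>)"
  have R: "0 \<le> R" "\<And>t. t \<in> \<Lambda> \<Longrightarrow> \<bar>t\<bar> \<le> R"
    using fin by (auto simp: R_def sum_nonneg intro: member_le_sum)
  define C where "C = (1 + 2 * R / \<eta>) + (1 + 4 * n\<^sup>2)"
  have C: "C \<ge> 1" "1 + 2 * R / \<eta> \<le> C" "1 + 4 * n\<^sup>2 \<le> C" "1 + 2 * R / \<eta> \<ge> 0"
    using R \<eta> by (auto simp: C_def)
  have main: "real (card T) \<le> C ^ (k\<^sup>2) * (C / \<omega>) powr ((real k)\<^sup>2 * (1 - 1 / n))"
    if \<omega>: "0 < \<omega>" "\<omega> \<le> 1" and T: "finite T" "T \<subseteq> spectral_class k \<Lambda>" "separated opdist \<omega> T" for k \<omega> T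
  proof -
    have carrier: "A \<in> carrier_mat k k" if "A \<in> spectral_class k \<Lambda>" for A
      using that by (rule spectral_class_carrier)
    have full: "{..<k} \<times> {..<k} \<subseteq> {..<k} \<times> {..<k}" "sym ({..<k} \<times> {..<k})" "card ({..<k} \<times> {..<k}) = k\<^sup>2"
      by (auto simp: sym_def card_cartesian_product power2_eq_square)
    have coarse: "real (card T') \<le> (1 + 2 * R / \<eta>) ^ (k\<^sup>2)"
      if "finite T'" "T' \<subseteq> spectral_class k \<Lambda>" "separated opdist \<eta> T'" for T'
      unfolding full(3)[symmetric]
    proof (rule selfadjoint_separated_card_le[OF full(1,2) that(1), where \<phi> = "\<lambda>A. A"])
      fix A
      assume "A \<in> T'"
      then show "A \<in> selfadjoint_mats k" "mat_opnorm A \<le> R"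
        using that(2) R by (auto intro: spectral_class_selfadjoint spectral_class_norm_le)
    qed (use that(3) \<eta> R in \<open>auto dest: separatedD\<close>)
    have "\<exists>T0. finite T0 \<and> T0 \<subseteq> spectral_class k \<Lambda> \<and> separated opdist \<eta> T0 \<and> (\<forall>A\<in>spectral_class k \<Lambda>. \<exists>B\<in>T0. opdist A B < \<eta>)"
      by (rule maximal_separated_covers[OF coarse])
        (use carrier \<eta> in \<open>auto intro: mat_opnorm_minus_commute simp: minus_r_inv_mat[of _ k k] mat_opnorm_zero\<close>)
    then obtain T0 where T0: "finite T0" "T0 \<subseteq> spectral_class k \<Lambda>" "separated opdist \<eta> T0"
      and cov: "\<And>A. A \<in> spectral_class k \<Lambda> \<Longrightarrow> \<exists>B\<in>T0. opdist A B < \<eta>"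
      by blast
    obtain c where c: "\<And>A. A \<in> T \<Longrightarrow> c A \<in> T0" "\<And>A. A \<in> T \<Longrightarrow> opdist A (c A) < \<eta>"
      using cov T(2) by (metis subsetD)
    have fiber: "real (card {A\<in>T. c A = B}) \<le> (C / \<omega>) powr ((real k)\<^sup>2 * (1 - 1 / n))" if B: "B \<in> T0" for B
    proof -
      obtain W d where W: "unitary_mat k W" "\<forall>i<k. d i \<in> \<Lambda>" "B = unitary_rdiag k W d"
        using B T0(2) by (auto simp: spectral_class_def)
      have Wc: "W \<in> carrier_mat k k" "mat_adjoint W \<in> carrier_mat k k"
        using W(1) by (auto simp: unitary_mat_def)
      define D where "D = rdiag k d"
      have D: "D \<in> carrier_mat k k" "D \<in> selfadjoint_mats k"
        using W(2) mat_diag_spectral_class[of k d \<Lambda>] by (auto simp: D_def spectral_class_selfadjoint)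
      define tw where "tw = (\<lambda>A. mat_adjoint W * A * W)"
      have twc: "tw A \<in> carrier_mat k k" if "A \<in> carrier_mat k k" for A
        using that Wc by (auto simp: tw_def intro!: mult_carrier_mat[of _ k k _ k])
      have twd: "opdist (tw A) (tw A') = opdist A A'" if "A \<in> carrier_mat k k" "A' \<in> carrier_mat k k" for A A'
      proof -
        have "tw A - tw A' = mat_adjoint W * (A - A') * W"
          unfolding tw_def mult_minus_distrib_mat[OF Wc(2) that]
          by (rule minus_mult_distrib_mat[symmetric, of _ k k]) (use that Wc in \<open>auto intro!: mult_carrier_mat[of _ k k _ k]\<close>)
        then show ?thesis
          using mat_opnorm_unitary_conj[OF unitary_mat_adjoint[OF W(1)], of "A - A'"] that by (simp add: minus_carrier_mat)
      qed
      have twB: "tw B = D"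
        using unitary_conj_cancel[OF W(1) mat_diag_dim] unfolding tw_def W(3) unitary_diag_def D_def .
      define Q where "Q = {(i, j). i < k \<and> j < k \<and> d i \<noteq> d j}"
      have Q: "Q \<subseteq> {..<k} \<times> {..<k}" "sym Q"
        by (auto simp: Q_def sym_def)
      define \<phi> where "\<phi> = (\<lambda>A. off_block k d (tw A - D))"
      let ?F = "{A\<in>T. c A = B}"
      have F: "A \<in> carrier_mat k k" "tw A \<in> spectral_class k \<Lambda>" "opdist (tw A) D \<le> \<eta>" if "A \<in> ?F" for A
      proof -
        show A: "A \<in> carrier_mat k k"
          using that T(2) carrier by auto
        show "tw A \<in> spectral_class k \<Lambda>"
          unfolding tw_def using that T(2) W(1) by (intro spectral_class_unitary_conj) auto
        have "opdist (tw A) D = opdist A B"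
          unfolding twB[symmetric] using A B T0(2) carrier by (intro twd) auto
        then show "opdist (tw A) D \<le> \<eta>"
          using c(2)[of A] that by auto
      qed
      have "real (card ?F) \<le> (1 + 2 * (n\<^sup>2 * \<eta>) / (\<omega> / 2)) ^ card Q"
      proof (rule selfadjoint_separated_card_le[OF Q, where \<phi> = \<phi>])
        fix A
        assume A: "A \<in> ?F"
        have sa: "tw A - D \<in> selfadjoint_mats k"
          using spectral_class_selfadjoint[OF F(2)[OF A]] D
          by (auto simp: selfadjoint_mats_def mat_adjoint_diff[of _ k k] minus_carrier_mat)
        show "\<phi> A \<in> selfadjoint_mats k"
          unfolding \<phi>_def using sa by (rule off_block_selfadjoint)
        have "mat_opnorm (\<phi> A) \<le> n\<^sup>2 * opdist (tw A) D"
          unfolding \<phi>_def n_def using W(2) selfadjoint_mats_carrier[OF sa] by (intro block_norm_le fin) auto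
        also have "\<dots> \<le> n\<^sup>2 * \<eta>"
          using F(3)[OF A] by (intro mult_left_mono) auto
        finally show "mat_opnorm (\<phi> A) \<le> n\<^sup>2 * \<eta>" .
        show "\<phi> A $$ (i, j) = 0" if "i < k" "j < k" "(i, j) \<notin> Q" for i j
          using that by (simp add: \<phi>_def off_block_def Q_def)
        fix A'
        assume A': "A' \<in> ?F" and neq: "A \<noteq> A'"
        have tc: "tw A \<in> carrier_mat k k" "tw A' \<in> carrier_mat k k"
          using F(1)[OF A] F(1)[OF A'] twc by auto
        have tD: "tw A - D \<in> carrier_mat k k" "tw A' - D \<in> carrier_mat k k"
          using D by (auto intro: minus_carrier_mat)
        have "\<omega> \<le> opdist A A'"
          using separatedD[OF T(3)] A A' neq by auto
        also have "\<dots> = opdist (tw A) (tw A')"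
          using twd F(1)[OF A] F(1)[OF A'] by simp
        also have "\<dots> \<le> 2 * mat_opnorm (off_block k d (tw A - tw A'))"
          using det[OF W(2) F(2)[OF A] F(2)[OF A']] F(3)[OF A] F(3)[OF A'] by (simp add: D_def)
        also have "tw A - tw A' = (tw A - D) - (tw A' - D)"
          using tc D by (intro eq_matI) auto
        also have "off_block k d \<dots> = \<phi> A - \<phi> A'"
          unfolding \<phi>_def by (rule off_block_diff[OF tD])
        finally show "\<omega> / 2 \<le> opdist (\<phi> A) (\<phi> A')"
          by simp
      qed (use T \<omega> \<eta> in auto)
      also have "\<dots> \<le> (C / \<omega>) ^ card Q"
      proof (rule power_mono)
        have "1 + 2 * (n\<^sup>2 * \<eta>) / (\<omega> / 2) = 1 + 4 * n\<^sup>2 * \<eta> / \<omega>"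
          by simp
        also have "\<dots> \<le> 1 / \<omega> + 4 * n\<^sup>2 * 1 / \<omega>"
          using \<omega> \<eta> by (intro add_mono divide_right_mono mult_left_mono) auto
        also have "\<dots> \<le> C / \<omega>"
          using C(3) \<omega> by (simp add: add_divide_distrib[symmetric] divide_right_mono)
        finally show "1 + 2 * (n\<^sup>2 * \<eta>) / (\<omega> / 2) \<le> C / \<omega>" .
      qed (use \<omega> \<eta> in auto)
      also have "\<dots> = (C / \<omega>) powr real (card Q)"
        using C(1) \<omega> by (simp add: powr_realpow)
      also have "\<dots> \<le> (C / \<omega>) powr ((real k)\<^sup>2 * (1 - 1 / n))"
      proof (rule powr_mono)
        let ?E = "{(i, j). i < k \<and> j < k \<and> d i = d j}"
        have un: "Q \<union> ?E = {..<k} \<times> {..<k}" and disj: "Q \<inter> ?E = {}"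
          by (auto simp: Q_def)
        have "finite Q" "finite ?E"
          by (rule finite_subset[of _ "{..<k} \<times> {..<k}"]; auto simp: Q_def)+
        from card_Un_disjoint[OF this disj] have "card Q + card ?E = k\<^sup>2"
          unfolding un full(3) by (rule sym)
        then have "real (card Q + card ?E) = real (k\<^sup>2)"
          by (rule arg_cong)
        then have "real (card Q) + real (card ?E) = (real k)\<^sup>2"
          by simp
        moreover have "(real k)\<^sup>2 \<le> n * real (card ?E)"
          unfolding n_def using W(2) by (intro card_equal_pairs_ge fin) auto
        then have "(real k)\<^sup>2 / n \<le> real (card ?E)"
          using n by (simp add: field_simps)
        ultimately show "real (card Q) \<le> (real k)\<^sup>2 * (1 - 1 / n)"
          by (simp add: right_diff_distrib)
        show "1 \<le> C / \<omega>"
          using C(1) \<omega> by (simp add: field_simps)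
      qed
      finally show ?thesis .
    qed
    have "T = (\<Union>B\<in>T0. {A\<in>T. c A = B})"
      using c(1) by auto
    then have "card T = card (\<Union>B\<in>T0. {A\<in>T. c A = B})"
      by (rule arg_cong)
    also have "\<dots> \<le> (\<Sum>B\<in>T0. card {A\<in>T. c A = B})"
      by (rule card_UN_le[OF T0(1)])
    finally have "real (card T) \<le> real (\<Sum>B\<in>T0. card {A\<in>T. c A = B})"
      by (rule of_nat_mono)
    then have "real (card T) \<le> (\<Sum>B\<in>T0. real (card {A\<in>T. c A = B}))"
      by (simp only: of_nat_sum)
    also have "\<dots> \<le> (\<Sum>B\<in>T0. (C / \<omega>) powr ((real k)\<^sup>2 * (1 - 1 / n)))"
      by (intro sum_mono fiber)
    also have "\<dots> = real (card T0) * (C / \<omega>) powr ((real k)\<^sup>2 * (1 - 1 / n))"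
      by simp
    also have "real (card T0) \<le> C ^ (k\<^sup>2)"
      using coarse[OF T0(1-3)] power_mono[OF C(2,4), of "k\<^sup>2"] by linarith
    finally show ?thesis
      by (simp add: mult_right_mono)
  qed
  show ?thesis
    by (intro exI[of _ C] conjI allI impI C(1) main[unfolded n_def])
qed

section \<open>Any discretization of a spectral class is large\<close>

lemma nearest_point_exists:
  fixes \<Lambda> :: "real set"
  assumes "finite \<Lambda>" "\<Lambda> \<noteq> {}"
  shows "\<exists>l\<in>\<Lambda>. \<forall>l'\<in>\<Lambda>. \<bar>l - t\<bar> \<le> \<bar>l' - t\<bar>"
proof -
  let ?l = "arg_min_on (\<lambda>l. \<bar>l - t\<bar>) \<Lambda>"
  have "?l \<in> \<Lambda>"
    using assms by (rule arg_min_if_finite(1))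
  moreover have "\<bar>?l - t\<bar> \<le> \<bar>l' - t\<bar>" if "l' \<in> \<Lambda>" for l'
    using assms that by (rule arg_min_least)
  ultimately show ?thesis
    by blast
qed

text \<open>
  An eigenvalue \<open>h\<close> of \<open>D + G\<close> cannot be farther than the norm of \<open>G\<close> from all entries of \<open>D\<close>: if \<open>Y\<close> is a
  spectral projection for \<open>h\<close>, then \<open>(D - h) Y = - G Y\<close>, and inverting \<open>D - h\<close> would make the norm of \<open>Y\<close>
  smaller than itself.
\<close>
lemma eigenvalue_near_spectrum:
  assumes d: "\<And>i. i < k \<Longrightarrow> \<eta> < \<bar>d i - h a\<bar>" and U: "unitary_mat k U" and a: "a < k"
    and G: "G \<in> carrier_mat k k" "mat_opnorm G \<le> \<eta>" and "0 \<le> \<eta>"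
    and H: "rdiag k d + G = unitary_rdiag k U h"
  shows False
proof -
  define D where "D = rdiag k d"
  define m where "m = Min ((\<lambda>i. \<bar>d i - h a\<bar>) ` {..<k})"
  have ne: "(\<lambda>i. \<bar>d i - h a\<bar>) ` {..<k} \<noteq> {}"
    using a by auto
  have m: "\<eta> < m" "\<And>i. i < k \<Longrightarrow> m \<le> \<bar>d i - h a\<bar>"
    using d ne by (auto simp: m_def)
  have mpos: "0 < m"
    using m(1) \<open>0 \<le> \<eta>\<close> by linarith
  define X where "X = mat_diag k (\<lambda>i. 1 / complex_of_real (d i - h a))"
  have X: "X \<in> carrier_mat k k"
    by (simp add: X_def)
  have nX: "mat_opnorm X \<le> 1 / m"
    unfolding X_def using m(2) mpos
    by (intro mat_opnorm_diag_le) (auto simp: norm_divide frac_le simp del: of_real_diff)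
  define Y where "Y = unitary_diag k U (\<lambda>i. if i = a then 1 else 0)"
  have Y: "Y \<in> carrier_mat k k"
    using unitary_mat_carrier[OF U] by (simp add: Y_def)
  have nY: "1 \<le> mat_opnorm Y"
    unfolding Y_def using mat_opnorm_unitary_diag_ge[OF U a, of "\<lambda>i. if i = a then 1 else 0"] by simp
  define E where "E = complex_of_real (h a) \<cdot>\<^sub>m (1\<^sub>m k :: complex mat)"
  have Dc: "D \<in> carrier_mat k k" "D - E \<in> carrier_mat k k"
    by (auto simp: D_def E_def intro!: shift_carrier)
  have DE: "D - E = mat_diag k (\<lambda>i. complex_of_real (d i - h a))"
    by (intro eq_matI) (auto simp: D_def E_def mat_diag_def)
  have "X * (D - E) = mat_diag k (\<lambda>i. 1)"
    unfolding DE X_def mat_diag_diag by (intro eq_matI) (use m(2) mpos in \<open>force simp: mat_diag_def\<close>)+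
  then have XD: "X * (D - E) = 1\<^sub>m k"
    by simp
  have "(D - E) + G = (D + G) - E"
    using Dc G by (intro eq_matI) (auto simp: E_def)
  also have "\<dots> = unitary_diag k U (\<lambda>i. complex_of_real (h i) - complex_of_real (h a))"
    unfolding D_def H E_def by (rule unitary_diag_shift[OF U])
  finally have "((D - E) + G) * Y = unitary_diag k U (\<lambda>i. (complex_of_real (h i) - complex_of_real (h a)) * (if i = a then 1 else 0))"
    unfolding Y_def by (simp only: unitary_diag_mult[OF U])
  also have "\<dots> = 0\<^sub>m k k"
    by (rule unitary_diag_zero[OF unitary_mat_carrier[OF U]]) auto
  finally have z: "(D - E) * Y + G * Y = 0\<^sub>m k k"
    using add_mult_distrib_mat[OF Dc(2) G(1) Y] by simp
  have c: "(D - E) * Y \<in> carrier_mat k k" "G * Y \<in> carrier_mat k k"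
    using Dc G Y by (auto intro: mult_carrier_mat)
  have "X * ((D - E) * Y) + X * (G * Y) = 0\<^sub>m k k"
    using mult_add_distrib_mat[OF X c] unfolding z by (simp add: right_mult_zero_mat[OF X])
  moreover have "X * ((D - E) * Y) = Y"
    using assoc_mult_mat[OF X Dc(2) Y] unfolding XD by (simp add: left_mult_one_mat[OF Y])
  ultimately have "Y + X * (G * Y) = 0\<^sub>m k k"
    by simp
  moreover have XGY: "X * (G * Y) \<in> carrier_mat k k"
    using X c(2) by (rule mult_carrier_mat)
  ultimately have "Y = (-1) \<cdot>\<^sub>m (X * (G * Y))"
    using Y by (intro eq_matI) (auto simp: mat_eq_iff eq_neg_iff_add_eq_0 simp del: index_mult_mat(1))
  then have "mat_opnorm Y = mat_opnorm (X * (G * Y))"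
    using mat_opnorm_smult[OF XGY, of "-1"] by simp
  also have "\<dots> \<le> mat_opnorm X * (mat_opnorm G * mat_opnorm Y)"
    using mat_opnorm_mult[OF X c(2)] mat_opnorm_mult[OF G(1) Y] mat_opnorm_nonneg
    by (meson mult_left_mono order.trans)
  also have "\<dots> \<le> 1 / m * (\<eta> * mat_opnorm Y)"
    using nX G(2) mat_opnorm_nonneg mpos \<open>0 \<le> \<eta>\<close> by (intro mult_mono) auto
  finally have "m * mat_opnorm Y \<le> \<eta> * mat_opnorm Y"
    using mpos by (simp add: field_simps)
  then show False
    using m(1) nY by simp
qed

text \<open>
  Replace every eigenvalue of \<open>H\<close> by the nearest point of \<open>\<Lambda>\<close>, keeping the eigenvectors.
\<close>
lemma spectral_rounding:
  fixes \<Lambda> :: "real set"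
  assumes fin: "finite \<Lambda>" and ne: "\<Lambda> \<noteq> {}" and d: "\<And>i. i < k \<Longrightarrow> d i \<in> \<Lambda>"
    and G: "G \<in> selfadjoint_mats k" "mat_opnorm G \<le> \<eta>" and \<eta>: "0 \<le> \<eta>"
  defines "H \<equiv> rdiag k d + G"
  shows "\<exists>A\<in>spectral_class k \<Lambda>. opdist A H \<le> \<eta> \<and> A * H = H * A"
proof -
  have Gc: "G \<in> carrier_mat k k"
    using G(1) by (rule selfadjoint_mats_carrier)
  have D: "rdiag k d \<in> selfadjoint_mats k"
    by (rule spectral_class_selfadjoint[OF mat_diag_spectral_class[OF d]])
  have Hc: "H \<in> carrier_mat k k"
    using Gc by (auto simp: H_def)
  have "mat_adjoint H = H"
    using D G(1) Gc by (simp add: H_def mat_adjoint_add[of _ k k] selfadjoint_mats_def)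
  then obtain U h where U: "unitary_mat k U" "H = unitary_rdiag k U h"
    using selfadjoint_unitary_diagonalization[OF Hc] by blast
  have "\<forall>t. \<exists>l\<in>\<Lambda>. \<forall>l'\<in>\<Lambda>. \<bar>l - t\<bar> \<le> \<bar>l' - t\<bar>"
    using nearest_point_exists[OF fin ne] by blast
  then obtain rd where rd: "\<And>t. rd t \<in> \<Lambda>" "\<And>t l'. l' \<in> \<Lambda> \<Longrightarrow> \<bar>rd t - t\<bar> \<le> \<bar>l' - t\<bar>"
    by metis
  define A where "A = unitary_diag k U (\<lambda>i. complex_of_real (rd (h i)))"
  have "\<bar>rd (h a) - h a\<bar> \<le> \<eta>" if "a < k" for a
  proof (rule ccontr)
    assume "\<not> ?thesis"
    then have "\<eta> < \<bar>d i - h a\<bar>" if "i < k" for i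
      using rd(2)[OF d[OF that], of "h a"] by linarith
    then show False
      using eigenvalue_near_spectrum[OF _ U(1) \<open>a < k\<close> Gc G(2) \<eta>] U(2) unfolding H_def by blast
  qed
  then have "opdist A H \<le> \<eta>"
    unfolding A_def U(2) unitary_diag_diff[OF unitary_mat_carrier[OF U(1)]] using \<eta>
    by (intro mat_opnorm_unitary_diag_le U(1)) (auto simp flip: of_real_diff)
  moreover have "A * H = H * A"
    unfolding A_def U(2) unitary_diag_mult[OF U(1)] by (simp add: mult.commute)
  moreover have "A \<in> spectral_class k \<Lambda>"
    unfolding A_def spectral_class_def using U(1) rd(1)
    by (intro CollectI exI[of _ U] exI[of _ "\<lambda>i. rd (h i)"]) simp
  ultimately show ?thesis
    by blast
qed

text \<open>
  The commutator with a diagonal matrix multiplies the \<open>(i, j)\<close> entry by \<open>d\<^sub>j - d\<^sub>i\<close>, which a block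
  multiplier undoes. The convention \<open>1 / 0 = 0\<close> makes that multiplier vanish on the diagonal blocks.
\<close>
lemma off_block_le_commutator:
  fixes \<Lambda> :: "real set"
  assumes fin: "finite \<Lambda>" and d: "\<And>i. i < k \<Longrightarrow> d i \<in> \<Lambda>" and M: "M \<in> carrier_mat k k"
  defines "D \<equiv> rdiag k d"
  shows "mat_opnorm (off_block k d M) \<le> (\<Sum>(p, q)\<in>\<Lambda> \<times> \<Lambda>. cmod (1 / complex_of_real (q - p))) * mat_opnorm (M * D - D * M)"
proof -
  have MD: "M * D = mat k k (\<lambda>(i, j). M $$ (i, j) * complex_of_real (d j))"
    unfolding D_def by (rule mat_diag_mult_right[OF M])
  have DM: "D * M = mat k k (\<lambda>(i, j). complex_of_real (d i) * M $$ (i, j))"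
    unfolding D_def by (rule mat_diag_mult_left[OF M])
  have c: "M * D - D * M \<in> carrier_mat k k"
    unfolding MD DM by (intro minus_carrier_mat) auto
  have "off_block k d M = mat k k (\<lambda>(i, j). 1 / complex_of_real (d j - d i) * (M * D - D * M) $$ (i, j))"
    unfolding MD DM off_block_def by (intro eq_matI) (auto simp: field_simps)
  then show ?thesis
    using mat_opnorm_block_multiplier[OF c fin d, where \<phi> = "\<lambda>p q. 1 / complex_of_real (q - p)"] by simp
qed

text \<open>
  The commutator of \<open>H - H'\<close> with \<open>A\<close> equals minus that of \<open>H'\<close> with \<open>A - A'\<close>, because \<open>A\<close> commutes with \<open>H\<close>
  and \<open>A'\<close> with \<open>H'\<close>; passing from \<open>A\<close> to \<open>D\<close> gives the other term.
\<close>
lemma commutator_transfer: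
  fixes H H' A A' D :: "complex mat"
  assumes car: "H \<in> carrier_mat k k" "H' \<in> carrier_mat k k" "A \<in> carrier_mat k k" "A' \<in> carrier_mat k k" "D \<in> carrier_mat k k"
    and comm: "A * H = H * A" "A' * H' = H' * A'"
  shows "mat_opnorm ((H - H') * D - D * (H - H'))
    \<le> 2 * opdist H H' * opdist D A + 2 * mat_opnorm H' * opdist A A'"
proof -
  define M where "M = H - H'"
  have M: "M \<in> carrier_mat k k" and DA: "D - A \<in> carrier_mat k k" and AA: "A - A' \<in> carrier_mat k k"
    using car by (auto simp: M_def intro: minus_carrier_mat)
  note pc = mult_carrier_mat[of _ k k _ k]
  have rearrange: "a - b = (a - (x - y)) - (b - (x - z)) + ((z - w) - (y - w))"
    if "a \<in> carrier_mat k k" "b \<in> carrier_mat k k" "x \<in> carrier_mat k k" "y \<in> carrier_mat k k"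
      "z \<in> carrier_mat k k" "w \<in> carrier_mat k k" for a b x y z w :: "complex mat"
    using that by (intro eq_matI) auto
  note prods = pc[OF M car(5)] pc[OF car(5) M] pc[OF car(1,3)] pc[OF car(2,3)] pc[OF car(3,2)] pc[OF car(2,4)]
    pc[OF M DA] pc[OF DA M] pc[OF AA car(2)] pc[OF car(2) AA]
  have e: "M * (D - A) = M * D - (H * A - H' * A)" "(D - A) * M = D * M - (H * A - A * H')"
    "(A - A') * H' = A * H' - H' * A'" "H' * (A - A') = H' * A - H' * A'"
    unfolding mult_minus_distrib_mat[OF M car(5,3)] minus_mult_distrib_mat[OF car(5,3) M]
      minus_mult_distrib_mat[OF car(3,4,2)] mult_minus_distrib_mat[OF car(2,3,4)] comm(2)
    unfolding M_def minus_mult_distrib_mat[OF car(1,2,3)] mult_minus_distrib_mat[OF car(3,1,2)] comm(1)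
    by (rule refl)+
  have "M * D - D * M = (M * (D - A) - (D - A) * M) + ((A - A') * H' - H' * (A - A'))"
    unfolding e using prods(1-6) by (rule rearrange)
  then have "mat_opnorm (M * D - D * M)
      \<le> mat_opnorm (M * (D - A) - (D - A) * M) + mat_opnorm ((A - A') * H' - H' * (A - A'))"
    using mat_opnorm_add[of "M * (D - A) - (D - A) * M" k k "(A - A') * H' - H' * (A - A')"] prods
    by (simp add: minus_carrier_mat)
  also have "\<dots> \<le> (mat_opnorm (M * (D - A)) + mat_opnorm ((D - A) * M)) + (mat_opnorm ((A - A') * H') + mat_opnorm (H' * (A - A')))"
    using prods by (intro add_mono mat_opnorm_diff)
  also have "\<dots> \<le> (mat_opnorm M * opdist D A + opdist D A * mat_opnorm M) + (opdist A A' * mat_opnorm H' + mat_opnorm H' * opdist A A')"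
    using M DA AA car by (intro add_mono mat_opnorm_mult)
  finally show ?thesis
    by (simp add: M_def algebra_simps)
qed

text \<open>
  The number of positions in the diagonal blocks when the \<open>N\<close> eigenvalues are repeated cyclically.
\<close>
lemma card_congruent_pairs_le:
  assumes "0 < N"
  shows "real (card {(i, j). i < k \<and> j < k \<and> i mod N = j mod N}) \<le> (real k)\<^sup>2 / real N + real k"
proof -
  have row: "real (card {j. j < k \<and> i mod N = j mod N}) \<le> real k / real N + 1" for i
  proof -
    have "{j. j < k \<and> i mod N = j mod N} \<subseteq> (\<lambda>q. q * N + i mod N) ` {..k div N}"
    proof
      fix j
      assume "j \<in> {j. j < k \<and> i mod N = j mod N}"
      then have "j = (j div N) * N + i mod N" "j div N \<le> k div N"
        by (auto intro: div_le_mono)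
      then show "j \<in> (\<lambda>q. q * N + i mod N) ` {..k div N}"
        by blast
    qed
    then have "card {j. j < k \<and> i mod N = j mod N} \<le> card {..k div N}"
      by (meson card_image_le card_mono finite_atMost finite_imageI le_trans)
    then have "real (card {j. j < k \<and> i mod N = j mod N}) \<le> real (k div N) + 1"
      by simp
    also have "real (k div N) \<le> real k / real N"
      by (rule of_nat_div_le_of_nat)
    finally show ?thesis
      by simp
  qed
  have "{(i, j). i < k \<and> j < k \<and> i mod N = j mod N} = (SIGMA i:{..<k}. {j. j < k \<and> i mod N = j mod N})"
    by auto
  then have "card {(i, j). i < k \<and> j < k \<and> i mod N = j mod N} = (\<Sum>i<k. card {j. j < k \<and> i mod N = j mod N})"
    by (simp add: card_SigmaI)
  then have "real (card {(i, j). i < k \<and> j < k \<and> i mod N = j mod N}) = (\<Sum>i<k. real (card {j. j < k \<and> i mod N = j mod N}))"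
    by simp
  also have "\<dots> \<le> (\<Sum>i<k. real k / real N + 1)"
    by (intro sum_mono row)
  finally show ?thesis
    by (simp add: algebra_simps power2_eq_square)
qed

text \<open>
  The map \<open>c\<close> stands for the choice of a nearby centre of a covering. The points of a separated set in
  the ball about a diagonal matrix \<open>D\<close>, a set of size about \<open>1 / \<omega>\<close> to the power \<open>k\<^sup>2\<close>, are sorted by the
  value of \<open>c\<close> at their roundings. Differences within one class nearly commute with \<open>D\<close>, so each class
  is separated already by its diagonal blocks and has size at most about \<open>1 / \<omega>\<close> to the power
  \<open>k\<^sup>2 / card \<Lambda> + k\<close>.
\<close>
theorem spectral_class_discretization_ge:
  fixes \<Lambda> :: "real set"
  assumes fin: "finite \<Lambda>" and ne: "\<Lambda> \<noteq> {}"
  shows "\<exists>K\<ge>1. \<forall>k \<omega> (c :: complex mat \<Rightarrow> complex mat). 0 < \<omega> \<longrightarrow> \<omega> \<le> 1 \<longrightarrow> finite (c ` spectral_class k \<Lambda>) \<longrightarrow>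
    (\<forall>A\<in>spectral_class k \<Lambda>. \<forall>A'\<in>spectral_class k \<Lambda>. c A = c A' \<longrightarrow> opdist A A' \<le> 2 * \<omega>) \<longrightarrow>
    (1 / (K * \<omega>)) ^ (k\<^sup>2) \<le> real (card (c ` spectral_class k \<Lambda>)) * (K / \<omega>) powr ((real k)\<^sup>2 / real (card \<Lambda>) + real k)"
proof -
  define N where "N = card \<Lambda>"
  have N: "0 < N"
    using fin ne by (simp add: N_def card_gt_0_iff)
  obtain e where e: "bij_betw e {0..<N} \<Lambda>"
    using ex_bij_betw_nat_finite[OF fin] by (auto simp: N_def)
  define d where "d = (\<lambda>i. e (i mod N))"
  have d: "d i \<in> \<Lambda>" for i
    using bij_betwE[OF e] N by (auto simp: d_def)
  have dd: "d i = d j \<longleftrightarrow> i mod N = j mod N" for i j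
    using bij_betw_imp_inj_on[OF e] N by (auto simp: d_def inj_on_eq_iff)
  define R where "R = (\<Sum>t\<in>\<Lambda>. \<bar>t\<bar>)"
  have R: "0 \<le> R" "\<And>t. t \<in> \<Lambda> \<Longrightarrow> \<bar>t\<bar> \<le> R"
    using fin by (auto simp: R_def sum_nonneg intro: member_le_sum)
  define Cc where "Cc = 1 + (\<Sum>(p, q)\<in>\<Lambda> \<times> \<Lambda>. cmod (1 / complex_of_real (q - p)))"
  have Cc: "1 \<le> Cc"
    unfolding Cc_def by (simp add: sum_nonneg case_prod_beta)
  \<comment> \<open>With this radius the error \<open>4 \<eta> \<parallel>M\<parallel>\<close> of replacing \<open>A\<close> by \<open>D\<close> in the commutator is absorbed.\<close>
  define \<eta> where "\<eta> = 1 / (8 * Cc)"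
  have \<eta>: "0 < \<eta>" "\<eta> \<le> 1" "Cc * \<eta> = 1 / 8"
    using Cc by (auto simp: \<eta>_def field_simps)
  \<comment> \<open>Points \<open>2 c1 \<omega>\<close> apart stay apart in their diagonal blocks after the error from the covering is subtracted.\<close>
  define c1 where "c1 = 8 * Cc * (R + 1)"
  have c1: "8 \<le> c1"
    using Cc R(1) mult_mono[of 1 Cc 1 "R + 1"] by (simp add: c1_def)
  define K where "K = 2 * c1 / \<eta> + (1 + (real N)\<^sup>2)"
  have K: "1 \<le> K" "2 * c1 / \<eta> \<le> K" "1 + (real N)\<^sup>2 \<le> K"
    using c1 \<eta> by (auto simp: K_def)
  have main: "(1 / (K * \<omega>)) ^ (k\<^sup>2) \<le> real (card (c ` spectral_class k \<Lambda>)) * (K / \<omega>) powr ((real k)\<^sup>2 / real N + real k)"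
    if \<omega>: "0 < \<omega>" "\<omega> \<le> 1" and fc: "finite (c ` spectral_class k \<Lambda>)"
      and cc: "\<forall>A\<in>spectral_class k \<Lambda>. \<forall>A'\<in>spectral_class k \<Lambda>. c A = c A' \<longrightarrow> opdist A A' \<le> 2 * \<omega>"
    for k \<omega> and c :: "complex mat \<Rightarrow> complex mat"
  proof -
    define D where "D = rdiag k d"
    have D: "D \<in> spectral_class k \<Lambda>"
      unfolding D_def using d by (intro mat_diag_spectral_class)
    have Dc: "D \<in> carrier_mat k k" and nD: "mat_opnorm D \<le> R"
      using D R by (auto intro: spectral_class_carrier spectral_class_norm_le)
    have "0 < 2 * c1 * \<omega>"
      using c1 \<omega> by simp
    from selfadjoint_separated_exists[OF \<eta>(1) this, of k]
    obtain T where T: "finite T" "T \<subseteq> selfadjoint_mats k" "\<And>G. G \<in> T \<Longrightarrow> mat_opnorm G \<le> \<eta>"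
        "separated opdist (2 * c1 * \<omega>) T" "(\<eta> / (2 * c1 * \<omega>)) ^ (k\<^sup>2) \<le> real (card T)"
      by blast
    have "\<forall>G\<in>T. \<exists>A. A \<in> spectral_class k \<Lambda> \<and> opdist A (D + G) \<le> \<eta> \<and> A * (D + G) = (D + G) * A"
    proof
      fix G
      assume "G \<in> T"
      then show "\<exists>A. A \<in> spectral_class k \<Lambda> \<and> opdist A (D + G) \<le> \<eta> \<and> A * (D + G) = (D + G) * A"
        using spectral_rounding[OF fin ne, of k d G \<eta>] d T(2,3) \<eta>(1)
        unfolding D_def by (auto simp: subset_eq)
    qed
    from bchoice[OF this] obtain A where A: "\<And>G. G \<in> T \<Longrightarrow> A G \<in> spectral_class k \<Lambda>"
        "\<And>G. G \<in> T \<Longrightarrow> opdist (A G) (D + G) \<le> \<eta>" "\<And>G. G \<in> T \<Longrightarrow> A G * (D + G) = (D + G) * A G"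
      by blast
    define Q where "Q = {(i, j). i < k \<and> j < k \<and> i mod N = j mod N}"
    have Q: "Q \<subseteq> {..<k} \<times> {..<k}" "sym Q"
      by (auto simp: Q_def sym_def)
    have Gc: "G \<in> carrier_mat k k" if "G \<in> T" for G
      using T(2) that selfadjoint_mats_carrier by blast
    have fiber: "real (card {G\<in>T. c (A G) = z}) \<le> (K / \<omega>) powr ((real k)\<^sup>2 / real N + real k)" for z
    proof -
      let ?F = "{G\<in>T. c (A G) = z}"
      have "real (card ?F) \<le> (1 + 2 * (real N)\<^sup>2 / (c1 * \<omega> / 2)) ^ card Q"
      proof (rule selfadjoint_separated_card_le[OF Q, where \<phi> = "diag_block k d"])
        fix G
        assume G: "G \<in> ?F"
        then show "diag_block k d G \<in> selfadjoint_mats k"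
          using T(2) by (intro off_block_selfadjoint) auto
        have "mat_opnorm (diag_block k d G) \<le> (real N)\<^sup>2 * mat_opnorm G"
          unfolding N_def using d Gc G by (intro block_norm_le fin) auto
        also have "\<dots> \<le> (real N)\<^sup>2 * 1"
          using T(3)[of G] G \<eta>(2) by (intro mult_left_mono) auto
        finally show "mat_opnorm (diag_block k d G) \<le> (real N)\<^sup>2"
          by simp
        show "diag_block k d G $$ (i, j) = 0" if "i < k" "j < k" "(i, j) \<notin> Q" for i j
          using that by (simp add: diag_block_def Q_def dd)
        fix G'
        assume G': "G' \<in> ?F" and neq: "G \<noteq> G'"
        define M where "M = G - G'"
        have GT: "G \<in> T" "G' \<in> T"
          using G G' by auto
        have Mc: "M \<in> carrier_mat k k"
          using Gc[OF GT(2)] by (auto simp: M_def intro: minus_carrier_mat)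
        have Hc: "D + G \<in> carrier_mat k k" "D + G' \<in> carrier_mat k k"
          using Gc[OF GT(1)] Gc[OF GT(2)] by auto
        have MH: "(D + G) - (D + G') = M"
          using Dc Gc[OF GT(1)] Gc[OF GT(2)] by (intro eq_matI) (auto simp: M_def)
        have Ac: "A G \<in> carrier_mat k k" "A G' \<in> carrier_mat k k"
          using A(1) GT by (auto intro: spectral_class_carrier)
        have "opdist D (A G) \<le> opdist D (D + G) + opdist (D + G) (A G)"
          using Dc Hc(1) Ac(1) by (rule mat_opnorm_diff_triangle)
        also have "D - (D + G) = (-1) \<cdot>\<^sub>m G"
          using Dc Gc[OF GT(1)] by (intro eq_matI) auto
        also have "mat_opnorm ((-1) \<cdot>\<^sub>m G) = mat_opnorm G"
          using mat_opnorm_smult[OF Gc[OF GT(1)], of "-1"] by simp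
        finally have DA: "opdist D (A G) \<le> 2 * \<eta>"
          using T(3)[OF GT(1)] A(2)[OF GT(1)] mat_opnorm_minus_commute[OF Hc(1) Ac(1)] by linarith
        have AA: "opdist (A G) (A G') \<le> 2 * \<omega>"
          using cc A(1) GT G G' by auto
        have H': "mat_opnorm (D + G') \<le> R + 1"
          using mat_opnorm_add[OF Dc Gc[OF GT(2)]] nD T(3)[OF GT(2)] \<eta>(2) by linarith
        have "mat_opnorm (M * D - D * M) \<le> 2 * mat_opnorm M * opdist D (A G) + 2 * mat_opnorm (D + G') * opdist (A G) (A G')"
          using commutator_transfer[OF Hc Ac Dc A(3)[OF GT(1)] A(3)[OF GT(2)]] unfolding MH .
        also have "\<dots> \<le> 2 * mat_opnorm M * (2 * \<eta>) + 2 * (R + 1) * (2 * \<omega>)"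
          using DA AA H' mat_opnorm_nonneg R(1) by (intro add_mono mult_mono) auto
        finally have comm: "mat_opnorm (M * D - D * M) \<le> 4 * \<eta> * mat_opnorm M + 4 * (R + 1) * \<omega>"
          by (simp add: algebra_simps)
        have "mat_opnorm (off_block k d M) \<le> (Cc - 1) * mat_opnorm (M * D - D * M)"
          unfolding D_def Cc_def using off_block_le_commutator[where d = d, OF fin _ Mc] d by simp
        also have "\<dots> \<le> Cc * (4 * \<eta> * mat_opnorm M + 4 * (R + 1) * \<omega>)"
          using comm Cc mat_opnorm_nonneg by (intro mult_mono) auto
        also have "\<dots> = 4 * (Cc * \<eta>) * mat_opnorm M + c1 * \<omega> / 2"
          by (simp add: c1_def algebra_simps)
        also have "\<dots> = mat_opnorm M / 2 + c1 * \<omega> / 2"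
          unfolding \<eta>(3) by simp
        finally have "mat_opnorm M \<le> 2 * mat_opnorm (diag_block k d M) + c1 * \<omega>"
          using mat_opnorm_le_blocks[OF Mc, of d] by simp
        moreover have "2 * c1 * \<omega> \<le> mat_opnorm M"
          using separatedD[OF T(4) GT neq] by (simp add: M_def)
        ultimately have "c1 * \<omega> / 2 \<le> mat_opnorm (diag_block k d M)"
          by simp
        then show "c1 * \<omega> / 2 \<le> opdist (diag_block k d G) (diag_block k d G')"
          unfolding M_def off_block_diff(2)[OF Gc[OF GT(1)] Gc[OF GT(2)]] .
      qed (use T c1 \<omega> in auto)
      also have "\<dots> \<le> (K / \<omega>) ^ card Q"
      proof (rule power_mono)
        have "2 * (real N)\<^sup>2 / (c1 * \<omega> / 2) = 4 / c1 * ((real N)\<^sup>2 / \<omega>)"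
          by simp
        also have "\<dots> \<le> 1 * ((real N)\<^sup>2 / \<omega>)"
          using c1 \<omega> by (intro mult_right_mono) auto
        finally have "1 + 2 * (real N)\<^sup>2 / (c1 * \<omega> / 2) \<le> 1 / \<omega> + (real N)\<^sup>2 / \<omega>"
          using \<omega> by (intro add_mono) auto
        also have "\<dots> \<le> K / \<omega>"
          using K(3) \<omega> by (simp add: add_divide_distrib[symmetric] divide_right_mono)
        finally show "1 + 2 * (real N)\<^sup>2 / (c1 * \<omega> / 2) \<le> K / \<omega>" .
      qed (use \<omega> c1 in auto)
      also have "\<dots> = (K / \<omega>) powr real (card Q)"
        using K(1) \<omega> by (simp add: powr_realpow)
      also have "\<dots> \<le> (K / \<omega>) powr ((real k)\<^sup>2 / real N + real k)"
        unfolding Q_def using card_congruent_pairs_le[OF N, of k] K(1) \<omega> by (intro powr_mono) auto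
      finally show ?thesis .
    qed
    define Z where "Z = (\<lambda>G. c (A G)) ` T"
    have "Z \<subseteq> c ` spectral_class k \<Lambda>"
      using A(1) by (auto simp: Z_def)
    then have cZ: "card Z \<le> card (c ` spectral_class k \<Lambda>)"
      using fc by (intro card_mono)
    have "T = (\<Union>z\<in>Z. {G\<in>T. c (A G) = z})"
      by (auto simp: Z_def)
    then have "card T = card (\<Union>z\<in>Z. {G\<in>T. c (A G) = z})"
      by (rule arg_cong)
    also have "\<dots> \<le> (\<Sum>z\<in>Z. card {G\<in>T. c (A G) = z})"
      using T(1) by (intro card_UN_le) (auto simp: Z_def)
    finally have "real (card T) \<le> real (\<Sum>z\<in>Z. card {G\<in>T. c (A G) = z})"
      by (rule of_nat_mono)
    also have "\<dots> = (\<Sum>z\<in>Z. real (card {G\<in>T. c (A G) = z}))"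
      by (rule of_nat_sum)
    also have "\<dots> \<le> (\<Sum>z\<in>Z. (K / \<omega>) powr ((real k)\<^sup>2 / real N + real k))"
      by (intro sum_mono fiber)
    also have "\<dots> = real (card Z) * (K / \<omega>) powr ((real k)\<^sup>2 / real N + real k)"
      by simp
    also have "\<dots> \<le> real (card (c ` spectral_class k \<Lambda>)) * (K / \<omega>) powr ((real k)\<^sup>2 / real N + real k)"
      using cZ by (intro mult_right_mono) auto
    finally have up: "real (card T) \<le> real (card (c ` spectral_class k \<Lambda>)) * (K / \<omega>) powr ((real k)\<^sup>2 / real N + real k)" .
    have "1 / (K * \<omega>) \<le> \<eta> / (2 * c1 * \<omega>)"
    proof -
      have "2 * c1 \<le> K * \<eta>"
        using K(2) \<eta>(1) by (simp add: field_simps)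
      then have "2 * c1 * \<omega> \<le> K * \<eta> * \<omega>"
        using \<omega> by (intro mult_right_mono) auto
      then show ?thesis
        using K(1) \<omega> c1 by (simp add: field_simps)
    qed
    then have "(1 / (K * \<omega>)) ^ (k\<^sup>2) \<le> (\<eta> / (2 * c1 * \<omega>)) ^ (k\<^sup>2)"
      using K(1) \<omega> by (intro power_mono) auto
    with T(5) up show ?thesis
      by linarith
  qed
  show ?thesis
    by (intro exI[of _ K] conjI allI impI K(1) main[unfolded N_def])
qed

section \<open>Covering numbers\<close>

lemma log_covering_number_le:
  assumes car: "S \<subseteq> carrier_mat k k" and "0 < \<omega>" and "1 \<le> B"
    and sep: "\<And>T. finite T \<Longrightarrow> T \<subseteq> S \<Longrightarrow> separated opdist \<omega> T \<Longrightarrow> real (card T) \<le> B"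
  shows "log_enat (covering_number S \<omega>) \<le> ereal (ln B)"
proof -
  have "\<exists>T. finite T \<and> T \<subseteq> S \<and> separated opdist \<omega> T \<and> (\<forall>A\<in>S. \<exists>A'\<in>T. opdist A A' < \<omega>)"
    using car \<open>0 < \<omega>\<close>
    by (intro maximal_separated_covers[OF sep])
      (auto intro: mat_opnorm_minus_commute simp: minus_r_inv_mat[of _ k k] mat_opnorm_zero subset_eq)
  then obtain T where T: "finite T" "T \<subseteq> S" "separated opdist \<omega> T" "\<And>A. A \<in> S \<Longrightarrow> \<exists>A'\<in>T. opdist A A' < \<omega>"
    by blast
  have "covering_number S \<omega> \<le> enat (card T)"
    unfolding covering_number_def by (rule INF_lower) (use T in auto)
  then obtain m where m: "covering_number S \<omega> = enat m" "m \<le> card T"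
    by (cases "covering_number S \<omega>") auto
  show ?thesis
  proof (cases "m = 0")
    case False
    have "real m \<le> B"
      using m(2) sep[OF T(1-3)] by linarith
    then show ?thesis
      using False by (simp add: m log_enat_def)
  qed (simp add: m log_enat_def)
qed

text \<open>
  In the absence of finite coverings the covering number, hence its logarithm, is infinite.
\<close>
lemma log_covering_number_ge:
  assumes "0 < b"
    and cov: "\<And>C. finite C \<Longrightarrow> C \<subseteq> S \<Longrightarrow> S \<subseteq> (\<Union>A\<in>C. {B. mat_opnorm (B - A) < \<omega>}) \<Longrightarrow> b \<le> real (card C)"
  shows "ereal (ln b) \<le> log_enat (covering_number S \<omega>)"
proof (cases "covering_number S \<omega>")
  case (enat m)
  let ?X = "(\<lambda>C. enat (card C)) ` {C. finite C \<and> C \<subseteq> S \<and> S \<subseteq> (\<Union>A\<in>C. {B. mat_opnorm (B - A) < \<omega>})}"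
  have "?X \<noteq> {}"
  proof
    assume "?X = {}"
    then have "covering_number S \<omega> = \<infinity>"
      unfolding covering_number_def by (simp only: Inf_enat_def) simp
    with enat show False
      by simp
  qed
  then have "covering_number S \<omega> \<in> ?X"
    unfolding covering_number_def by (meson ex_in_conv wellorder_InfI)
  then obtain C where C: "finite C" "C \<subseteq> S" "S \<subseteq> (\<Union>A\<in>C. {B. mat_opnorm (B - A) < \<omega>})" "m = card C"
    using enat by auto
  then have "b \<le> real m"
    using cov by blast
  then show ?thesis
    using \<open>0 < b\<close> by (auto simp: enat log_enat_def)
qed (simp add: log_enat_def)

lemma Gamma_top_carrier: "Gamma_top P R x k \<epsilon> r \<subseteq> carrier_mat k k"
  by (auto simp: Gamma_top_def selfadjoint_mats_def)

lemma ereal_divide_pos: "0 < b \<Longrightarrow> ereal a / ereal b = ereal (a / b)"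
  by simp

text \<open>
  One pair \<open>(\<epsilon>, r)\<close> serves for all \<open>R\<close>: the supremum over \<open>R\<close> is taken outside, so \<open>c\<close> must not
  depend on \<open>R\<close>.
\<close>
lemma delta_top_at_le:
  assumes \<omega>: "0 < \<omega>" "\<omega> < 1" and \<epsilon>: "0 < \<epsilon>" and r: "1 \<le> r"
    and B: "\<And>k. 1 \<le> k \<Longrightarrow> 1 \<le> B k" "\<And>k. 1 \<le> k \<Longrightarrow> ln (B k) \<le> c * ((real k)\<^sup>2 * (- ln \<omega>))"
    and sep: "\<And>R k T. 1 \<le> k \<Longrightarrow> finite T \<Longrightarrow> T \<subseteq> Gamma_top P R x k \<epsilon> r \<Longrightarrow> separated opdist \<omega> T \<Longrightarrow> real (card T) \<le> B k"
  shows "delta_top_at P x \<omega> \<le> ereal c"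
  unfolding delta_top_at_def
proof (rule SUP_least, rule INF_lower2[of "(\<epsilon>, r)"])
  show "(\<epsilon>, r) \<in> {0<..} \<times> {1..}"
    using \<epsilon> r by simp
  fix R :: real
  have "\<forall>\<^sub>F k in sequentially. log_enat (covering_number (Gamma_top P R x k \<epsilon> r) \<omega>) / ereal (- (real k)\<^sup>2 * ln \<omega>) \<le> ereal c"
    using eventually_ge_at_top[of "1::nat"]
  proof eventually_elim
    case (elim k)
    have pos: "0 < - (real k)\<^sup>2 * ln \<omega>"
      using elim \<omega> by (simp add: mult_pos_neg)
    have "log_enat (covering_number (Gamma_top P R x k \<epsilon> r) \<omega>) \<le> ereal (ln (B k))"
      using elim \<omega> B(1) sep by (intro log_covering_number_le[OF Gamma_top_carrier]) auto
    then have "log_enat (covering_number (Gamma_top P R x k \<epsilon> r) \<omega>) / ereal (- (real k)\<^sup>2 * ln \<omega>)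
        \<le> ereal (ln (B k)) / ereal (- (real k)\<^sup>2 * ln \<omega>)"
      using pos by (intro ereal_divide_right_mono) auto
    also have "\<dots> = ereal (ln (B k) / (- (real k)\<^sup>2 * ln \<omega>))"
      by (rule ereal_divide_pos[OF pos])
    also have "\<dots> \<le> ereal c"
    proof -
      have "ln (B k) \<le> c * (- (real k)\<^sup>2 * ln \<omega>)"
        using B(2)[of k] elim by simp
      then show ?thesis
        by (simp only: ereal_less_eq(3) pos_divide_le_eq[OF pos])
    qed
    finally show ?case .
  qed
  then show "(case (\<epsilon>, r) of (\<epsilon>, r) \<Rightarrow> limsup (\<lambda>k. log_enat (covering_number (Gamma_top P R x k \<epsilon> r) \<omega>) / ereal (- (real k)\<^sup>2 * ln \<omega>))) \<le> ereal c"
    unfolding prod.case by (rule Limsup_bounded)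
qed

section \<open>Matrices that approximate the element\<close>

lemma rational_poly_approximation:
  assumes "0 < \<delta>" "0 \<le> B"
  shows "\<exists>q\<in>rational_complex_polys. \<forall>t. cmod t \<le> B \<longrightarrow> cmod (poly q t - poly p t) \<le> \<delta>"
  using assms(1)
proof (induction p arbitrary: \<delta>)
  case 0
  then show ?case
    by (intro bexI[of _ 0]) (auto simp: rational_complex_polys_def)
next
  case (pCons a p)
  have "0 < \<delta> / (2 * (B + 1))"
    using pCons.prems assms(2) by simp
  from pCons.IH[OF this] obtain q where q: "q \<in> rational_complex_polys"
    "\<And>t. cmod t \<le> B \<Longrightarrow> cmod (poly q t - poly p t) \<le> \<delta> / (2 * (B + 1))"
    by blast
  have dense: "\<exists>u\<in>\<rat>. \<bar>u - v\<bar> \<le> \<delta> / 4" for v :: real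
    using Rats_dense_in_real[of "v - \<delta> / 4" v] pCons.prems by (auto intro!: bexI)
  obtain u v where uv: "u \<in> \<rat>" "\<bar>u - Re a\<bar> \<le> \<delta> / 4" "v \<in> \<rat>" "\<bar>v - Im a\<bar> \<le> \<delta> / 4"
    using dense by metis
  define b where "b = Complex u v"
  have ba: "cmod (b - a) \<le> \<delta> / 2"
    using cmod_le[of "b - a"] uv by (simp add: b_def)
  have "pCons b q \<in> rational_complex_polys"
    using q(1) uv(1,3) by (auto simp: rational_complex_polys_def coeff_pCons b_def split: nat.split)
  moreover have "cmod (poly (pCons b q) t - poly (pCons a p) t) \<le> \<delta>" if t: "cmod t \<le> B" for t
  proof -
    have "poly (pCons b q) t - poly (pCons a p) t = (b - a) + t * (poly q t - poly p t)"
      by (simp add: algebra_simps)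
    then have "cmod (poly (pCons b q) t - poly (pCons a p) t) \<le> cmod (b - a) + cmod t * cmod (poly q t - poly p t)"
      by (metis norm_mult norm_triangle_ineq)
    also have "\<dots> \<le> \<delta> / 2 + B * (\<delta> / (2 * (B + 1)))"
      using ba q(2)[OF t] t assms(2) by (intro add_mono mult_mono) auto
    also have "B * (\<delta> / (2 * (B + 1))) \<le> \<delta> / 2"
      using pCons.prems assms(2) by (simp add: field_simps)
    finally show ?thesis
      by simp
  qed
  ultimately show ?case
    by blast
qed

lemma variable_rational_poly: "[:0, 1:] \<in> rational_complex_polys"
  by (auto simp: rational_complex_polys_def coeff_pCons split: nat.split)

lemma cstar_poly_variable: "cstar_poly [:0, 1:] (x::'a::unital_cstar_algebra) = x"
  using cstar_poly_linear[of 0 x] by (simp add: scaleC_zero_left)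

lemma cstar_spectrum_of_real_Re:
  assumes "star x = (x::'a::unital_cstar_algebra)" "z \<in> cstar_spectrum x"
  shows "complex_of_real (Re z) = z"
  using cstar_spectrum_real[OF assms] by (simp add: complex_eq_iff)

lemma Gamma_top_diagonalization:
  assumes "A \<in> Gamma_top P R x k \<epsilon> r"
  obtains U a where "unitary_mat k U" "A = unitary_rdiag k U a"
    "\<And>j i. j \<in> {1..r} \<Longrightarrow> i < k \<Longrightarrow> cmod (poly (P j) (complex_of_real (a i))) \<le> norm (cstar_poly (P j) x) + \<epsilon>"
proof -
  have A: "A \<in> carrier_mat k k" "mat_adjoint A = A"
    and G: "\<And>j. j \<in> {1..r} \<Longrightarrow> \<bar>mat_opnorm (mat_poly (P j) A) - norm (cstar_poly (P j) x)\<bar> \<le> \<epsilon>"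
    using assms by (auto simp: Gamma_top_def selfadjoint_mats_def)
  obtain U a where U: "unitary_mat k U" "A = unitary_rdiag k U a"
    using selfadjoint_unitary_diagonalization[OF A] by blast
  have "cmod (poly (P j) (complex_of_real (a i))) \<le> norm (cstar_poly (P j) x) + \<epsilon>" if "j \<in> {1..r}" "i < k" for j i
  proof -
    have "cmod (poly (P j) (complex_of_real (a i))) \<le> mat_opnorm (mat_poly (P j) A)"
      unfolding U(2) mat_poly_unitary_diag[OF U(1)]
      by (rule mat_opnorm_unitary_diag_ge[OF U(1) that(2), of "\<lambda>i. poly (P j) (complex_of_real (a i))"])
    then show ?thesis
      using G[OF that(1)] by linarith
  qed
  with U show ?thesis
    by (rule that)
qed

text \<open>
  A rational polynomial close to the one with root set \<open>\<sigma>\<close> nearly vanishes at \<open>x\<close>, so it is small at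
  every eigenvalue of \<open>A\<close>. Including the variable itself among the test polynomials bounds these
  eigenvalues independently of \<open>R\<close>, as the approximation requires.
\<close>
lemma Gamma_top_near_spectral_class:
  fixes x :: "'a::unital_cstar_algebra"
  assumes P: "P ` {1..} = rational_complex_polys" and sa: "star x = x" and fin: "finite (cstar_spectrum x)"
    and \<theta>: "0 < \<theta>"
  shows "\<exists>\<epsilon>>0. \<exists>r\<ge>1. \<forall>R k. \<forall>A\<in>Gamma_top P R x k \<epsilon> r. \<exists>A'\<in>spectral_class k (Re ` cstar_spectrum x). opdist A A' \<le> \<theta>"
proof -
  define \<Lambda> where "\<Lambda> = Re ` cstar_spectrum x"
  have \<Lambda>: "finite \<Lambda>" "\<Lambda> \<noteq> {}"
    using fin norm_cstar_poly_attained[OF sa] by (auto simp: \<Lambda>_def)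
  define q where "q = (\<Prod>l\<in>\<Lambda>. [:- complex_of_real l, 1:])"
  have q: "poly q t = (\<Prod>l\<in>\<Lambda>. t - complex_of_real l)" for t
    by (simp add: q_def poly_prod)
  \<comment> \<open>An eigenvalue farther than \<open>\<theta>\<close> from \<open>\<Lambda>\<close> would make \<open>|q|\<close> exceed \<open>3 \<delta>\<close>: one \<open>\<delta>\<close> is lost at the eigenvalue, one at \<open>x\<close>, one to \<open>\<epsilon>\<close>.\<close>
  define \<delta> where "\<delta> = \<theta> ^ card \<Lambda> / 3"
  have \<delta>: "0 < \<delta>"
    using \<theta> by (simp add: \<delta>_def)
  define B where "B = norm x + 1"
  have B: "0 \<le> B"
    by (simp add: B_def add_nonneg_nonneg)
  obtain q' where q': "q' \<in> rational_complex_polys" "\<And>t. cmod t \<le> B \<Longrightarrow> cmod (poly q' t - poly q t) \<le> \<delta>"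
    using rational_poly_approximation[OF \<delta> B] by blast
  obtain j1 j2 where j: "1 \<le> j1" "P j1 = q'" "1 \<le> j2" "P j2 = [:0, 1:]"
    using q'(1) variable_rational_poly unfolding P[symmetric] by (metis atLeast_iff imageE)
  define \<epsilon> where "\<epsilon> = min 1 \<delta>"
  define r where "r = max j1 j2"
  have jr: "j1 \<in> {1..r}" "j2 \<in> {1..r}" "1 \<le> r"
    using j by (auto simp: r_def)
  have "\<exists>A'\<in>spectral_class k \<Lambda>. opdist A A' \<le> \<theta>" if AG: "A \<in> Gamma_top P R x k \<epsilon> r" for R k A
  proof -
    obtain U a where U: "unitary_mat k U" "A = unitary_rdiag k U a"
      and est: "\<And>j i. j \<in> {1..r} \<Longrightarrow> i < k \<Longrightarrow> cmod (poly (P j) (complex_of_real (a i))) \<le> norm (cstar_poly (P j) x) + \<epsilon>"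
      using Gamma_top_diagonalization[OF AG] by blast
    have near: "\<exists>l\<in>\<Lambda>. \<bar>a i - l\<bar> \<le> \<theta>" if i: "i < k" for i
    proof (rule ccontr)
      assume "\<not> ?thesis"
      then have far: "\<And>l. l \<in> \<Lambda> \<Longrightarrow> \<theta> < \<bar>a i - l\<bar>"
        by (auto simp: not_le)
      have "cmod (poly q (complex_of_real (a i))) = (\<Prod>l\<in>\<Lambda>. \<bar>a i - l\<bar>)"
        by (simp add: q prod_norm[symmetric] flip: of_real_diff)
      also have "\<dots> > (\<Prod>l\<in>\<Lambda>. \<theta>)"
      proof -
        obtain l where "l \<in> \<Lambda>"
          using \<Lambda>(2) by blast
        then show ?thesis
          using far \<theta> \<Lambda>(1) by (intro prod_mono_strict[of l]) (auto simp del: zero_less_abs_iff intro: less_imp_le less_trans[OF \<theta>])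
      qed
      finally have "3 * \<delta> < cmod (poly q (complex_of_real (a i)))"
        by (simp add: \<delta>_def)
      moreover have "cmod (complex_of_real (a i)) \<le> B"
        using est[OF jr(2) i] by (simp add: j cstar_poly_variable B_def \<epsilon>_def)
      then have "cmod (poly q' (complex_of_real (a i)) - poly q (complex_of_real (a i))) \<le> \<delta>"
        by (rule q'(2))
      moreover have "cmod (poly q' (complex_of_real (a i))) \<le> norm (cstar_poly q' x) + \<delta>"
        using est[OF jr(1) i] by (simp add: j \<epsilon>_def)
      moreover have "norm (cstar_poly q' x) \<le> \<delta>"
      proof -
        obtain z where z: "z \<in> cstar_spectrum x" "cmod (poly q' z) = norm (cstar_poly q' x)"
          using norm_cstar_poly_attained[OF sa] by blast
        have "Re z \<in> \<Lambda>" "z - complex_of_real (Re z) = 0"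
          using z(1) cstar_spectrum_of_real_Re[OF sa z(1)] by (auto simp: \<Lambda>_def)
        then have "poly q z = 0"
          unfolding q using \<Lambda>(1) by (auto simp: prod_zero_iff)
        then show ?thesis
          using q'(2)[of z] z(2) cstar_spectrum_norm_le[OF z(1)] by (simp add: B_def)
      qed
      moreover have "cmod (poly q (complex_of_real (a i))) \<le>
          cmod (poly q' (complex_of_real (a i))) + cmod (poly q' (complex_of_real (a i)) - poly q (complex_of_real (a i)))"
        by (metis norm_triangle_sub norm_minus_commute)
      ultimately show False
        by linarith
    qed
    then obtain b where b: "\<And>i. i < k \<Longrightarrow> b i \<in> \<Lambda>" "\<And>i. i < k \<Longrightarrow> \<bar>a i - b i\<bar> \<le> \<theta>"
      by metis
    define A' where "A' = unitary_rdiag k U b"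
    have "opdist A A' \<le> \<theta>"
      unfolding U(2) A'_def unitary_diag_diff[OF unitary_mat_carrier[OF U(1)]] using \<theta> b(2)
      by (intro mat_opnorm_unitary_diag_le U(1)) (auto simp flip: of_real_diff)
    moreover have "A' \<in> spectral_class k \<Lambda>"
      unfolding A'_def spectral_class_def using U(1) b(1)
      by (intro CollectI exI[of _ U] exI[of _ b]) simp
    ultimately show ?thesis
      by blast
  qed
  then show ?thesis
    using \<delta> jr(3) unfolding \<Lambda>_def[symmetric] by (intro exI[of _ \<epsilon>] conjI exI[of _ r]) (auto simp: \<epsilon>_def)
qed

text \<open>
  A separated subset of the matrix approximants stays separated, at half the scale, when each matrix is
  moved to the spectral class of the spectrum.
\<close>
theorem delta_top_at_le_finite_spectrum:
  fixes x :: "'a::unital_cstar_algebra"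
  assumes P: "P ` {1..} = rational_complex_polys" and sa: "star x = x" and fin: "finite (cstar_spectrum x)"
  shows "\<exists>K. \<forall>\<omega>. 0 < \<omega> \<longrightarrow> \<omega> < 1 \<longrightarrow>
    delta_top_at P x \<omega> \<le> ereal (1 - 1 / real (card (cstar_spectrum x)) + K / (- ln \<omega>))"
proof -
  define \<Lambda> where "\<Lambda> = Re ` cstar_spectrum x"
  have \<Lambda>: "finite \<Lambda>" "\<Lambda> \<noteq> {}"
    using fin norm_cstar_poly_attained[OF sa] by (auto simp: \<Lambda>_def)
  have "inj_on Re (cstar_spectrum x)"
    using cstar_spectrum_of_real_Re[OF sa] by (metis inj_onI)
  then have card: "card \<Lambda> = card (cstar_spectrum x)"
    by (simp add: \<Lambda>_def card_image)
  define n where "n = real (card \<Lambda>)"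
  have n: "1 \<le> n"
    using \<Lambda> by (simp add: n_def Suc_le_eq card_gt_0_iff)
  obtain C where C: "1 \<le> C"
    and CB: "\<And>k \<omega> T. 0 < \<omega> \<Longrightarrow> \<omega> \<le> 1 \<Longrightarrow> finite T \<Longrightarrow> T \<subseteq> spectral_class k \<Lambda> \<Longrightarrow> separated opdist \<omega> T \<Longrightarrow>
      real (card T) \<le> C ^ (k\<^sup>2) * (C / \<omega>) powr ((real k)\<^sup>2 * (1 - 1 / n))"
    using spectral_class_separated_card_le[OF \<Lambda>] unfolding n_def by blast
  define K where "K = ln C + ln (2 * C)"
  have "delta_top_at P x \<omega> \<le> ereal (1 - 1 / n + K / (- ln \<omega>))" if \<omega>: "0 < \<omega>" "\<omega> < 1" for \<omega>
  proof -
    have "0 < \<omega> / 4"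
      using \<omega> by simp
    from Gamma_top_near_spectral_class[OF P sa fin this] obtain \<epsilon> r where er: "0 < \<epsilon>" "1 \<le> r"
      and near: "\<And>R k A. A \<in> Gamma_top P R x k \<epsilon> r \<Longrightarrow> \<exists>A'\<in>spectral_class k \<Lambda>. opdist A A' \<le> \<omega> / 4"
      unfolding \<Lambda>_def by blast
    let ?B = "\<lambda>k. C ^ (k\<^sup>2) * (C / (\<omega> / 2)) powr ((real k)\<^sup>2 * (1 - 1 / n))"
    have base: "1 \<le> C / (\<omega> / 2)"
      using C \<omega> by (simp add: field_simps)
    have ex: "0 \<le> (real k)\<^sup>2 * (1 - 1 / n)" for k
      using n by simp
    show ?thesis
    proof (rule delta_top_at_le[OF \<omega> er, where B = ?B])
      fix k :: nat
      show "1 \<le> ?B k"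
        using C base ex[of k] mult_mono[of 1 "C ^ (k\<^sup>2)" 1 "(C / (\<omega> / 2)) powr ((real k)\<^sup>2 * (1 - 1 / n))"]
        by (simp add: one_le_power ge_one_powr_ge_zero)
      have "ln (?B k) = (real k)\<^sup>2 * ln C + (real k)\<^sup>2 * (1 - 1 / n) * ln (C / (\<omega> / 2))"
        using C \<omega> by (simp add: ln_mult ln_realpow ln_powr del: powr_mult)
      also have "ln (C / (\<omega> / 2)) = ln (2 * C) + (- ln \<omega>)"
        using C \<omega> by (simp add: ln_div ln_mult)
      finally have ln: "ln (?B k) = (real k)\<^sup>2 * (ln C + (1 - 1 / n) * (ln (2 * C) + (- ln \<omega>)))"
        by (simp add: algebra_simps)
      have "(1 - 1 / n) * ln (2 * C) \<le> 1 * ln (2 * C)"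
        using n C by (intro mult_right_mono) auto
      then have "ln C + (1 - 1 / n) * (ln (2 * C) + (- ln \<omega>)) \<le> K + (1 - 1 / n) * (- ln \<omega>)"
        unfolding K_def distrib_left[of "1 - 1 / n"] by linarith
      also have "\<dots> = (1 - 1 / n + K / (- ln \<omega>)) * (- ln \<omega>)"
        using \<omega> by (simp add: field_simps)
      finally have "(real k)\<^sup>2 * (ln C + (1 - 1 / n) * (ln (2 * C) + (- ln \<omega>)))
          \<le> (real k)\<^sup>2 * ((1 - 1 / n + K / (- ln \<omega>)) * (- ln \<omega>))"
        by (intro mult_left_mono) auto
      then show "ln (?B k) \<le> (1 - 1 / n + K / (- ln \<omega>)) * ((real k)\<^sup>2 * (- ln \<omega>))"
        unfolding ln by (simp only: mult_ac)
    next
      fix R k T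
      assume T: "finite T" "T \<subseteq> Gamma_top P R x k \<epsilon> r" "separated opdist \<omega> T"
      have "\<forall>A\<in>T. \<exists>A'. A' \<in> spectral_class k \<Lambda> \<and> opdist A A' \<le> \<omega> / 4"
        using near T(2) by (meson subsetD)
      from bchoice[OF this] obtain f where f: "\<And>A. A \<in> T \<Longrightarrow> f A \<in> spectral_class k \<Lambda>"
          "\<And>A. A \<in> T \<Longrightarrow> opdist A (f A) \<le> \<omega> / 4"
        by blast
      have sep: "\<omega> / 2 \<le> opdist (f A) (f A')" if AA: "A \<in> T" "A' \<in> T" "A \<noteq> A'" for A A'
      proof -
        have car: "A \<in> carrier_mat k k" "A' \<in> carrier_mat k k" "f A \<in> carrier_mat k k" "f A' \<in> carrier_mat k k"
          using AA T(2) Gamma_top_carrier[of P R x k \<epsilon> r] f(1) spectral_class_carrier by blast+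
        have "opdist A A' \<le> opdist A (f A) + (opdist (f A) (f A') + opdist (f A') A')"
          using mat_opnorm_diff_triangle[OF car(1,3,2)] mat_opnorm_diff_triangle[OF car(3,4,2)] by linarith
        moreover have "opdist (f A') A' = opdist A' (f A')"
          using car by (intro mat_opnorm_minus_commute)
        ultimately show ?thesis
          using separatedD[OF T(3) AA] f(2)[OF AA(1)] f(2)[OF AA(2)] by linarith
      qed
      have "inj_on f T"
      proof (rule inj_onI, rule ccontr)
        fix A A'
        assume AA: "A \<in> T" "A' \<in> T" "f A = f A'" "A \<noteq> A'"
        then have "\<omega> / 2 \<le> opdist (f A) (f A)"
          using sep[of A A'] by simp
        then show False
          using \<omega> minus_r_inv_mat[OF spectral_class_carrier[OF f(1)[OF AA(1)]]] by (simp add: mat_opnorm_zero)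
      qed
      then have "real (card T) = real (card (f ` T))"
        by (simp add: card_image)
      also have "\<dots> \<le> ?B k"
      proof (rule CB)
        show "separated opdist (\<omega> / 2) (f ` T)"
          unfolding separated_def using sep by blast
      qed (use \<omega> T f in auto)
      finally show "real (card T) \<le> ?B k" .
    qed
  qed
  then show ?thesis
    unfolding n_def card by blast
qed

text \<open>
  The variable as a test polynomial confines the approximants to a ball of fixed radius in a space of
  dimension \<open>k\<^sup>2\<close>.
\<close>
theorem delta_top_at_le_general:
  fixes x :: "'a::unital_cstar_algebra"
  assumes P: "P ` {1..} = rational_complex_polys"
  shows "\<exists>K. \<forall>\<omega>. 0 < \<omega> \<longrightarrow> \<omega> < 1 \<longrightarrow> delta_top_at P x \<omega> \<le> ereal (1 + K / (- ln \<omega>))"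
proof -
  define C where "C = 1 + 2 * (norm x + 1)"
  have C: "1 \<le> C"
    by (simp add: C_def)
  have one: "(0::real) < 1"
    by simp
  obtain r where r: "1 \<le> r" "P r = [:0, 1:]"
    using variable_rational_poly unfolding P[symmetric] by (metis atLeast_iff imageE)
  have "delta_top_at P x \<omega> \<le> ereal (1 + ln C / (- ln \<omega>))" if \<omega>: "0 < \<omega>" "\<omega> < 1" for \<omega>
  proof (rule delta_top_at_le[where \<epsilon> = 1 and r = r, OF \<omega> one r(1), where B = "\<lambda>k. (C / \<omega>) ^ (k\<^sup>2)"])
    fix k :: nat
    show "1 \<le> (C / \<omega>) ^ (k\<^sup>2)"
      using C \<omega> by (intro one_le_power) (simp add: field_simps)
    have "ln ((C / \<omega>) ^ (k\<^sup>2)) = (real k)\<^sup>2 * (ln C + (- ln \<omega>))"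
      using C \<omega> by (simp add: ln_realpow ln_div)
    also have "ln C + (- ln \<omega>) = (1 + ln C / (- ln \<omega>)) * (- ln \<omega>)"
      using \<omega> by (simp add: field_simps)
    finally show "ln ((C / \<omega>) ^ (k\<^sup>2)) \<le> (1 + ln C / (- ln \<omega>)) * ((real k)\<^sup>2 * (- ln \<omega>))"
      by (simp only: mult_ac order_refl)
  next
    fix R k T
    assume T: "finite T" "T \<subseteq> Gamma_top P R x k 1 r" "separated opdist \<omega> T"
    have full: "{..<k} \<times> {..<k} \<subseteq> {..<k} \<times> {..<k}" "sym ({..<k} \<times> {..<k})" "card ({..<k} \<times> {..<k}) = k\<^sup>2"
      by (auto simp: sym_def card_cartesian_product power2_eq_square)
    have "real (card T) \<le> (1 + 2 * (norm x + 1) / \<omega>) ^ card ({..<k} \<times> {..<k})"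
    proof (rule selfadjoint_separated_card_le[OF full(1,2) T(1), where \<phi> = "\<lambda>A. A"])
      fix A
      assume A: "A \<in> T"
      then show "A \<in> selfadjoint_mats k"
        using T(2) by (auto simp: Gamma_top_def)
      obtain U a where U: "unitary_mat k U" "A = unitary_rdiag k U a"
        and est: "\<And>j i. j \<in> {1..r} \<Longrightarrow> i < k \<Longrightarrow> cmod (poly (P j) (complex_of_real (a i))) \<le> norm (cstar_poly (P j) x) + 1"
        using Gamma_top_diagonalization[of A P R x k 1 r] A T(2) by blast
      show "mat_opnorm A \<le> norm x + 1"
        unfolding U(2) using est[of r] r
        by (intro mat_opnorm_unitary_diag_le U(1)) (auto simp: cstar_poly_variable add_nonneg_nonneg)
    qed (use \<omega> T(3) in \<open>auto dest: separatedD simp: add_nonneg_nonneg\<close>)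
    also have "\<dots> \<le> (C / \<omega>) ^ (k\<^sup>2)"
      unfolding full(3)
    proof (rule power_mono)
      have "1 + 2 * (norm x + 1) / \<omega> \<le> 1 / \<omega> + 2 * (norm x + 1) / \<omega>"
        using \<omega> by (intro add_mono) auto
      then show "1 + 2 * (norm x + 1) / \<omega> \<le> C / \<omega>"
        by (simp add: C_def add_divide_distrib)
    qed (use \<omega> in \<open>auto simp: add_nonneg_nonneg\<close>)
    finally show "real (card T) \<le> (C / \<omega>) ^ (k\<^sup>2)" .
  qed
  then show ?thesis
    by blast
qed

text \<open>
  Diagonalizing \<open>A - A'\<close> exhibits its eigenvalues among those of the difference of the direct sums.
\<close>
lemma direct_sum_opdist_ge:
  assumes A: "A \<in> selfadjoint_mats k" "A' \<in> selfadjoint_mats k" and B: "B \<in> carrier_mat m m"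
  shows "opdist A A' \<le> opdist (direct_sum A B) (direct_sum A' B)"
proof -
  have car: "A \<in> carrier_mat k k" "A' \<in> carrier_mat k k"
    using A by (auto intro: selfadjoint_mats_carrier)
  have M: "A - A' \<in> carrier_mat k k" "mat_adjoint (A - A') = A - A'"
    using A car by (auto simp: selfadjoint_mats_def mat_adjoint_diff[of _ k k] minus_carrier_mat)
  obtain U e where U: "unitary_mat k U" "A - A' = unitary_rdiag k U e"
    using selfadjoint_unitary_diagonalization[OF M] by blast
  have zero: "0\<^sub>m m m = unitary_diag m (1\<^sub>m m) (\<lambda>_. 0 :: complex)"
    by (rule unitary_diag_zero[symmetric]) auto
  define e' where "e' = (\<lambda>i. if i < k then complex_of_real (e i) else 0)"
  have "direct_sum A B - direct_sum A' B = direct_sum (A - A') (0\<^sub>m m m)"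
    using car B by (intro eq_matI) (auto simp: direct_sum_def)
  also have "\<dots> = unitary_diag (k + m) (direct_sum U (1\<^sub>m m)) e'"
    unfolding zero U(2) direct_sum_unitary_diag[OF U(1) unitary_mat_one] e'_def ..
  finally have eq: "direct_sum A B - direct_sum A' B = unitary_diag (k + m) (direct_sum U (1\<^sub>m m)) e'" .
  have "cmod (complex_of_real (e i)) \<le> opdist (direct_sum A B) (direct_sum A' B)" if "i < k" for i
    using mat_opnorm_unitary_diag_ge[OF unitary_direct_sum[OF U(1) unitary_mat_one[of m]], of i e'] that
    unfolding eq by (simp add: e'_def)
  then show ?thesis
    unfolding U(2) by (intro mat_opnorm_unitary_diag_le U(1) mat_opnorm_nonneg)
qed

text \<open>
  All eigenvalues lie in the spectrum, and the summand contributes points at which the test polynomials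
  attain their norms; so the norms of the test polynomials agree exactly with those at \<open>x\<close>.
\<close>
lemma direct_sum_mem_Gamma_top:
  fixes x :: "'a::unital_cstar_algebra"
  assumes sa: "star x = x" and \<Lambda>: "\<Lambda> \<subseteq> Re ` cstar_spectrum x" and A: "A \<in> spectral_class k \<Lambda>"
    and F: "\<And>i. i < m \<Longrightarrow> F i \<in> Re ` cstar_spectrum x"
    and att: "\<And>j. j \<in> {1..r} \<Longrightarrow> \<exists>i<m. cmod (poly (P j) (complex_of_real (F i))) = norm (cstar_poly (P j) x)"
    and "0 < \<epsilon>" "norm x \<le> R"
  shows "direct_sum A (rdiag m F) \<in> Gamma_top P R x (k + m) \<epsilon> r"
proof -
  obtain U d where U: "unitary_mat k U" "\<forall>i<k. d i \<in> \<Lambda>" "A = unitary_rdiag k U d"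
    using A by (auto simp: spectral_class_def)
  define g where "g = (\<lambda>i. if i < k then d i else F (i - k))"
  define V where "V = direct_sum U (1\<^sub>m m)"
  have V: "unitary_mat (k + m) V"
    unfolding V_def by (rule unitary_direct_sum[OF U(1) unitary_mat_one])
  have "direct_sum A (rdiag m F) =
      unitary_diag (k + m) V (\<lambda>i. if i < k then complex_of_real (d i) else complex_of_real (F (i - k)))"
    unfolding mat_diag_eq_unitary_diag U(3) V_def by (rule direct_sum_unitary_diag[OF U(1) unitary_mat_one])
  also have "(\<lambda>i. if i < k then complex_of_real (d i) else complex_of_real (F (i - k))) = (\<lambda>i. complex_of_real (g i))"
    by (auto simp: g_def)
  finally have eq: "direct_sum A (rdiag m F) = unitary_rdiag (k + m) V g" .
  have g: "complex_of_real (g i) \<in> cstar_spectrum x" if i: "i < k + m" for i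
  proof -
    have "g i \<in> Re ` cstar_spectrum x"
      using i U(2) \<Lambda> F by (auto simp: g_def)
    then show ?thesis
      using cstar_spectrum_of_real_Re[OF sa] by auto
  qed
  have "0 \<le> R"
    using \<open>norm x \<le> R\<close> norm_ge_zero[of x] by linarith
  then have "mat_opnorm (unitary_rdiag (k + m) V g) \<le> R"
    using cstar_spectrum_norm_le[OF g] \<open>norm x \<le> R\<close>
    by (intro mat_opnorm_unitary_diag_le V) (auto intro: order.trans simp del: norm_of_real)
  moreover have "mat_opnorm (mat_poly (P j) (unitary_rdiag (k + m) V g)) = norm (cstar_poly (P j) x)"
    if j: "j \<in> {1..r}" for j
    unfolding mat_poly_unitary_diag[OF V]
  proof (rule antisym)
    show "mat_opnorm (unitary_diag (k + m) V (\<lambda>a. poly (P j) (complex_of_real (g a)))) \<le> norm (cstar_poly (P j) x)"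
      using cstar_spectrum_poly_le_norm[OF g] by (intro mat_opnorm_unitary_diag_le V) auto
    obtain i where i: "i < m" "cmod (poly (P j) (complex_of_real (F i))) = norm (cstar_poly (P j) x)"
      using att[OF j] by blast
    show "norm (cstar_poly (P j) x) \<le> mat_opnorm (unitary_diag (k + m) V (\<lambda>a. poly (P j) (complex_of_real (g a))))"
      using mat_opnorm_unitary_diag_ge[OF V, of "k + i" "\<lambda>a. poly (P j) (complex_of_real (g a))"] i by (simp add: g_def)
  qed
  moreover have "unitary_rdiag (k + m) V g \<in> selfadjoint_mats (k + m)"
    using V unfolding selfadjoint_mats_def by (simp add: mat_adjoint_unitary_diag unitary_mat_carrier)
  ultimately show ?thesis
    unfolding eq Gamma_top_def using \<open>0 < \<epsilon>\<close> by auto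
qed

text \<open>
  Given \<open>r\<close>, a summand of size \<open>r\<close> suffices for the test polynomials, whatever the matrix size. A covering
  of the approximants of size \<open>k + r\<close> then discretizes the spectral class of size \<open>k\<close>, and the
  fixed shift by \<open>r\<close> disappears in the limit. The constant \<open>K\<close> is independent of \<open>\<epsilon>\<close> and \<open>r\<close>.
\<close>
theorem delta_top_at_ge:
  fixes x :: "'a::unital_cstar_algebra"
  assumes sa: "star x = x" and S: "S \<subseteq> cstar_spectrum x" "finite S" "S \<noteq> {}"
  shows "\<exists>K. \<forall>\<omega>. 0 < \<omega> \<longrightarrow> \<omega> < 1 \<longrightarrow> ereal (1 - 1 / real (card S) - K / (- ln \<omega>)) \<le> delta_top_at P x \<omega>"
proof -
  define \<Lambda> where "\<Lambda> = Re ` S"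
  have \<Lambda>: "finite \<Lambda>" "\<Lambda> \<noteq> {}" "\<Lambda> \<subseteq> Re ` cstar_spectrum x"
    using S by (auto simp: \<Lambda>_def)
  have "inj_on Re S"
    using cstar_spectrum_of_real_Re[OF sa] S(1) by (metis inj_onI subsetD)
  then have card: "card \<Lambda> = card S"
    by (simp add: \<Lambda>_def card_image)
  define n where "n = real (card \<Lambda>)"
  have n: "1 \<le> n"
    using \<Lambda> by (simp add: n_def Suc_le_eq card_gt_0_iff)
  obtain K where K: "1 \<le> K"
    and KB: "\<And>k \<omega> (c :: complex mat \<Rightarrow> complex mat). 0 < \<omega> \<Longrightarrow> \<omega> \<le> 1 \<Longrightarrow> finite (c ` spectral_class k \<Lambda>) \<Longrightarrow>
      \<forall>A\<in>spectral_class k \<Lambda>. \<forall>A'\<in>spectral_class k \<Lambda>. c A = c A' \<longrightarrow> opdist A A' \<le> 2 * \<omega> \<Longrightarrow>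
      (1 / (K * \<omega>)) ^ (k\<^sup>2) \<le> real (card (c ` spectral_class k \<Lambda>)) * (K / \<omega>) powr ((real k)\<^sup>2 / n + real k)"
    using spectral_class_discretization_ge[OF \<Lambda>(1,2)] unfolding n_def by blast
  have "ereal (1 - 1 / n - (ln K * (1 + 1 / n)) / (- ln \<omega>)) \<le> delta_top_at P x \<omega>" if \<omega>: "0 < \<omega>" "\<omega> < 1" for \<omega>
    unfolding delta_top_at_def
  proof (rule SUP_upper2[of "norm x + 1"], simp add: add_nonneg_pos, rule INF_greatest)
    fix p :: "real \<times> nat"
    assume "p \<in> {0<..} \<times> {1..}"
    then obtain \<epsilon> r where p: "p = (\<epsilon>, r)" "0 < \<epsilon>"
      by auto
    let ?R = "norm x + 1"
    have "\<forall>j. \<exists>z\<in>cstar_spectrum x. cmod (poly (P j) z) = norm (cstar_poly (P j) x)"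
      using norm_cstar_poly_attained[OF sa] by blast
    then obtain z where z: "\<And>j. z j \<in> cstar_spectrum x" "\<And>j. cmod (poly (P j) (z j)) = norm (cstar_poly (P j) x)"
      by metis
    \<comment> \<open>Test polynomials are numbered from \<open>1\<close>, matrix positions from \<open>0\<close>.\<close>
    define F where "F = (\<lambda>i. Re (z (i + 1)))"
    have F: "F i \<in> Re ` cstar_spectrum x" for i
      using z(1) by (simp add: F_def)
    have att: "\<exists>i<r. cmod (poly (P j) (complex_of_real (F i))) = norm (cstar_poly (P j) x)" if "j \<in> {1..r}" for j
      using that z(2)[of j] cstar_spectrum_of_real_Re[OF sa z(1), of j] by (intro exI[of _ "j - 1"]) (auto simp: F_def)
    define L where "L = - ln \<omega>"
    have L: "0 < L"
      using \<omega> by (simp add: L_def)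
    define low where "low = (\<lambda>k. (real k)\<^sup>2 * (L - ln K) - ((real k)\<^sup>2 / n + real k) * (ln K + L))"
    have bound: "ereal (low k) \<le> log_enat (covering_number (Gamma_top P ?R x (k + r) \<epsilon> r) \<omega>)" for k
    proof -
      define b where "b = (1 / (K * \<omega>)) ^ (k\<^sup>2) / (K / \<omega>) powr ((real k)\<^sup>2 / n + real k)"
      have b: "0 < b"
        using K \<omega> by (simp add: b_def)
      have "ln b = low k"
        using K \<omega> by (simp add: b_def low_def L_def ln_div ln_realpow ln_mult ln_powr del: power_divide)
      moreover have "ereal (ln b) \<le> log_enat (covering_number (Gamma_top P ?R x (k + r) \<epsilon> r) \<omega>)"
      proof (rule log_covering_number_ge[OF b])
        fix C
        assume C: "finite C" "C \<subseteq> Gamma_top P ?R x (k + r) \<epsilon> r"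
          "Gamma_top P ?R x (k + r) \<epsilon> r \<subseteq> (\<Union>A\<in>C. {B. mat_opnorm (B - A) < \<omega>})"
        define DF where "DF = rdiag r F"
        have DF: "DF \<in> carrier_mat r r"
          by (simp add: DF_def)
        have mem: "direct_sum A DF \<in> Gamma_top P ?R x (k + r) \<epsilon> r" if "A \<in> spectral_class k \<Lambda>" for A
          unfolding DF_def using sa \<Lambda>(3) that F att p(2)
          by (intro direct_sum_mem_Gamma_top) auto
        have "\<forall>A\<in>spectral_class k \<Lambda>. \<exists>B. B \<in> C \<and> opdist (direct_sum A DF) B < \<omega>"
          using mem C(3) by blast
        from bchoice[OF this] obtain c where c: "\<And>A. A \<in> spectral_class k \<Lambda> \<Longrightarrow> c A \<in> C"
            "\<And>A. A \<in> spectral_class k \<Lambda> \<Longrightarrow> opdist (direct_sum A DF) (c A) < \<omega>"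
          by blast
        have sub: "c ` spectral_class k \<Lambda> \<subseteq> C"
          using c(1) by blast
        have "opdist A A' \<le> 2 * \<omega>" if AA: "A \<in> spectral_class k \<Lambda>" "A' \<in> spectral_class k \<Lambda>" "c A = c A'" for A A'
        proof -
          have car: "direct_sum A DF \<in> carrier_mat (k + r) (k + r)" "direct_sum A' DF \<in> carrier_mat (k + r) (k + r)"
              "c A \<in> carrier_mat (k + r) (k + r)"
            using mem[OF AA(1)] mem[OF AA(2)] c(1)[OF AA(1)] C(2) Gamma_top_carrier by blast+
          have "opdist A A' \<le> opdist (direct_sum A DF) (direct_sum A' DF)"
            using AA DF by (intro direct_sum_opdist_ge) (auto intro: spectral_class_selfadjoint)
          also have "\<dots> \<le> opdist (direct_sum A DF) (c A) + opdist (c A) (direct_sum A' DF)"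
            by (rule mat_opnorm_diff_triangle[OF car(1,3,2)])
          also have "opdist (c A) (direct_sum A' DF) = opdist (direct_sum A' DF) (c A')"
            using mat_opnorm_minus_commute[OF car(3,2)] AA(3) by simp
          finally show ?thesis
            using c(2)[OF AA(1)] c(2)[OF AA(2)] by linarith
        qed
        then have "(1 / (K * \<omega>)) ^ (k\<^sup>2) \<le> real (card (c ` spectral_class k \<Lambda>)) * (K / \<omega>) powr ((real k)\<^sup>2 / n + real k)"
          using \<omega> finite_subset[OF sub C(1)] by (intro KB) auto
        also have "\<dots> \<le> real (card C) * (K / \<omega>) powr ((real k)\<^sup>2 / n + real k)"
          using card_mono[OF C(1) sub] by (intro mult_right_mono) auto
        finally show "b \<le> real (card C)"
          using K \<omega> by (simp add: b_def divide_le_eq del: power_divide)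
      qed
      ultimately show ?thesis
        by simp
    qed
    define h where "h = (\<lambda>k. log_enat (covering_number (Gamma_top P ?R x k \<epsilon> r) \<omega>) / ereal (- (real k)\<^sup>2 * ln \<omega>))"
    define g where "g = (\<lambda>k. low k / ((real (k + r))\<^sup>2 * L))"
    have "(\<lambda>k. (real k)\<^sup>2 / (real k + real r)\<^sup>2) \<longlonglongrightarrow> 1" "(\<lambda>k. real k / (real k + real r)\<^sup>2) \<longlonglongrightarrow> 0"
      by real_asymp+
    then have "(\<lambda>k. ((real k)\<^sup>2 / (real k + real r)\<^sup>2 * (L - ln K) -
        ((real k)\<^sup>2 / (real k + real r)\<^sup>2 / n + real k / (real k + real r)\<^sup>2) * (ln K + L)) / L)
        \<longlonglongrightarrow> (1 * (L - ln K) - (1 / n + 0) * (ln K + L)) / L"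
      using n L by (intro tendsto_intros) auto
    also have "(\<lambda>k. ((real k)\<^sup>2 / (real k + real r)\<^sup>2 * (L - ln K) -
        ((real k)\<^sup>2 / (real k + real r)\<^sup>2 / n + real k / (real k + real r)\<^sup>2) * (ln K + L)) / L) = g"
      by (rule ext) (simp add: g_def low_def diff_divide_distrib add_divide_distrib distrib_right)
    also have "(1 * (L - ln K) - (1 / n + 0) * (ln K + L)) / L = 1 - 1 / n - (ln K * (1 + 1 / n)) / L"
      using L n by (simp add: field_simps)
    finally have "(\<lambda>k. ereal (g k)) \<longlonglongrightarrow> ereal (1 - 1 / n - (ln K * (1 + 1 / n)) / L)"
      by simp
    then have "ereal (1 - 1 / n - (ln K * (1 + 1 / n)) / L) = limsup (\<lambda>k. ereal (g k))"
      by (rule lim_imp_Limsup[OF sequentially_bot, symmetric])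
    also have "\<dots> \<le> limsup (\<lambda>k. h (k + r))"
    proof (rule Limsup_mono)
      show "\<forall>\<^sub>F k in sequentially. ereal (g k) \<le> h (k + r)"
        using eventually_ge_at_top[of "1::nat"]
      proof eventually_elim
        case (elim k)
        have pos: "0 < (real (k + r))\<^sup>2 * L"
          using elim L by simp
        have "- (real (k + r))\<^sup>2 * ln \<omega> = (real (k + r))\<^sup>2 * L"
          by (simp add: L_def)
        then have h: "h (k + r) = log_enat (covering_number (Gamma_top P ?R x (k + r) \<epsilon> r) \<omega>) / ereal ((real (k + r))\<^sup>2 * L)"
          unfolding h_def by (simp only:)
        have "ereal (g k) = ereal (low k) / ereal ((real (k + r))\<^sup>2 * L)"
          unfolding g_def by (rule ereal_divide_pos[OF pos, symmetric])
        also have "\<dots> \<le> h (k + r)"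
          unfolding h using bound pos by (intro ereal_divide_right_mono) auto
        finally show ?case .
      qed
    qed
    also have "\<dots> \<le> limsup h"
      using limsup_subseq_mono[of "\<lambda>k. k + r" h] by (simp add: strict_mono_def comp_def)
    finally show "ereal (1 - 1 / n - (ln K * (1 + 1 / n)) / (- ln \<omega>)) \<le>
        (case p of (\<epsilon>, r) \<Rightarrow> limsup (\<lambda>k. log_enat (covering_number (Gamma_top P ?R x k \<epsilon> r) \<omega>) / ereal (- (real k)\<^sup>2 * ln \<omega>)))"
      by (simp add: p h_def L_def)
  qed
  then show ?thesis
    unfolding n_def card by blast
qed

section \<open>The topological free entropy dimension\<close>

lemma eventually_unit_interval: "\<forall>\<^sub>F \<omega> in at_right (0::real). 0 < \<omega> \<and> \<omega> < 1"
  using eventually_at_right_real[of 0 "1::real"] by (auto elim: eventually_mono)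

lemma delta_top_le:
  assumes "\<And>\<omega>. 0 < \<omega> \<Longrightarrow> \<omega> < 1 \<Longrightarrow> delta_top_at P x \<omega> \<le> ereal (c + K / (- ln \<omega>))"
  shows "delta_top P x \<le> ereal c"
proof -
  have "((\<lambda>\<omega>. c + K / (- ln \<omega>)) \<longlongrightarrow> c) (at_right 0)"
    by real_asymp
  then have "((\<lambda>\<omega>. ereal (c + K / (- ln \<omega>))) \<longlongrightarrow> ereal c) (at_right 0)"
    by simp
  then have "Limsup (at_right 0) (\<lambda>\<omega>. ereal (c + K / (- ln \<omega>))) = ereal c"
    by (intro lim_imp_Limsup) auto
  moreover have "delta_top P x \<le> Limsup (at_right 0) (\<lambda>\<omega>. ereal (c + K / (- ln \<omega>)))"
    unfolding delta_top_def
    by (intro Limsup_mono eventually_mono[OF eventually_unit_interval]) (use assms in auto)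
  ultimately show ?thesis
    by simp
qed

lemma delta_top_ge:
  assumes "\<And>\<omega>. 0 < \<omega> \<Longrightarrow> \<omega> < 1 \<Longrightarrow> ereal (c - K / (- ln \<omega>)) \<le> delta_top_at P x \<omega>"
  shows "ereal c \<le> delta_top P x"
proof -
  have "((\<lambda>\<omega>. c - K / (- ln \<omega>)) \<longlongrightarrow> c) (at_right 0)"
    by real_asymp
  then have "((\<lambda>\<omega>. ereal (c - K / (- ln \<omega>))) \<longlongrightarrow> ereal c) (at_right 0)"
    by simp
  then have "Limsup (at_right 0) (\<lambda>\<omega>. ereal (c - K / (- ln \<omega>))) = ereal c"
    by (intro lim_imp_Limsup) auto
  moreover have "Limsup (at_right 0) (\<lambda>\<omega>. ereal (c - K / (- ln \<omega>))) \<le> delta_top P x"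
    unfolding delta_top_def
    by (intro Limsup_mono eventually_mono[OF eventually_unit_interval]) (use assms in auto)
  ultimately show ?thesis
    by simp
qed

theorem theorem4p1:
  fixes x :: "'a::unital_cstar_algebra"
    and P :: "nat \<Rightarrow> complex poly"
    and n :: enat
  assumes "P ` {1..} = rational_complex_polys"
    and "star x = x"
    and "n = (if finite (cstar_spectrum x) then enat (card (cstar_spectrum x)) else \<infinity>)"
  shows "delta_top P x = 1 - 1 / ereal_of_enat n"
proof (cases "finite (cstar_spectrum x)")
  case True
  let ?N = "card (cstar_spectrum x)"
  have ne: "cstar_spectrum x \<noteq> {}"
    using norm_cstar_poly_attained[OF assms(2)] by blast
  then have N: "0 < ?N"
    using True by (simp add: card_gt_0_iff)
  obtain K where "\<And>\<omega>. 0 < \<omega> \<Longrightarrow> \<omega> < 1 \<Longrightarrow> delta_top_at P x \<omega> \<le> ereal (1 - 1 / real ?N + K / (- ln \<omega>))"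
    using delta_top_at_le_finite_spectrum[OF assms(1,2) True] by blast
  then have "delta_top P x \<le> ereal (1 - 1 / real ?N)"
    by (rule delta_top_le)
  moreover obtain K' where "\<And>\<omega>. 0 < \<omega> \<Longrightarrow> \<omega> < 1 \<Longrightarrow> ereal (1 - 1 / real ?N - K' / (- ln \<omega>)) \<le> delta_top_at P x \<omega>"
    using delta_top_at_ge[OF assms(2) subset_refl True ne] by blast
  then have "ereal (1 - 1 / real ?N) \<le> delta_top P x"
    by (rule delta_top_ge)
  ultimately have "delta_top P x = ereal (1 - 1 / real ?N)"
    by (rule antisym)
  also have "\<dots> = 1 - 1 / ereal_of_enat n"
    using N ne by (simp add: assms(3) True one_ereal_def)
  finally show ?thesis .
next
  case False
  obtain K where "\<And>\<omega>. 0 < \<omega> \<Longrightarrow> \<omega> < 1 \<Longrightarrow> delta_top_at P x \<omega> \<le> ereal (1 + K / (- ln \<omega>))"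
    using delta_top_at_le_general[OF assms(1)] by blast
  then have up: "delta_top P x \<le> ereal 1"
    by (rule delta_top_le)
  have low: "ereal (1 - 1 / real (Suc N)) \<le> delta_top P x" for N
  proof -
    obtain S where S: "S \<subseteq> cstar_spectrum x" "finite S" "card S = Suc N"
      using infinite_arbitrarily_large[OF False] by blast
    then have "S \<noteq> {}"
      by auto
    then obtain K' where "\<And>\<omega>. 0 < \<omega> \<Longrightarrow> \<omega> < 1 \<Longrightarrow> ereal (1 - 1 / real (card S) - K' / (- ln \<omega>)) \<le> delta_top_at P x \<omega>"
      using delta_top_at_ge[OF assms(2) S(1,2)] by blast
    then have "ereal (1 - 1 / real (card S)) \<le> delta_top P x"
      by (rule delta_top_ge)
    then show ?thesis
      by (simp add: S(3))
  qed
  have "(\<lambda>N. 1 - 1 / real (Suc N)) \<longlonglongrightarrow> 1"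
    by real_asymp
  then have "(\<lambda>N. ereal (1 - 1 / real (Suc N))) \<longlonglongrightarrow> ereal 1"
    by simp
  then have "ereal 1 \<le> delta_top P x"
    by (rule LIMSEQ_le_const2) (use low in auto)
  with up have "delta_top P x = 1"
    by (simp add: one_ereal_def)
  then show ?thesis
    by (simp add: assms(3) False)
qed

end
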